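(* For the Lipschitz MAB problem on any fixed metric space $(X,\mathcal{D})$, the following dichotomy holds: either the problem is $f(t)$-tractable for every $f\in\omega(\log t)$, or it is not $g(t)$-tractable for any $g\in o(\sqrt t)$. Moreover, the former occurs if and only if the metric completion of $(X,\mathcal{D})$ is a compact metric space with countably many points.
   Context: Lipschitz MAB problem on a metric space $(X,\mathcal{D})$ (of diameter at most $1$): $(X,\mathcal{D})$ is known to the algorithm. A problem instance $I$ consists of an unknown payoff function $\mu:X\to[0,1]$ with $|\mu(x)-\mu(y)|\le\mathcal{D}(x,y)$ for all $x,y$, and for each $x$ a distribution on $[0,1]$ with mean $\mu(x)$. In each round $t$ the algorithm picks $x_t\in X$ and receives an independent reward from the distribution of $x_t$. Regret: $R(t)=t\sup_x\mu(x)-\mathbb{E}[\sum_{s\le t}\mu(x_s)]$. For a function $f:\mathbb{N}\to\mathbb{R}$, the problem is $f(t)$-tractable if there is an algorithm such that for every instance $I$ there is a constant $C_I$ with $R(t)\le C_I f(t)$ for all $t$. $f\in\omega(\log t)$ means $f(t)/\log t\to\infty$; $g\in o(\sqrt t)$ means $g(t)/\sqrt t\to0$.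
   Formalization: Functions f in ω(log t) are also required to satisfy f(t)>0 for all t≥1, and the regret bound is required for t≥1; otherwise f(t)=(log t)^2, with f(1)=0, refutes the claim on a two-point space. X is assumed nonempty, and algorithms and reward distributions Borel measurable. *)

theory Defs
  imports "HOL-Probability.Probability"
begin

section \<open>Metric completion\<close>

text \<open>Points are classes of Cauchy sequences, two sequences being identified when their mutual
  distance tends to 0.\<close>

definition cauchy_rel :: "'a set \<Rightarrow> ('a \<Rightarrow> 'a \<Rightarrow> real) \<Rightarrow> ((nat \<Rightarrow> 'a) \<times> (nat \<Rightarrow> 'a)) set" where
  "cauchy_rel X d = {(\<sigma>, \<tau>). Metric_space.MCauchy X d \<sigma> \<and> Metric_space.MCauchy X d \<tau> \<and>
     (\<lambda>n. d (\<sigma> n) (\<tau> n)) \<longlonglongrightarrow> 0}"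

definition completion_space :: "'a set \<Rightarrow> ('a \<Rightarrow> 'a \<Rightarrow> real) \<Rightarrow> (nat \<Rightarrow> 'a) set set" where
  "completion_space X d = {\<sigma>. Metric_space.MCauchy X d \<sigma>} // cauchy_rel X d"

text \<open>The value 0 off the completion is a dummy: \<^const>\<open>Metric_space\<close> asks for nonnegativity and
  symmetry on the whole type.\<close>

definition completion_dist ::
    "'a set \<Rightarrow> ('a \<Rightarrow> 'a \<Rightarrow> real) \<Rightarrow> (nat \<Rightarrow> 'a) set \<Rightarrow> (nat \<Rightarrow> 'a) set \<Rightarrow> real" where
  "completion_dist X d A B =
     (if A \<in> completion_space X d \<and> B \<in> completion_space X d
      then lim (\<lambda>n. d ((SOME \<sigma>. \<sigma> \<in> A) n) ((SOME \<tau>. \<tau> \<in> B) n)) else 0)"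

definition completion_embed :: "'a set \<Rightarrow> ('a \<Rightarrow> 'a \<Rightarrow> real) \<Rightarrow> 'a \<Rightarrow> (nat \<Rightarrow> 'a) set" where
  "completion_embed X d x = cauchy_rel X d `` {\<lambda>_. x}"

context Metric_space
begin

lemma MCauchy_in: "MCauchy \<sigma> \<Longrightarrow> \<sigma> n \<in> M"
  by (auto simp: MCauchy_def)

lemma dist_diff_le:
  assumes "a \<in> M" "b \<in> M" "a' \<in> M" "b' \<in> M"
  shows "\<bar>d a b - d a' b'\<bar> \<le> d a a' + d b b'"
proof -
  have "d a b \<le> d a a' + (d a' b' + d b' b)"
    using triangle[of a a' b] triangle[of a' b' b] assms by linarith
  moreover have "d a' b' \<le> d a' a + (d a b + d b b')"
    using triangle[of a' a b'] triangle[of a b b'] assms by linarith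
  ultimately show ?thesis
    using commute[of a a'] commute[of b b'] by linarith
qed

lemma convergent_dist_MCauchy:
  assumes "MCauchy \<sigma>" "MCauchy \<tau>"
  shows "convergent (\<lambda>n. d (\<sigma> n) (\<tau> n))"
proof -
  have "Cauchy (\<lambda>n. d (\<sigma> n) (\<tau> n))"
  proof (rule metric_CauchyI)
    fix e :: real assume "e > 0"
    then obtain N1 N2 where
      N1: "\<And>n n'. N1 \<le> n \<Longrightarrow> N1 \<le> n' \<Longrightarrow> d (\<sigma> n) (\<sigma> n') < e / 2" and
      N2: "\<And>n n'. N2 \<le> n \<Longrightarrow> N2 \<le> n' \<Longrightarrow> d (\<tau> n) (\<tau> n') < e / 2"
      using assms unfolding MCauchy_def by (meson half_gt_zero)
    show "\<exists>N. \<forall>m\<ge>N. \<forall>n\<ge>N. dist (d (\<sigma> m) (\<tau> m)) (d (\<sigma> n) (\<tau> n)) < e"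
    proof (intro exI allI impI)
      fix m n assume "max N1 N2 \<le> m" "max N1 N2 \<le> n"
      then have "d (\<sigma> m) (\<sigma> n) < e / 2" "d (\<tau> m) (\<tau> n) < e / 2"
        using N1 N2 by auto
      then show "dist (d (\<sigma> m) (\<tau> m)) (d (\<sigma> n) (\<tau> n)) < e"
        using dist_diff_le[of "\<sigma> m" "\<tau> m" "\<sigma> n" "\<tau> n"] assms MCauchy_in
        by (auto simp: dist_real_def)
    qed
  qed
  then show ?thesis by (simp add: Cauchy_convergent_iff)
qed

lemma equiv_cauchy_rel: "equiv {\<sigma>. MCauchy \<sigma>} (cauchy_rel M d)"
proof (rule equivI)
  show "refl_on {\<sigma>. MCauchy \<sigma>} (cauchy_rel M d)"
    by (auto simp: refl_on_def cauchy_rel_def MCauchy_in)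
  show "cauchy_rel M d \<subseteq> {\<sigma>. MCauchy \<sigma>} \<times> {\<sigma>. MCauchy \<sigma>}"
    by (auto simp: cauchy_rel_def)
  show "sym (cauchy_rel M d)"
    by (auto simp: sym_def cauchy_rel_def commute)
  show "trans (cauchy_rel M d)"
  proof (rule transI)
    fix x y z assume xy: "(x, y) \<in> cauchy_rel M d" and yz: "(y, z) \<in> cauchy_rel M d"
    have "(\<lambda>n. d (x n) (y n) + d (y n) (z n)) \<longlonglongrightarrow> 0 + 0"
      using xy yz by (intro tendsto_add) (auto simp: cauchy_rel_def)
    then have s: "(\<lambda>n. d (x n) (y n) + d (y n) (z n)) \<longlonglongrightarrow> 0" by simp
    have "(\<lambda>n. d (x n) (z n)) \<longlonglongrightarrow> 0"
      by (rule tendsto_sandwich[OF _ _ tendsto_const s])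
         (use xy yz in \<open>auto simp: cauchy_rel_def intro!: always_eventually triangle MCauchy_in\<close>)
    then show "(x, z) \<in> cauchy_rel M d"
      using xy yz by (auto simp: cauchy_rel_def)
  qed
qed

lemma completion_spaceE:
  assumes "A \<in> completion_space M d"
  obtains \<sigma> where "MCauchy \<sigma>" "A = cauchy_rel M d `` {\<sigma>}"
  using assms by (auto simp: completion_space_def elim!: quotientE)

lemma class_in_completion: "MCauchy \<sigma> \<Longrightarrow> cauchy_rel M d `` {\<sigma>} \<in> completion_space M d"
  by (auto simp: completion_space_def intro: quotientI)

lemma completion_dist_limit:
  assumes "MCauchy \<sigma>" "MCauchy \<tau>"
  shows "(\<lambda>n. d (\<sigma> n) (\<tau> n)) \<longlonglongrightarrow>
    completion_dist M d (cauchy_rel M d `` {\<sigma>}) (cauchy_rel M d `` {\<tau>})"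
proof -
  define s where "s = (SOME x. x \<in> cauchy_rel M d `` {\<sigma>})"
  define t where "t = (SOME x. x \<in> cauchy_rel M d `` {\<tau>})"
  have "\<sigma> \<in> cauchy_rel M d `` {\<sigma>}" "\<tau> \<in> cauchy_rel M d `` {\<tau>}"
    using assms equiv_class_self[OF equiv_cauchy_rel] by auto
  then have "(\<sigma>, s) \<in> cauchy_rel M d" "(\<tau>, t) \<in> cauchy_rel M d"
    unfolding s_def t_def by (metis Image_singleton_iff someI)+
  then have st: "MCauchy s" "MCauchy t"
    "(\<lambda>n. d (\<sigma> n) (s n)) \<longlonglongrightarrow> 0" "(\<lambda>n. d (\<tau> n) (t n)) \<longlonglongrightarrow> 0"
    by (auto simp: cauchy_rel_def)
  have l: "(\<lambda>n. d (s n) (t n)) \<longlonglongrightarrow> lim (\<lambda>n. d (s n) (t n))"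
    using convergent_dist_MCauchy[OF st(1,2)] by (simp add: convergent_LIMSEQ_iff)
  have "(\<lambda>n. d (\<sigma> n) (s n) + d (\<tau> n) (t n)) \<longlonglongrightarrow> 0 + 0"
    by (intro tendsto_add st)
  then have "(\<lambda>n. d (\<sigma> n) (s n) + d (\<tau> n) (t n)) \<longlonglongrightarrow> 0" by simp
  then have "(\<lambda>n. d (\<sigma> n) (\<tau> n) - d (s n) (t n)) \<longlonglongrightarrow> 0"
    by (rule Lim_null_comparison[rotated])
       (use assms st in \<open>auto intro!: always_eventually dist_diff_le MCauchy_in\<close>)
  from tendsto_add[OF this l] show ?thesis
    using assms by (simp add: completion_dist_def class_in_completion s_def t_def)
qed

lemma Metric_space_completion: "Metric_space (completion_space M d) (completion_dist M d)"
proof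
  fix A B
  show "0 \<le> completion_dist M d A B"
  proof (cases "A \<in> completion_space M d \<and> B \<in> completion_space M d")
    case True
    then obtain \<sigma> \<tau> where "MCauchy \<sigma>" "A = cauchy_rel M d `` {\<sigma>}"
      "MCauchy \<tau>" "B = cauchy_rel M d `` {\<tau>}"
      by (metis completion_spaceE)
    then show ?thesis
      using completion_dist_limit[of \<sigma> \<tau>] by (auto intro: LIMSEQ_le_const)
  qed (auto simp: completion_dist_def)
  show "completion_dist M d A B = completion_dist M d B A"
    by (auto simp: completion_dist_def commute)
next
  fix A B assume "A \<in> completion_space M d" "B \<in> completion_space M d"
  then obtain \<sigma> \<tau> where st: "MCauchy \<sigma>" "A = cauchy_rel M d `` {\<sigma>}"
      "MCauchy \<tau>" "B = cauchy_rel M d `` {\<tau>}"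
    by (metis completion_spaceE)
  have "completion_dist M d A B = 0 \<longleftrightarrow> (\<lambda>n. d (\<sigma> n) (\<tau> n)) \<longlonglongrightarrow> 0"
    using completion_dist_limit[OF st(1,3)] st LIMSEQ_unique by metis
  also have "\<dots> \<longleftrightarrow> (\<sigma>, \<tau>) \<in> cauchy_rel M d"
    using st by (auto simp: cauchy_rel_def)
  also have "\<dots> \<longleftrightarrow> A = B"
    using st eq_equiv_class_iff[OF equiv_cauchy_rel, of \<sigma> \<tau>] by simp
  finally show "completion_dist M d A B = 0 \<longleftrightarrow> A = B" .
next
  fix A B C assume "A \<in> completion_space M d" "B \<in> completion_space M d" "C \<in> completion_space M d"
  then obtain \<sigma> \<tau> \<rho> where st: "MCauchy \<sigma>" "A = cauchy_rel M d `` {\<sigma>}"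
      "MCauchy \<tau>" "B = cauchy_rel M d `` {\<tau>}" "MCauchy \<rho>" "C = cauchy_rel M d `` {\<rho>}"
    by (metis completion_spaceE)
  show "completion_dist M d A C \<le> completion_dist M d A B + completion_dist M d B C"
    unfolding st
    by (rule LIMSEQ_le[OF completion_dist_limit[OF st(1,5)]
          tendsto_add[OF completion_dist_limit[OF st(1,3)] completion_dist_limit[OF st(3,5)]]])
       (use st in \<open>auto intro!: triangle MCauchy_in\<close>)
qed

lemma completion_embed_in: "x \<in> M \<Longrightarrow> completion_embed M d x \<in> completion_space M d"
  by (auto simp: completion_embed_def intro: class_in_completion)

lemma completion_embed_isometry:
  assumes "x \<in> M" "y \<in> M"
  shows "completion_dist M d (completion_embed M d x) (completion_embed M d y) = d x y"
  using completion_dist_limit[of "\<lambda>_. x" "\<lambda>_. y"] assms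
  by (simp add: completion_embed_def LIMSEQ_const_iff)

lemma completion_embed_approx:
  assumes "MCauchy \<sigma>" "e > 0"
  shows "\<exists>N. \<forall>n\<ge>N. completion_dist M d (cauchy_rel M d `` {\<sigma>}) (completion_embed M d (\<sigma> n)) < e"
proof -
  obtain N where N: "\<And>n n'. N \<le> n \<Longrightarrow> N \<le> n' \<Longrightarrow> d (\<sigma> n) (\<sigma> n') < e / 2"
    using assms unfolding MCauchy_def by (meson half_gt_zero)
  have "completion_dist M d (cauchy_rel M d `` {\<sigma>}) (completion_embed M d (\<sigma> n)) \<le> e / 2"
    if "n \<ge> N" for n
    unfolding completion_embed_def
    by (rule LIMSEQ_le_const2[OF completion_dist_limit])
       (use assms N that in \<open>auto intro!: exI[of _ N] less_imp_le MCauchy_in\<close>)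
  then show ?thesis using assms by (intro exI[of _ N]) force
qed

lemma completion_embed_dense:
  "Metric_space.mtopology (completion_space M d) (completion_dist M d) closure_of
     (completion_embed M d ` M) = completion_space M d"
proof -
  interpret K: Metric_space "completion_space M d" "completion_dist M d"
    by (rule Metric_space_completion)
  have "\<exists>y\<in>M. completion_dist M d A (completion_embed M d y) < r"
    if "A \<in> completion_space M d" "r > 0" for A r
    using that by (elim completion_spaceE) (metis MCauchy_in completion_embed_approx order_refl)
  then show ?thesis
    by (auto simp: K.metric_closure_of completion_embed_in)
qed

lemma mcomplete_completion:
  "Metric_space.mcomplete (completion_space M d) (completion_dist M d)"
proof -
  interpret K: Metric_space "completion_space M d" "completion_dist M d"
    by (rule Metric_space_completion)
  let ?D = "completion_dist M d" and ?e = "completion_embed M d"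
  show ?thesis
    unfolding K.mcomplete_def
  proof (intro allI impI)
    fix S assume S: "K.MCauchy S"
    then have Sin: "S n \<in> completion_space M d" for n by (rule K.MCauchy_in)
    have "\<exists>y\<in>M. ?D (S n) (?e y) < 1 / Suc n" for n
    proof -
      obtain \<sigma> where \<sigma>: "MCauchy \<sigma>" "S n = cauchy_rel M d `` {\<sigma>}"
        using Sin completion_spaceE by blast
      from completion_embed_approx[OF \<sigma>(1), of "1 / Suc n"] \<sigma> show ?thesis
        by (auto intro: MCauchy_in)
    qed
    then obtain y where y: "\<And>n. y n \<in> M" "\<And>n. ?D (S n) (?e (y n)) < 1 / Suc n"
      by metis
    have small: "\<exists>N. \<forall>n\<ge>N. ?D (S n) (?e (y n)) < e" if e: "e > 0" for e
    proof -
      obtain N where N: "1 / real (Suc N) < e" using e by (rule nat_approx_posE)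
      have "?D (S n) (?e (y n)) < e" if "n \<ge> N" for n
      proof -
        have "1 / real (Suc n) \<le> 1 / real (Suc N)"
          using that by (intro divide_left_mono) auto
        then show ?thesis using y(2)[of n] N by linarith
      qed
      then show ?thesis by blast
    qed
    have yC: "MCauchy y"
      unfolding MCauchy_def
    proof (intro conjI allI impI)
      show "range y \<subseteq> M" using y by auto
      fix e :: real assume e: "e > 0"
      obtain N1 where N1: "\<And>n. n \<ge> N1 \<Longrightarrow> ?D (S n) (?e (y n)) < e / 3"
        using small[of "e / 3"] e by auto
      obtain N2 where N2: "\<And>n n'. N2 \<le> n \<Longrightarrow> N2 \<le> n' \<Longrightarrow> ?D (S n) (S n') < e / 3"
        using S e unfolding K.MCauchy_def by (meson divide_pos_pos zero_less_numeral)
      show "\<exists>N. \<forall>n n'. N \<le> n \<longrightarrow> N \<le> n' \<longrightarrow> d (y n) (y n') < e"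
      proof (intro exI allI impI)
        fix m n assume mn: "max N1 N2 \<le> m" "max N1 N2 \<le> n"
        have "?D (?e (y m)) (?e (y n)) \<le> ?D (?e (y m)) (S m) + ?D (S m) (?e (y n))"
          by (intro K.triangle completion_embed_in y Sin)
        also have "?D (S m) (?e (y n)) \<le> ?D (S m) (S n) + ?D (S n) (?e (y n))"
          by (intro K.triangle completion_embed_in y Sin)
        finally show "d (y m) (y n) < e"
          using N1[of m] N1[of n] N2[of m n] mn K.commute[of "?e (y m)" "S m"]
          by (simp add: completion_embed_isometry y)
      qed
    qed
    let ?L = "cauchy_rel M d `` {y}"
    have "limitin K.mtopology S ?L sequentially"
      unfolding K.limit_metric_sequentially
    proof (intro conjI allI impI class_in_completion yC)
      fix e :: real assume e: "e > 0"
      obtain N1 where N1: "\<And>n. n \<ge> N1 \<Longrightarrow> ?D (S n) (?e (y n)) < e / 2"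
        using small[of "e / 2"] e by auto
      obtain N2 where N2: "\<And>n. n \<ge> N2 \<Longrightarrow> ?D ?L (?e (y n)) < e / 2"
        using completion_embed_approx[OF yC, of "e / 2"] e by auto
      show "\<exists>N. \<forall>n\<ge>N. S n \<in> completion_space M d \<and> ?D (S n) ?L < e"
      proof (intro exI allI impI conjI Sin)
        fix n assume "max N1 N2 \<le> n"
        then show "?D (S n) ?L < e"
          using K.triangle[of "S n" "?e (y n)" ?L] N1[of n] N2[of n] K.commute[of "?e (y n)" ?L]
            completion_embed_in[OF y(1)[of n]] class_in_completion[OF yC] Sin[of n]
          by auto
      qed
    qed
    then show "\<exists>x. limitin K.mtopology S x sequentially" by blast
  qed
qed

end

section \<open>The Lipschitz multi-armed bandit problem\<close>

definition arm_algebra :: "'a set \<Rightarrow> ('a \<Rightarrow> 'a \<Rightarrow> real) \<Rightarrow> 'a measure" where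
  "arm_algebra X d = sigma X {U. openin (Metric_space.mtopology X d) U}"

abbreviation round_algebra :: "'a set \<Rightarrow> ('a \<Rightarrow> 'a \<Rightarrow> real) \<Rightarrow> ('a \<times> real) measure" where
  "round_algebra X d \<equiv> arm_algebra X d \<Otimes>\<^sub>M borel"

text \<open>An instance is a payoff function \<open>\<mu>\<close> with reward distributions \<open>P x\<close>. Measurability of
  \<open>P\<close> is what makes the law of the interaction well defined; it is automatic if \<open>X\<close> is
  countable.\<close>

definition lipschitz_instance ::
    "'a set \<Rightarrow> ('a \<Rightarrow> 'a \<Rightarrow> real) \<Rightarrow> ('a \<Rightarrow> real) \<Rightarrow> ('a \<Rightarrow> real measure) \<Rightarrow> bool" where
  "lipschitz_instance X d \<mu> P \<longleftrightarrow>
     (\<forall>x\<in>X. \<mu> x \<in> {0..1}) \<and>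
     (\<forall>x\<in>X. \<forall>y\<in>X. \<bar>\<mu> x - \<mu> y\<bar> \<le> d x y) \<and>
     P \<in> arm_algebra X d \<rightarrow>\<^sub>M prob_algebra borel \<and>
     (\<forall>x\<in>X. (AE r in P x. r \<in> {0..1}) \<and> (\<integral>r. r \<partial>P x) = \<mu> x)"

text \<open>A (randomized) algorithm gives, for each round \<open>t\<close> (counted from 0) and each history of
  arms and rewards in rounds \<open>0, \<dots>, t - 1\<close>, the distribution of the next arm.\<close>

definition bandit_algorithm ::
    "'a set \<Rightarrow> ('a \<Rightarrow> 'a \<Rightarrow> real) \<Rightarrow> (nat \<Rightarrow> (nat \<Rightarrow> 'a \<times> real) \<Rightarrow> 'a measure) \<Rightarrow> bool" where
  "bandit_algorithm X d \<pi> \<longleftrightarrow>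
     (\<forall>t. \<pi> t \<in> (\<Pi>\<^sub>M s\<in>{0..<t}. round_algebra X d) \<rightarrow>\<^sub>M prob_algebra (arm_algebra X d))"

definition round_law ::
    "'a set \<Rightarrow> ('a \<Rightarrow> 'a \<Rightarrow> real) \<Rightarrow> ('a \<Rightarrow> real measure) \<Rightarrow>
     (nat \<Rightarrow> (nat \<Rightarrow> 'a \<times> real) \<Rightarrow> 'a measure) \<Rightarrow>
     nat \<Rightarrow> (nat \<Rightarrow> 'a \<times> real) \<Rightarrow> ('a \<times> real) measure" where
  "round_law X d P \<pi> t h =
     \<pi> t h \<bind> (\<lambda>x. P x \<bind> (\<lambda>r. return (round_algebra X d) (x, r)))"

text \<open>The joint law of the first \<open>t\<close> rounds, obtained from the empty history by composing the
  kernels of the single rounds.\<close>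

definition history_law ::
    "'a set \<Rightarrow> ('a \<Rightarrow> 'a \<Rightarrow> real) \<Rightarrow> ('a \<Rightarrow> real measure) \<Rightarrow>
     (nat \<Rightarrow> (nat \<Rightarrow> 'a \<times> real) \<Rightarrow> 'a measure) \<Rightarrow> nat \<Rightarrow> (nat \<Rightarrow> 'a \<times> real) measure" where
  "history_law X d P \<pi> t =
     Ionescu_Tulcea.C (round_law X d P \<pi>) (\<lambda>_. round_algebra X d) 0 t (\<lambda>_. undefined)"

lemma space_arm_algebra: "Metric_space X d \<Longrightarrow> space (arm_algebra X d) = X"
  unfolding arm_algebra_def
  by (rule space_measure_of) (auto dest!: openin_subset simp: Metric_space.topspace_mtopology)

lemma Ionescu_Tulcea_round_law:
  assumes "lipschitz_instance X d \<mu> P" and "bandit_algorithm X d \<pi>"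
  shows "Ionescu_Tulcea (round_law X d P \<pi>) (\<lambda>_. round_algebra X d)"
proof -
  have [measurable]: "P \<in> arm_algebra X d \<rightarrow>\<^sub>M prob_algebra borel"
    using assms by (simp add: lipschitz_instance_def)
  have [measurable]: "\<pi> t \<in> (\<Pi>\<^sub>M s\<in>{0..<t}. round_algebra X d) \<rightarrow>\<^sub>M prob_algebra (arm_algebra X d)" for t
    using assms by (simp add: bandit_algorithm_def)
  have m: "round_law X d P \<pi> t \<in>
      (\<Pi>\<^sub>M s\<in>{0..<t}. round_algebra X d) \<rightarrow>\<^sub>M prob_algebra (round_algebra X d)" for t
    unfolding round_law_def[abs_def] by measurable
  show ?thesis
  proof (rule Ionescu_Tulcea.intro)
    show "round_law X d P \<pi> i \<in> (\<Pi>\<^sub>M s\<in>{0..<i}. round_algebra X d) \<rightarrow>\<^sub>M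
        subprob_algebra (round_algebra X d)" for i
      using m by (rule measurable_prob_algebraD)
    show "prob_space (round_law X d P \<pi> i x)"
      if "x \<in> space (\<Pi>\<^sub>M s\<in>{0..<i}. round_algebra X d)" for i x
      using measurable_space[OF m that] by (simp add: space_prob_algebra)
  qed
qed

definition regret ::
    "'a set \<Rightarrow> ('a \<Rightarrow> 'a \<Rightarrow> real) \<Rightarrow> ('a \<Rightarrow> real) \<Rightarrow> ('a \<Rightarrow> real measure) \<Rightarrow>
     (nat \<Rightarrow> (nat \<Rightarrow> 'a \<times> real) \<Rightarrow> 'a measure) \<Rightarrow> nat \<Rightarrow> real" where
  "regret X d \<mu> P \<pi> t =
     real t * (SUP x\<in>X. \<mu> x) - (\<integral>h. (\<Sum>s<t. \<mu> (fst (h s))) \<partial>history_law X d P \<pi> t)"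

definition tractable :: "'a set \<Rightarrow> ('a \<Rightarrow> 'a \<Rightarrow> real) \<Rightarrow> (nat \<Rightarrow> real) \<Rightarrow> bool" where
  "tractable X d f \<longleftrightarrow>
     (\<exists>\<pi>. bandit_algorithm X d \<pi> \<and>
       (\<forall>\<mu> P. lipschitz_instance X d \<mu> P \<longrightarrow>
         (\<exists>C. \<forall>t\<ge>1. regret X d \<mu> P \<pi> t \<le> C * f t)))"

text \<open>Positivity is part of being a regret rate: if \<open>X\<close> has two points, then every algorithm has
  positive regret at all \<open>t \<ge> 1\<close> on some instance, so an \<open>f\<close> in \<open>\<omega>(log t)\<close> with a value
  \<open>f t \<le> 0\<close>, \<open>t \<ge> 1\<close>, is never a bound up to a constant.\<close>

definition omega_log :: "(nat \<Rightarrow> real) \<Rightarrow> bool" where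
  "omega_log f \<longleftrightarrow> (\<forall>t\<ge>1. 0 < f t) \<and> filterlim (\<lambda>t. f t / ln (real t)) at_top sequentially"

definition little_o_sqrt :: "(nat \<Rightarrow> real) \<Rightarrow> bool" where
  "little_o_sqrt g \<longleftrightarrow> (\<lambda>t. g t / sqrt (real t)) \<longlonglongrightarrow> 0"

end

theory Submission
  imports Defs "HOL-Library.Bourbaki_Witt_Fixpoint" "HOL-Library.Discrete_Functions"
    "HOL-Real_Asymp.Real_Asymp"
begin

text \<open>
  Upper bound. If the completion is compact and countable, Baire's theorem gives every nonempty
  closed subset an isolated point, so adding isolated points one at a time exhausts the completion
  by a well-ordered chain of open sets. The chain singles out one optimal point: the last of the
  optimal points to be added. Every sufficiently fine estimate of the set of optimal points
  singles out the same point. An algorithm that explores finite nets in phases starting at the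
  times \<open>2 ^ 2 ^ j\<close> and otherwise plays the point so selected therefore errs only with the small
  probability that the estimates of the current phase are inaccurate, and its regret is
  essentially the exploration cost, which can be made any \<open>\<omega>(log t)\<close>.

  Lower bound. Given an algorithm, a bad payoff function with Bernoulli rewards is the limit of
  payoffs \<open>\<nu> n\<close> to which a bump is added in a region that the algorithm rarely visits under
  \<open>\<nu> n\<close>. If the space is not totally bounded, the regions are taken from an infinite separated
  family of balls. Otherwise the completion is uncountable, every ball with uncountably many
  points of the completion contains two disjoint such balls, and the algorithm spends at most half
  of its time in one of them; a bump of height \<open>1 / (32 sqrt t)\<close> there is not detected within \<open>t\<close>
  rounds, because the second moment of the likelihood ratio stays close to 1.
\<close>

section \<open>The law of the interaction\<close>

text \<open>The upper bound is delicate because exploitation must lose almost nothing. Playing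
  anywhere near an estimated optimal set may cost its accuracy in every round, far more than
  \<open>log t\<close> in total. So the phases must agree on one exact point of the completion,
  which arms approximate to within \<open>(1 / 2) ^ t\<close>, a summable loss. The accuracy needed
  for this agreement depends on the unknown payoff, but only finitely many phases fall short of it,
  and the constant of the instance absorbs them. Doubly exponential phases balance the other costs:
  exploration of order \<open>2 ^ j\<close> in phase \<open>j\<close> adds up to order
  \<open>log t\<close>, and error probabilities \<open>exp (- 2 * 2 ^ j)\<close> are at most
  \<open>1 / (s + 1)\<close> in round \<open>s\<close>, again of order \<open>log t\<close> in
  total. Net sizes and accuracies enter as a factor that grows as slowly as desired.

  In the lower bound the instance may depend on the algorithm, but a single instance has to defeat
  every constant, so its regret must be large at infinitely many times. Each stage must therefore
  preserve what the earlier ones achieved, which is why later bumps are confined to the region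
  singled out before.\<close>

context Metric_space
begin

lemma openin_arm_algebra: "openin mtopology U \<Longrightarrow> U \<in> sets (arm_algebra M d)"
  unfolding arm_algebra_def
  by (subst sets_measure_of) (auto dest!: openin_subset)

lemma mball_arm_algebra: "mball x r \<in> sets (arm_algebra M d)"
  by (rule openin_arm_algebra) simp

lemma lipschitz_borel_measurable:
  assumes lip: "\<And>x y. x \<in> M \<Longrightarrow> y \<in> M \<Longrightarrow> \<bar>\<nu> x - \<nu> y\<bar> \<le> d x y"
  shows "\<nu> \<in> borel_measurable (arm_algebra M d)"
proof (rule borel_measurableI)
  fix S :: "real set" assume S: "open S"
  have "openin mtopology (\<nu> -` S \<inter> M)"
    unfolding openin_mtopology
  proof (intro conjI allI impI)
    fix x assume x: "x \<in> \<nu> -` S \<inter> M"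
    then obtain e where "e > 0" and e: "\<And>y. dist y (\<nu> x) < e \<Longrightarrow> y \<in> S"
      using S unfolding open_dist by blast
    have "mball x e \<subseteq> \<nu> -` S \<inter> M"
    proof
      fix y assume "y \<in> mball x e"
      then show "y \<in> \<nu> -` S \<inter> M"
        using lip[of y x] x e[of "\<nu> y"] by (auto simp: in_mball dist_real_def commute)
    qed
    then show "\<exists>r>0. mball x r \<subseteq> \<nu> -` S \<inter> M" using \<open>e > 0\<close> by blast
  qed auto
  then show "\<nu> -` S \<inter> space (arm_algebra M d) \<in> sets (arm_algebra M d)"
    using openin_arm_algebra by (simp add: space_arm_algebra[OF Metric_space_axioms])
qed

end

text \<open>A locale, so that runs of the same algorithm on two instances can be interpreted side by
  side and compared.\<close>

locale bandit_run =
  fixes X :: "'a set" and d :: "'a \<Rightarrow> 'a \<Rightarrow> real" and \<mu> :: "'a \<Rightarrow> real"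
    and P :: "'a \<Rightarrow> real measure" and \<pi> :: "nat \<Rightarrow> (nat \<Rightarrow> 'a \<times> real) \<Rightarrow> 'a measure"
  assumes metric: "Metric_space X d"
    and nonempty: "X \<noteq> {}"
    and inst: "lipschitz_instance X d \<mu> P"
    and alg: "bandit_algorithm X d \<pi>"
begin

abbreviation "arms \<equiv> arm_algebra X d"
abbreviation "hist t \<equiv> (\<Pi>\<^sub>M s\<in>{0..<t::nat}. round_algebra X d)"
abbreviation "law t \<equiv> history_law X d P \<pi> t"

lemma space_arms [simp]: "space arms = X"
  by (rule space_arm_algebra[OF metric])

lemma P_measurable [measurable]: "P \<in> arms \<rightarrow>\<^sub>M prob_algebra borel"
  using inst by (simp add: lipschitz_instance_def)

lemma \<pi>_measurable [measurable]: "\<pi> t \<in> hist t \<rightarrow>\<^sub>M prob_algebra arms"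
  using alg by (simp add: bandit_algorithm_def)

lemma P_subprob [measurable]: "P \<in> arms \<rightarrow>\<^sub>M subprob_algebra borel"
  by (rule measurable_prob_algebraD) measurable

lemma \<pi>_subprob [measurable]: "\<pi> t \<in> hist t \<rightarrow>\<^sub>M subprob_algebra arms"
  by (rule measurable_prob_algebraD) measurable

lemma P_prob: "x \<in> X \<Longrightarrow> prob_space (P x)" and sets_P: "x \<in> X \<Longrightarrow> sets (P x) = sets borel"
  using measurable_space[OF P_measurable, of x] by (auto simp: space_prob_algebra)

lemma \<pi>_prob: "h \<in> space (hist t) \<Longrightarrow> prob_space (\<pi> t h)"
  and sets_\<pi>: "h \<in> space (hist t) \<Longrightarrow> sets (\<pi> t h) = sets arms"
  using measurable_space[OF \<pi>_measurable, of h t] by (auto simp: space_prob_algebra)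

lemma space_\<pi>: "h \<in> space (hist t) \<Longrightarrow> space (\<pi> t h) = X"
  using sets_eq_imp_space_eq[OF sets_\<pi>] by simp

sublocale IT: Ionescu_Tulcea "round_law X d P \<pi>" "\<lambda>_. round_algebra X d"
  by (rule Ionescu_Tulcea_round_law[OF inst alg])

lemma sets_law [measurable_cong]: "sets (law t) = sets (hist t)"
  unfolding history_law_def by (subst IT.sets_C) (auto simp: space_PiM)

lemma space_law: "space (law t) = space (hist t)"
  by (rule sets_eq_imp_space_eq[OF sets_law])

lemma prob_law: "prob_space (law t)"
  unfolding history_law_def by (rule IT.prob_space_C) (auto simp: space_PiM)

lemma law_Suc: "law (Suc t) = law t \<bind> IT.eP t"
  by (simp add: history_law_def)

lemma law_0: "law 0 = return (hist 0) (\<lambda>_. undefined)"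
  by (simp add: history_law_def)

lemma nn_integral_round_law:
  assumes h: "h \<in> space (hist t)" and [measurable]: "F \<in> borel_measurable (round_algebra X d)"
  shows "(\<integral>\<^sup>+z. F z \<partial>round_law X d P \<pi> t h) = (\<integral>\<^sup>+x. (\<integral>\<^sup>+r. F (x, r) \<partial>P x) \<partial>\<pi> t h)"
proof -
  have K: "(\<lambda>x. P x \<bind> (\<lambda>r. return (round_algebra X d) (x, r))) \<in> arms \<rightarrow>\<^sub>M subprob_algebra (round_algebra X d)"
    by measurable
  have "(\<integral>\<^sup>+z. F z \<partial>round_law X d P \<pi> t h) =
      (\<integral>\<^sup>+x. (\<integral>\<^sup>+z. F z \<partial>(P x \<bind> (\<lambda>r. return (round_algebra X d) (x, r)))) \<partial>\<pi> t h)"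
    unfolding round_law_def
    by (rule nn_integral_bind[OF assms(2)]) (use K in \<open>simp add: measurable_cong_sets[OF sets_\<pi>[OF h] refl]\<close>)
  also have "\<dots> = (\<integral>\<^sup>+x. (\<integral>\<^sup>+r. F (x, r) \<partial>P x) \<partial>\<pi> t h)"
  proof (rule nn_integral_cong)
    fix x assume "x \<in> space (\<pi> t h)"
    then have x: "x \<in> X" using space_\<pi>[OF h] by simp
    have [measurable_cong]: "sets (P x) = sets borel" by (rule sets_P[OF x])
    have "(\<integral>\<^sup>+z. F z \<partial>(P x \<bind> (\<lambda>r. return (round_algebra X d) (x, r)))) =
        (\<integral>\<^sup>+r. (\<integral>\<^sup>+z. F z \<partial>return (round_algebra X d) (x, r)) \<partial>P x)"
      using x by (intro nn_integral_bind[where B="round_algebra X d"]) (auto intro!: measurable_Pair1')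
    also have "\<dots> = (\<integral>\<^sup>+r. F (x, r) \<partial>P x)"
      by (intro nn_integral_cong nn_integral_return) (auto simp: space_pair_measure x)
    finally show "(\<integral>\<^sup>+z. F z \<partial>(P x \<bind> (\<lambda>r. return (round_algebra X d) (x, r)))) = \<dots>" .
  qed
  finally show ?thesis .
qed

lemma hist_upd [measurable]:
  "(\<lambda>(h, z). h(t := z)) \<in> hist t \<Otimes>\<^sub>M round_algebra X d \<rightarrow>\<^sub>M hist (Suc t)"
  unfolding split_beta' by (rule measurable_fun_upd[where J="{0..<t}"]) auto

text \<open>Disintegration of the last round into history, arm and reward. The inductions over
  \<open>t\<close> below go through it; nonnegative integrals keep them free of integrability
  conditions.\<close>

lemma nn_integral_law_Suc:
  assumes F [measurable]: "F \<in> borel_measurable (hist (Suc t))"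
  shows "(\<integral>\<^sup>+h. F h \<partial>law (Suc t)) =
    (\<integral>\<^sup>+h. (\<integral>\<^sup>+x. (\<integral>\<^sup>+r. F (h(t := (x, r))) \<partial>P x) \<partial>\<pi> t h) \<partial>law t)"
proof -
  have "(\<integral>\<^sup>+h. F h \<partial>law (Suc t)) = (\<integral>\<^sup>+h. (\<integral>\<^sup>+g. F g \<partial>IT.eP t h) \<partial>law t)"
    unfolding law_Suc by (rule nn_integral_bind[where B="hist (Suc t)"]) measurable
  also have "\<dots> = (\<integral>\<^sup>+h. (\<integral>\<^sup>+x. (\<integral>\<^sup>+r. F (h(t := (x, r))) \<partial>P x) \<partial>\<pi> t h) \<partial>law t)"
  proof (rule nn_integral_cong)
    fix h assume "h \<in> space (law t)"
    then have h: "h \<in> space (hist t)" by (simp add: space_law)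
    have [measurable]: "(\<lambda>z. h(t := z)) \<in> round_algebra X d \<rightarrow>\<^sub>M hist (Suc t)"
      using measurable_Pair2[OF hist_upd h] by simp
    show "(\<integral>\<^sup>+g. F g \<partial>IT.eP t h) = (\<integral>\<^sup>+x. (\<integral>\<^sup>+r. F (h(t := (x, r))) \<partial>P x) \<partial>\<pi> t h)"
      using h by (subst IT.nn_integral_eP) (auto intro!: nn_integral_round_law)
  qed
  finally show ?thesis .
qed

lemma \<mu>_range: "x \<in> X \<Longrightarrow> 0 \<le> \<mu> x" "x \<in> X \<Longrightarrow> \<mu> x \<le> 1"
  and \<mu>_lipschitz: "x \<in> X \<Longrightarrow> y \<in> X \<Longrightarrow> \<bar>\<mu> x - \<mu> y\<bar> \<le> d x y"
  and reward_range: "x \<in> X \<Longrightarrow> AE r in P x. r \<in> {0..1}"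
  and reward_mean: "x \<in> X \<Longrightarrow> (\<integral>r. r \<partial>P x) = \<mu> x"
  using inst by (auto simp: lipschitz_instance_def)

lemma \<mu>_measurable [measurable]: "\<mu> \<in> borel_measurable arms"
  by (rule Metric_space.lipschitz_borel_measurable[OF metric \<mu>_lipschitz])

abbreviation "best \<equiv> (SUP x\<in>X. \<mu> x)"

lemma bdd_\<mu>: "bdd_above (\<mu> ` X)"
  using \<mu>_range by (auto intro!: bdd_aboveI2)

lemma \<mu>_le_best: "x \<in> X \<Longrightarrow> \<mu> x \<le> best"
  by (rule cSUP_upper[OF _ bdd_\<mu>])

lemma best_le_1: "best \<le> 1"
  using nonempty \<mu>_range by (intro cSUP_least) auto

lemma hist_arm: "h \<in> space (hist t) \<Longrightarrow> s < t \<Longrightarrow> fst (h s) \<in> X"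
  by (force simp: space_PiM PiE_iff space_pair_measure mem_Times_iff)

lemma hist_coord: "s < t \<Longrightarrow> (\<lambda>h. h s) \<in> hist t \<rightarrow>\<^sub>M round_algebra X d"
  by (rule measurable_component_singleton) simp

lemma law_arm: "s < t \<Longrightarrow> (\<lambda>h. fst (h s)) \<in> law t \<rightarrow>\<^sub>M arms"
  using measurable_comp[OF hist_coord measurable_fst, of s t]
  by (simp add: comp_def measurable_cong_sets[OF sets_law refl])

lemma nn_integral_law_sum:
  assumes [measurable]: "G \<in> borel_measurable arms"
  shows "(\<integral>\<^sup>+h. (\<Sum>s<t. G (fst (h s))) \<partial>law t) = (\<Sum>s<t. (\<integral>\<^sup>+h. (\<integral>\<^sup>+x. G x \<partial>\<pi> s h) \<partial>law s))"
proof (induction t)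
  case (Suc t)
  have "(\<integral>\<^sup>+h. (\<Sum>s<Suc t. G (fst (h s))) \<partial>law (Suc t)) =
    (\<integral>\<^sup>+h. (\<integral>\<^sup>+x. (\<integral>\<^sup>+r. (\<Sum>s<t. G (fst (h s))) + G x \<partial>P x) \<partial>\<pi> t h) \<partial>law t)"
    by (subst nn_integral_law_Suc) auto
  also have "\<dots> = (\<integral>\<^sup>+h. (\<Sum>s<t. G (fst (h s))) + (\<integral>\<^sup>+x. G x \<partial>\<pi> t h) \<partial>law t)"
  proof (rule nn_integral_cong)
    fix h assume "h \<in> space (law t)"
    then have h: "h \<in> space (hist t)" by (simp add: space_law)
    have "(\<integral>\<^sup>+x. (\<integral>\<^sup>+r. (\<Sum>s<t. G (fst (h s))) + G x \<partial>P x) \<partial>\<pi> t h) =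
        (\<integral>\<^sup>+x. (\<Sum>s<t. G (fst (h s))) + G x \<partial>\<pi> t h)"
      by (intro nn_integral_cong)
         (simp add: space_\<pi>[OF h] prob_space.emeasure_space_1[OF P_prob])
    also have "\<dots> = (\<Sum>s<t. G (fst (h s))) + (\<integral>\<^sup>+x. G x \<partial>\<pi> t h)"
      by (subst nn_integral_add)
         (auto simp: measurable_cong_sets[OF sets_\<pi>[OF h] refl] prob_space.emeasure_space_1[OF \<pi>_prob[OF h]])
    finally show "(\<integral>\<^sup>+x. (\<integral>\<^sup>+r. (\<Sum>s<t. G (fst (h s))) + G x \<partial>P x) \<partial>\<pi> t h) = \<dots>" .
  qed
  also have "\<dots> = (\<integral>\<^sup>+h. (\<Sum>s<t. G (fst (h s))) \<partial>law t) + (\<integral>\<^sup>+h. (\<integral>\<^sup>+x. G x \<partial>\<pi> t h) \<partial>law t)"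
    by (rule nn_integral_add) measurable
  finally show ?case using Suc by simp
qed auto

text \<open>Every payoff lies between 0 and \<open>best\<close>, so the difference of Bochner
  integrals in \<open>regret\<close> is an integral of nonnegative gaps, to which the calculus above
  applies.\<close>

lemma regret_eq_nn_integral:
  "ennreal (regret X d \<mu> P \<pi> t) = (\<integral>\<^sup>+h. (\<Sum>s<t. ennreal (best - \<mu> (fst (h s)))) \<partial>law t)"
  and regret_nonneg: "0 \<le> regret X d \<mu> P \<pi> t"
proof -
  interpret prob_space "law t" by (rule prob_law)
  let ?S = "\<lambda>h. \<Sum>s<t. \<mu> (fst (h s))"
  have range: "0 \<le> \<mu> (fst (h s))" "\<mu> (fst (h s)) \<le> 1" "\<mu> (fst (h s)) \<le> best"
    if "h \<in> space (law t)" "s < t" for h s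
    using \<mu>_range \<mu>_le_best hist_arm[of h t s] that by (auto simp: space_law)
  have b: "0 \<le> ?S h" "?S h \<le> t * best" if "h \<in> space (law t)" for h
    using range[OF that] sum_bounded_above[of "{..<t}" "\<lambda>s. \<mu> (fst (h s))" best]
    by (auto intro!: sum_nonneg)
  note law_arm [measurable]
  have int: "integrable (law t) ?S"
    by (rule integrable_const_bound[of _ "t * best"]) (auto intro!: AE_I2 simp: b)
  have eq: "regret X d \<mu> P \<pi> t = (\<integral>h. (t * best - ?S h) \<partial>law t)"
    unfolding regret_def by (subst Bochner_Integration.integral_diff[OF _ int]) (auto simp: prob_space)
  show "0 \<le> regret X d \<mu> P \<pi> t"
    unfolding eq by (rule integral_nonneg_AE) (auto intro!: AE_I2 simp: b)
  have "ennreal (regret X d \<mu> P \<pi> t) = (\<integral>\<^sup>+h. ennreal (t * best - ?S h) \<partial>law t)"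
    unfolding eq by (rule nn_integral_eq_integral[symmetric]) (use int in \<open>auto intro!: AE_I2 simp: b\<close>)
  also have "\<dots> = (\<integral>\<^sup>+h. (\<Sum>s<t. ennreal (best - \<mu> (fst (h s)))) \<partial>law t)"
    by (intro nn_integral_cong) (subst sum_ennreal, auto simp: range sum_subtractf)
  finally show "ennreal (regret X d \<mu> P \<pi> t) = (\<integral>\<^sup>+h. (\<Sum>s<t. ennreal (best - \<mu> (fst (h s)))) \<partial>law t)" .
qed

lemma regret_eq_sum:
  "ennreal (regret X d \<mu> P \<pi> t) =
    (\<Sum>s<t. (\<integral>\<^sup>+h. (\<integral>\<^sup>+x. ennreal (best - \<mu> x) \<partial>\<pi> s h) \<partial>law s))"
  unfolding regret_eq_nn_integral by (rule nn_integral_law_sum) measurable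

text \<open>A round outside \<open>A\<close> loses at least \<open>U - L\<close>, and in expectation
  at least a quarter of the rounds are spent there. In the applications \<open>A\<close> is the
  region of the bumps, \<open>L\<close> bounds the payoff off it and \<open>U\<close> is a height
  that the bump certainly reaches.\<close>

lemma regret_ge_of_few_visits:
  assumes A [measurable]: "A \<in> sets arms" and L: "\<And>x. x \<in> X - A \<Longrightarrow> \<mu> x \<le> L"
    and U: "L \<le> U" "U \<le> best"
    and visits: "(\<integral>\<^sup>+h. (\<Sum>s<t. indicator A (fst (h s))) \<partial>law t) \<le> ennreal (3 / 4 * t)"
  shows "t * (U - L) / 4 \<le> regret X d \<mu> P \<pi> t"
proof -
  interpret prob_space "law t" by (rule prob_law)
  note law_arm [measurable]
  let ?V = "\<integral>\<^sup>+h. (\<Sum>s<t. indicator A (fst (h s))) \<partial>law t"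
  let ?W = "\<integral>\<^sup>+h. (\<Sum>s<t. indicator (X - A) (fst (h s))) \<partial>law t"
  have XA [measurable]: "X - A \<in> sets arms"
    using sets.compl_sets[OF A] by simp
  have "?V + ?W = (\<integral>\<^sup>+h. (\<Sum>s<t. indicator A (fst (h s))) + (\<Sum>s<t. indicator (X - A) (fst (h s))) \<partial>law t)"
    by (rule nn_integral_add[symmetric]) measurable
  also have "\<dots> = (\<integral>\<^sup>+h. of_nat t \<partial>law t)"
  proof (rule nn_integral_cong)
    fix h assume "h \<in> space (law t)"
    then have "(\<Sum>s<t. indicator A (fst (h s)) + indicator (X - A) (fst (h s)) :: ennreal) = (\<Sum>s<t. 1)"
      using hist_arm by (intro sum.cong) (auto simp: space_law split: split_indicator)
    then show "(\<Sum>s<t. indicator A (fst (h s))) + (\<Sum>s<t. indicator (X - A) (fst (h s))) = (of_nat t :: ennreal)"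
      by (simp add: sum.distrib)
  qed
  also have "\<dots> = of_nat t" by (simp add: emeasure_space_1)
  finally have VW: "?V + ?W = ennreal t" by (simp add: ennreal_of_nat_eq_real_of_nat)
  obtain v where v: "?V = ennreal v" "0 \<le> v" "v \<le> 3 / 4 * t"
    using visits by (cases ?V) (auto simp: top_unique ennreal_le_iff)
  obtain w where w: "?W = ennreal w" "0 \<le> w"
    using VW by (cases ?W) (auto simp: top_unique)
  have "v + w = t"
    using VW v w by (simp flip: ennreal_plus)
  then have "w \<ge> t / 4" using v by simp
  have "ennreal (U - L) * ?W = (\<integral>\<^sup>+h. ennreal (U - L) * (\<Sum>s<t. indicator (X - A) (fst (h s))) \<partial>law t)"
    by (rule nn_integral_cmult[symmetric]) measurable
  also have "\<dots> \<le> (\<integral>\<^sup>+h. (\<Sum>s<t. ennreal (best - \<mu> (fst (h s)))) \<partial>law t)"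
    unfolding sum_distrib_left
  proof (intro nn_integral_mono sum_mono)
    fix h s assume hs: "h \<in> space (law t)" "s \<in> {..<t}"
    then show "ennreal (U - L) * indicator (X - A) (fst (h s)) \<le> ennreal (best - \<mu> (fst (h s)))"
      using L[of "fst (h s)"] U by (auto split: split_indicator intro!: ennreal_leI)
  qed
  finally have "ennreal ((U - L) * w) \<le> ennreal (regret X d \<mu> P \<pi> t)"
    using U w by (simp add: regret_eq_nn_integral ennreal_mult)
  then have "(U - L) * w \<le> regret X d \<mu> P \<pi> t"
    using regret_nonneg by simp
  moreover have "(U - L) * (t / 4) \<le> (U - L) * w"
    using U \<open>w \<ge> t / 4\<close> by (intro mult_left_mono) auto
  ultimately show ?thesis by (simp add: mult.commute)
qed

end

section \<open>Change of reward distributions\<close>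

lemma (in bandit_run) hist_upd_fixed:
  "h \<in> space (hist t) \<Longrightarrow> (\<lambda>z. h(t := z)) \<in> round_algebra X d \<rightarrow>\<^sub>M hist (Suc t)"
  using measurable_Pair2[OF hist_upd, of h t] by simp

lemma (in bandit_run) nn_integral_law_0: "F \<in> borel_measurable (hist 0) \<Longrightarrow> (\<integral>\<^sup>+h. F h \<partial>law 0) = F (\<lambda>_. undefined)"
  unfolding law_0 by (rule nn_integral_return) (auto simp: space_PiM)

lemma (in bandit_run) measurable_round_integral:
  assumes [measurable]: "G \<in> borel_measurable (hist t \<Otimes>\<^sub>M round_algebra X d)"
  shows "(\<lambda>h. \<integral>\<^sup>+x. (\<integral>\<^sup>+r. G (h, (x, r)) \<partial>P x) \<partial>\<pi> t h) \<in> borel_measurable (hist t)"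
proof (rule nn_integral_measurable_subprob_algebra2[OF _ \<pi>_subprob])
  have "(\<lambda>z. \<integral>\<^sup>+r. G (fst z, (snd z, r)) \<partial>P (snd z)) \<in> borel_measurable (hist t \<Otimes>\<^sub>M arms)"
    by (rule nn_integral_measurable_subprob_algebra2[where N=borel]) measurable
  then show "(\<lambda>(h, x). \<integral>\<^sup>+r. G (h, (x, r)) \<partial>P x) \<in> borel_measurable (hist t \<Otimes>\<^sub>M arms)"
    by (simp add: split_beta')
qed

lemma (in bandit_run) measurable_reward_integral:
  assumes [measurable]: "G \<in> borel_measurable (round_algebra X d)"
  shows "(\<lambda>x. \<integral>\<^sup>+r. G (x, r) \<partial>P x) \<in> borel_measurable arms"
  by (rule nn_integral_measurable_subprob_algebra2[where N=borel]) (simp_all add: split_beta')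

text \<open>Both runs use the same algorithm, so the choice of arms contributes no density and only
  the reward densities multiply up.\<close>

lemma nn_integral_law_change_of_measure:
  assumes run: "bandit_run X d \<mu> P \<pi>" and run': "bandit_run X d \<mu>' P' \<pi>"
    and \<rho> [measurable]: "\<rho> \<in> borel_measurable (round_algebra X d)"
    and dens: "\<And>x G. x \<in> X \<Longrightarrow> G \<in> borel_measurable borel \<Longrightarrow>
        (\<integral>\<^sup>+r. G r \<partial>P' x) = (\<integral>\<^sup>+r. \<rho> (x, r) * G r \<partial>P x)"
    and "F \<in> borel_measurable (\<Pi>\<^sub>M s\<in>{0..<t}. round_algebra X d)"
  shows "(\<integral>\<^sup>+h. F h \<partial>history_law X d P' \<pi> t) = (\<integral>\<^sup>+h. (\<Prod>s<t. \<rho> (h s)) * F h \<partial>history_law X d P \<pi> t)"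
  using assms(5)
proof (induction t arbitrary: F)
  case 0
  then show ?case
    using bandit_run.nn_integral_law_0[OF run] bandit_run.nn_integral_law_0[OF run'] by simp
next
  case (Suc t F)
  interpret run: bandit_run X d \<mu> P \<pi> by (rule run)
  interpret run': bandit_run X d \<mu>' P' \<pi> by (rule run')
  note F [measurable] = Suc.prems
  note run.hist_coord [measurable]
  have "(\<integral>\<^sup>+h. F h \<partial>run'.law (Suc t)) =
      (\<integral>\<^sup>+h. (\<integral>\<^sup>+x. (\<integral>\<^sup>+r. F (h(t := (x, r))) \<partial>P' x) \<partial>\<pi> t h) \<partial>run'.law t)"
    by (rule run'.nn_integral_law_Suc) fact
  also have "\<dots> = (\<integral>\<^sup>+h. (\<integral>\<^sup>+x. (\<integral>\<^sup>+r. \<rho> (x, r) * F (h(t := (x, r))) \<partial>P x) \<partial>\<pi> t h) \<partial>run'.law t)"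
  proof (intro nn_integral_cong dens)
    fix h x assume "h \<in> space (run'.law t)" "x \<in> space (\<pi> t h)"
    then have h: "h \<in> space (run.hist t)" and x: "x \<in> X"
      using run.space_\<pi> by (auto simp: run'.space_law)
    show "x \<in> X" by (rule x)
    show "(\<lambda>r. F (h(t := (x, r)))) \<in> borel_measurable borel"
      using x by (auto intro!: measurable_compose[OF _ F] measurable_compose[OF _ run.hist_upd_fixed[OF h]])
  qed
  \<comment> \<open>With the last round integrated out, the integrand depends on the first
    \<open>t\<close> rounds only, so the induction hypothesis applies to it.\<close>
  also have "\<dots> = (\<integral>\<^sup>+h. (\<Prod>s<t. \<rho> (h s)) *
      (\<integral>\<^sup>+x. (\<integral>\<^sup>+r. \<rho> (x, r) * F (h(t := (x, r))) \<partial>P x) \<partial>\<pi> t h) \<partial>run.law t)"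
    by (intro Suc.IH run.measurable_round_integral[where G="\<lambda>(h, z). \<rho> z * F (h(t := z))", simplified])
       (use measurable_compose[OF run.hist_upd F] in \<open>simp add: split_beta'\<close>)
  also have "\<dots> = (\<integral>\<^sup>+h. (\<integral>\<^sup>+x. (\<integral>\<^sup>+r. (\<Prod>s<Suc t. \<rho> ((h(t := (x, r))) s)) * F (h(t := (x, r))) \<partial>P x) \<partial>\<pi> t h) \<partial>run.law t)"
  proof (rule nn_integral_cong)
    fix h assume "h \<in> space (run.law t)"
    then have h: "h \<in> space (run.hist t)" by (simp add: run.space_law)
    have [measurable]: "(\<lambda>z. F (h(t := z))) \<in> borel_measurable (round_algebra X d)"
      by (rule measurable_compose[OF run.hist_upd_fixed[OF h] F])
    let ?Z = "\<Prod>s<t. \<rho> (h s)"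
    have "?Z * (\<integral>\<^sup>+x. (\<integral>\<^sup>+r. \<rho> (x, r) * F (h(t := (x, r))) \<partial>P x) \<partial>\<pi> t h) =
        (\<integral>\<^sup>+x. ?Z * (\<integral>\<^sup>+r. \<rho> (x, r) * F (h(t := (x, r))) \<partial>P x) \<partial>\<pi> t h)"
      by (intro nn_integral_cmult[symmetric])
         (use run.measurable_reward_integral[of "\<lambda>z. \<rho> z * F (h(t := z))"] in
          \<open>simp add: measurable_cong_sets[OF run.sets_\<pi>[OF h] refl]\<close>)
    also have "\<dots> = (\<integral>\<^sup>+x. (\<integral>\<^sup>+r. ?Z * (\<rho> (x, r) * F (h(t := (x, r)))) \<partial>P x) \<partial>\<pi> t h)"
    proof (intro nn_integral_cong nn_integral_cmult[symmetric])
      fix x assume "x \<in> space (\<pi> t h)"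
      then have x: "x \<in> X" using run.space_\<pi>[OF h] by simp
      have [measurable]: "Pair x \<in> borel \<rightarrow>\<^sub>M round_algebra X d"
        by (rule measurable_Pair1') (simp add: x)
      show "(\<lambda>r. \<rho> (x, r) * F (h(t := (x, r)))) \<in> borel_measurable (P x)"
        by (simp add: measurable_cong_sets[OF run.sets_P[OF x] refl])
    qed
    also have "\<dots> = (\<integral>\<^sup>+x. (\<integral>\<^sup>+r. (\<Prod>s<Suc t. \<rho> ((h(t := (x, r))) s)) * F (h(t := (x, r))) \<partial>P x) \<partial>\<pi> t h)"
      by (simp add: mult_ac)
    finally show "?Z * (\<integral>\<^sup>+x. (\<integral>\<^sup>+r. \<rho> (x, r) * F (h(t := (x, r))) \<partial>P x) \<partial>\<pi> t h) = \<dots>" .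
  qed
  also have "\<dots> = (\<integral>\<^sup>+h. (\<Prod>s<Suc t. \<rho> (h s)) * F h \<partial>run.law (Suc t))"
    by (rule run.nn_integral_law_Suc[symmetric]) measurable
  finally show ?case .
qed

text \<open>The conditional expectation of each factor is bounded whatever the past, so rounds can
  be peeled off from the last one. It serves twice: for the second moment of the likelihood ratio
  and for the moment generating function of sampled rewards.\<close>

lemma (in bandit_run) nn_integral_law_prod_le:
  assumes G [measurable]: "\<And>s. G s \<in> borel_measurable (round_algebra X d)"
    and "\<And>s h. s < t \<Longrightarrow> h \<in> space (hist s) \<Longrightarrow> (\<integral>\<^sup>+x. (\<integral>\<^sup>+r. G s (x, r) \<partial>P x) \<partial>\<pi> s h) \<le> c s"
  shows "(\<integral>\<^sup>+h. (\<Prod>s<t. G s (h s)) \<partial>law t) \<le> (\<Prod>s<t. c s)"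
  using assms(2)
proof (induction t)
  case 0
  show ?case using prob_space.emeasure_space_1[OF prob_law] by simp
next
  case (Suc t)
  note hist_coord [measurable]
  have "(\<integral>\<^sup>+h. (\<Prod>s<Suc t. G s (h s)) \<partial>law (Suc t)) =
      (\<integral>\<^sup>+h. (\<integral>\<^sup>+x. (\<integral>\<^sup>+r. (\<Prod>s<t. G s (h s)) * G t (x, r) \<partial>P x) \<partial>\<pi> t h) \<partial>law t)"
    by (subst nn_integral_law_Suc) (auto simp: mult_ac)
  also have "\<dots> \<le> (\<integral>\<^sup>+h. (\<Prod>s<t. G s (h s)) * c t \<partial>law t)"
  proof (rule nn_integral_mono)
    fix h assume "h \<in> space (law t)"
    then have h: "h \<in> space (hist t)" by (simp add: space_law)
    let ?Z = "\<Prod>s<t. G s (h s)"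
    have "(\<integral>\<^sup>+x. (\<integral>\<^sup>+r. ?Z * G t (x, r) \<partial>P x) \<partial>\<pi> t h) = (\<integral>\<^sup>+x. ?Z * (\<integral>\<^sup>+r. G t (x, r) \<partial>P x) \<partial>\<pi> t h)"
    proof (intro nn_integral_cong nn_integral_cmult)
      fix x assume "x \<in> space (\<pi> t h)"
      then have x: "x \<in> X" using space_\<pi>[OF h] by simp
      have [measurable]: "Pair x \<in> borel \<rightarrow>\<^sub>M round_algebra X d"
        by (rule measurable_Pair1') (simp add: x)
      show "(\<lambda>r. G t (x, r)) \<in> borel_measurable (P x)"
        by (simp add: measurable_cong_sets[OF sets_P[OF x] refl])
    qed
    also have "\<dots> = ?Z * (\<integral>\<^sup>+x. (\<integral>\<^sup>+r. G t (x, r) \<partial>P x) \<partial>\<pi> t h)"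
      by (rule nn_integral_cmult)
         (use measurable_reward_integral[OF G] in \<open>simp add: measurable_cong_sets[OF sets_\<pi>[OF h] refl]\<close>)
    also have "\<dots> \<le> ?Z * c t"
      by (intro mult_left_mono Suc.prems h) auto
    finally show "(\<integral>\<^sup>+x. (\<integral>\<^sup>+r. ?Z * G t (x, r) \<partial>P x) \<partial>\<pi> t h) \<le> ?Z * c t" .
  qed
  also have "\<dots> = (\<integral>\<^sup>+h. (\<Prod>s<t. G s (h s)) \<partial>law t) * c t"
    by (rule nn_integral_multc) measurable
  also have "\<dots> \<le> (\<Prod>s<t. c s) * c t"
    using Suc by (intro mult_right_mono) auto
  finally show ?case by simp
qed

section \<open>Bernoulli rewards and the likelihood ratio of two payoffs\<close>

definition bern :: "real \<Rightarrow> real measure" where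
  "bern p = distr (measure_pmf (bernoulli_pmf p)) borel of_bool"

lemma sets_bern [simp]: "sets (bern p) = sets borel"
  by (simp add: bern_def)

lemma prob_space_bern: "prob_space (bern p)"
  unfolding bern_def by (rule prob_space.prob_space_distr[OF prob_space_measure_pmf]) simp

lemma nn_integral_bern:
  assumes "0 \<le> p" "p \<le> 1" and [measurable]: "G \<in> borel_measurable borel"
  shows "(\<integral>\<^sup>+r. G r \<partial>bern p) = ennreal p * G 1 + ennreal (1 - p) * G 0"
  unfolding bern_def using assms by (subst nn_integral_distr) (auto simp: mult.commute)

lemma AE_bern: "AE r in bern p. r \<in> {0..1}"
  unfolding bern_def by (subst AE_distr_iff) (auto intro!: AE_I2)

lemma integral_bern: "0 \<le> p \<Longrightarrow> p \<le> 1 \<Longrightarrow> (\<integral>r. r \<partial>bern p) = p"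
  unfolding bern_def by (subst integral_distr) auto

lemma bern_kernel:
  assumes [measurable]: "\<nu> \<in> borel_measurable M" and r: "\<And>x. x \<in> space M \<Longrightarrow> 0 \<le> \<nu> x \<and> \<nu> x \<le> 1"
  shows "(\<lambda>x. bern (\<nu> x)) \<in> M \<rightarrow>\<^sub>M prob_algebra borel"
proof (rule measurable_prob_algebraI)
  show "prob_space (bern (\<nu> x))" for x by (rule prob_space_bern)
  show "(\<lambda>x. bern (\<nu> x)) \<in> M \<rightarrow>\<^sub>M subprob_algebra borel"
  proof (rule measurable_subprob_algebra)
    fix A :: "real set" assume A: "A \<in> sets borel"
    have "emeasure (bern (\<nu> x)) A = ennreal (\<nu> x) * indicator A 1 + ennreal (1 - \<nu> x) * indicator A 0"
      if "x \<in> space M" for x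
      using nn_integral_bern[of "\<nu> x" "indicator A"] r[OF that] A by simp
    then show "(\<lambda>x. emeasure (bern (\<nu> x)) A) \<in> borel_measurable M"
      by (subst measurable_cong) measurable
  qed (auto intro: prob_space_imp_subprob_space prob_space_bern)
qed

text \<open>The range from 1/2 to 3/4 keeps the Bernoulli variance at least 3/16, which controls the
  likelihood ratios, and leaves room 1/4 above the base level 1/2 for bumps.\<close>

definition payoff :: "'a set \<Rightarrow> ('a \<Rightarrow> 'a \<Rightarrow> real) \<Rightarrow> ('a \<Rightarrow> real) \<Rightarrow> bool" where
  "payoff X d \<nu> \<longleftrightarrow> (\<forall>x\<in>X. 1 / 2 \<le> \<nu> x \<and> \<nu> x \<le> 3 / 4) \<and> (\<forall>x\<in>X. \<forall>y\<in>X. \<bar>\<nu> x - \<nu> y\<bar> \<le> d x y)"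

lemma payoff_run:
  assumes "Metric_space X d" "X \<noteq> {}" "bandit_algorithm X d \<pi>" "payoff X d \<nu>"
  shows "bandit_run X d \<nu> (\<lambda>x. bern (\<nu> x)) \<pi>"
proof (rule bandit_run.intro)
  show "lipschitz_instance X d \<nu> (\<lambda>x. bern (\<nu> x))"
    unfolding lipschitz_instance_def
  proof (intro conjI ballI AE_bern)
    have "\<nu> \<in> borel_measurable (arm_algebra X d)"
      using assms by (intro Metric_space.lipschitz_borel_measurable) (auto simp: payoff_def)
    then show "(\<lambda>x. bern (\<nu> x)) \<in> arm_algebra X d \<rightarrow>\<^sub>M prob_algebra borel"
      using assms by (intro bern_kernel) (force simp: payoff_def space_arm_algebra)+
  qed (use assms in \<open>force simp: payoff_def intro!: integral_bern\<close>)+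
qed (use assms in auto)

text \<open>The density of \<open>bern (\<nu>' x)\<close> with respect to
  \<open>bern (\<nu> x)\<close>; rewards other than 0 and 1 form a null set and are treated like
  0.\<close>

definition likelihood_ratio :: "('a \<Rightarrow> real) \<Rightarrow> ('a \<Rightarrow> real) \<Rightarrow> 'a \<times> real \<Rightarrow> real" where
  "likelihood_ratio \<nu> \<nu>' = (\<lambda>(x, r). if r = 1 then \<nu>' x / \<nu> x else (1 - \<nu>' x) / (1 - \<nu> x))"

locale two_payoffs =
  fixes X :: "'a set" and d \<nu> \<nu>' \<pi>
  assumes metric: "Metric_space X d" and nonempty: "X \<noteq> {}" and alg: "bandit_algorithm X d \<pi>"
    and payoff: "payoff X d \<nu>" and payoff': "payoff X d \<nu>'"
begin

sublocale run: bandit_run X d \<nu> "\<lambda>x. bern (\<nu> x)" \<pi>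
  by (rule payoff_run[OF metric nonempty alg payoff])

sublocale run': bandit_run X d \<nu>' "\<lambda>x. bern (\<nu>' x)" \<pi>
  by (rule payoff_run[OF metric nonempty alg payoff'])

abbreviation "\<rho> \<equiv> likelihood_ratio \<nu> \<nu>'"

lemma payoff_bounds:
  assumes "x \<in> X"
  shows "1 / 2 \<le> \<nu> x" "\<nu> x \<le> 3 / 4" "1 / 2 \<le> \<nu>' x" "\<nu>' x \<le> 3 / 4"
  using payoff payoff' assms by (auto simp: payoff_def)

lemma \<rho>_measurable [measurable]: "\<rho> \<in> borel_measurable (round_algebra X d)"
  unfolding likelihood_ratio_def by measurable

lemma \<rho>_nonneg: "fst z \<in> X \<Longrightarrow> 0 \<le> \<rho> z"
  using payoff_bounds[of "fst z"] by (auto simp: likelihood_ratio_def split_beta)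

lemma change_of_measure:
  assumes "F \<in> borel_measurable (run.hist t)"
  shows "(\<integral>\<^sup>+h. F h \<partial>run'.law t) = (\<integral>\<^sup>+h. (\<Prod>s<t. ennreal (\<rho> (h s))) * F h \<partial>run.law t)"
proof (rule nn_integral_law_change_of_measure[OF run.bandit_run_axioms run'.bandit_run_axioms _ _ assms])
  fix x and G :: "real \<Rightarrow> ennreal" assume x: "x \<in> X" and [measurable]: "G \<in> borel_measurable borel"
  have [measurable]: "Pair x \<in> borel \<rightarrow>\<^sub>M round_algebra X d"
    by (rule measurable_Pair1') (simp add: x)
  note b = payoff_bounds[OF x]
  have "(\<integral>\<^sup>+r. ennreal (\<rho> (x, r)) * G r \<partial>bern (\<nu> x)) =
      ennreal (\<nu> x) * (ennreal (\<nu>' x / \<nu> x) * G 1) + ennreal (1 - \<nu> x) * (ennreal ((1 - \<nu>' x) / (1 - \<nu> x)) * G 0)"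
    using b by (subst nn_integral_bern) (auto simp: likelihood_ratio_def)
  also have "\<dots> = ennreal (\<nu>' x) * G 1 + ennreal (1 - \<nu>' x) * G 0"
    using b by (simp flip: mult.assoc ennreal_mult)
  also have "\<dots> = (\<integral>\<^sup>+r. G r \<partial>bern (\<nu>' x))"
    using b by (subst nn_integral_bern) auto
  finally show "(\<integral>\<^sup>+r. G r \<partial>bern (\<nu>' x)) = (\<integral>\<^sup>+r. ennreal (\<rho> (x, r)) * G r \<partial>bern (\<nu> x))" ..
qed measurable

text \<open>In one round the second moment is 1 plus the chi-square divergence
  \<open>(q - p)\<^sup>2 / (p * (1 - p))\<close>, and \<open>p * (1 - p) \<ge> 3 / 16\<close> gives
  the factor 6. The bound is the same for all arms, so it multiplies over the rounds however the
  arms are chosen.\<close>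

lemma second_moment:
  assumes "\<And>x. x \<in> X \<Longrightarrow> \<bar>\<nu>' x - \<nu> x\<bar> \<le> \<delta>"
  shows "(\<integral>\<^sup>+h. (\<Prod>s<t. ennreal ((\<rho> (h s))\<^sup>2)) \<partial>run.law t) \<le> ennreal ((1 + 6 * \<delta>\<^sup>2) ^ t)"
proof -
  have one: "(\<integral>\<^sup>+r. ennreal ((\<rho> (x, r))\<^sup>2) \<partial>bern (\<nu> x)) \<le> ennreal (1 + 6 * \<delta>\<^sup>2)" if x: "x \<in> X" for x
  proof -
    have [measurable]: "Pair x \<in> borel \<rightarrow>\<^sub>M round_algebra X d"
      by (rule measurable_Pair1') (simp add: x)
    define p q where "p = \<nu> x" and "q = \<nu>' x"
    have b: "1 / 2 \<le> p" "p \<le> 3 / 4" "1 / 2 \<le> q" "q \<le> 3 / 4"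
      using payoff_bounds[OF x] by (auto simp: p_def q_def)
    have "(q - p)\<^sup>2 \<le> \<delta>\<^sup>2"
      using assms[OF x] unfolding p_def q_def by (metis abs_ge_zero power2_abs power_mono)
    have "(\<integral>\<^sup>+r. ennreal ((\<rho> (x, r))\<^sup>2) \<partial>bern p) = ennreal p * ennreal ((q / p)\<^sup>2) + ennreal (1 - p) * ennreal (((1 - q) / (1 - p))\<^sup>2)"
      using b by (subst nn_integral_bern) (auto simp: likelihood_ratio_def p_def q_def)
    also have "\<dots> = ennreal (p * (q / p)\<^sup>2 + (1 - p) * ((1 - q) / (1 - p))\<^sup>2)"
      using b by (simp add: ennreal_mult)
    also have "p * (q / p)\<^sup>2 + (1 - p) * ((1 - q) / (1 - p))\<^sup>2 = 1 + (q - p)\<^sup>2 / (p * (1 - p))"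
      using b by (simp add: power2_eq_square divide_simps) algebra
    also have "\<dots> \<le> 1 + 6 * \<delta>\<^sup>2"
    proof -
      have "0 \<le> (p - 1 / 4) * (3 / 4 - p)" using b by (intro mult_nonneg_nonneg) auto
      then have "3 / 16 \<le> p * (1 - p)" by (simp add: field_simps)
      then have "1 \<le> 6 * (p * (1 - p))" by linarith
      then have "(q - p)\<^sup>2 * 1 \<le> (q - p)\<^sup>2 * (6 * (p * (1 - p)))"
        by (rule mult_left_mono) simp
      then have "(q - p)\<^sup>2 \<le> 6 * (q - p)\<^sup>2 * (p * (1 - p))"
        by (simp only: mult_ac mult_1_right)
      then have "(q - p)\<^sup>2 / (p * (1 - p)) \<le> 6 * (q - p)\<^sup>2"
        using b by (subst pos_divide_le_eq) auto
      then show ?thesis using \<open>(q - p)\<^sup>2 \<le> \<delta>\<^sup>2\<close> by simp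
    qed
    finally show "(\<integral>\<^sup>+r. ennreal ((\<rho> (x, r))\<^sup>2) \<partial>bern (\<nu> x)) \<le> ennreal (1 + 6 * \<delta>\<^sup>2)"
      by (simp add: p_def ennreal_leI)
  qed
  have "(\<integral>\<^sup>+h. (\<Prod>s<t. ennreal ((\<rho> (h s))\<^sup>2)) \<partial>run.law t) \<le> (\<Prod>s<t. ennreal (1 + 6 * \<delta>\<^sup>2))"
  proof (rule run.nn_integral_law_prod_le)
    fix s h assume h: "h \<in> space (run.hist s)"
    have "(\<integral>\<^sup>+x. (\<integral>\<^sup>+r. ennreal ((\<rho> (x, r))\<^sup>2) \<partial>bern (\<nu> x)) \<partial>\<pi> s h) \<le> (\<integral>\<^sup>+x. ennreal (1 + 6 * \<delta>\<^sup>2) \<partial>\<pi> s h)"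
      by (intro nn_integral_mono one) (simp add: run.space_\<pi>[OF h])
    then show "(\<integral>\<^sup>+x. (\<integral>\<^sup>+r. ennreal ((\<rho> (x, r))\<^sup>2) \<partial>bern (\<nu> x)) \<partial>\<pi> s h) \<le> ennreal (1 + 6 * \<delta>\<^sup>2)"
      using prob_space.emeasure_space_1[OF run.\<pi>_prob[OF h]] by simp
  qed measurable
  also have "(\<Prod>s<t. ennreal (1 + 6 * \<delta>\<^sup>2)) = ennreal ((1 + 6 * \<delta>\<^sup>2) ^ t)"
    by (simp only: prod_constant card_lessThan) (rule ennreal_power, simp)
  finally show ?thesis .
qed

text \<open>The likelihood ratio \<open>Z\<close> has mean 1, so the two expectations of
  \<open>N\<close> differ by that of \<open>(Z - 1) * N\<close>, which is at most
  \<open>1 / 8 + 2 * (Z - 1)\<^sup>2\<close>. The bound 1/192 makes the mean of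
  \<open>Z\<^sup>2\<close> at most 17/16, and 1/8 + 2/16 = 1/4.\<close>

lemma expectation_close:
  assumes \<delta>: "\<And>x. x \<in> X \<Longrightarrow> \<bar>\<nu>' x - \<nu> x\<bar> \<le> \<delta>" and small: "t * \<delta>\<^sup>2 \<le> 1 / 192"
    and N [measurable]: "N \<in> borel_measurable (run.hist t)" and N1: "\<And>h. h \<in> space (run.hist t) \<Longrightarrow> 0 \<le> N h \<and> N h \<le> (1 :: real)"
  shows "(\<integral>\<^sup>+h. N h \<partial>run'.law t) \<le> (\<integral>\<^sup>+h. N h \<partial>run.law t) + ennreal (1 / 4)"
proof -
  note run.hist_coord [measurable]
  interpret prob_space "run.law t" by (rule run.prob_law)
  define Z where "Z = (\<lambda>h :: nat \<Rightarrow> 'a \<times> real. \<Prod>s<t. \<rho> (h s))"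
  have [measurable]: "Z \<in> borel_measurable (run.hist t)"
    unfolding Z_def by measurable
  have Z: "(\<Prod>s<t. ennreal (\<rho> (h s))) = ennreal (Z h)" "(\<Prod>s<t. ennreal ((\<rho> (h s))\<^sup>2)) = ennreal ((Z h)\<^sup>2)" "0 \<le> Z h"
    if "h \<in> space (run.law t)" for h
    using run.hist_arm[of h t] that prod_ennreal[of "{..<t}" "\<lambda>s. (\<rho> (h s))\<^sup>2"]
    by (auto simp: run.space_law Z_def \<rho>_nonneg prod_power_distrib intro!: prod_nonneg prod_ennreal)
  have E': "(\<integral>\<^sup>+h. F h \<partial>run'.law t) = (\<integral>\<^sup>+h. ennreal (Z h) * F h \<partial>run.law t)"
    if "F \<in> borel_measurable (run.hist t)" for F
    using change_of_measure[OF that] by (simp add: Z cong: nn_integral_cong_simp)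
  have "(1 + 6 * \<delta>\<^sup>2) ^ t \<le> exp (6 * \<delta>\<^sup>2) ^ t"
    by (intro power_mono) (auto intro: exp_ge_add_one_self)
  also have "\<dots> = exp (6 * (t * \<delta>\<^sup>2))" by (simp flip: exp_of_nat_mult add: mult_ac)
  also have "\<dots> \<le> exp (1 / 32)" using small by simp
  also have "\<dots> \<le> 1 + 1 / 32 + (1 / 32)\<^sup>2" by (rule exp_bound) auto
  also have "\<dots> \<le> 17 / 16" by (simp add: power2_eq_square)
  finally have "(\<integral>\<^sup>+h. ennreal ((Z h)\<^sup>2) \<partial>run.law t) \<le> ennreal (17 / 16)"
    using order_trans[OF second_moment[OF \<delta>, where t=t] ennreal_leI] by (simp add: Z cong: nn_integral_cong_simp)
  then have Z2: "2 * (\<integral>\<^sup>+h. ennreal ((Z h)\<^sup>2) \<partial>run.law t) \<le> 2 * ennreal (17 / 16)"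
    by (rule mult_left_mono) simp
  have Z1: "(\<integral>\<^sup>+h. ennreal (Z h) \<partial>run.law t) = 1"
    using E'[of "\<lambda>_. 1"] prob_space.emeasure_space_1[OF run'.prob_law] by simp
  \<comment> \<open>The summand 4 is four times the mean of \<open>Z\<close>; it carries the term
    \<open>- 4 * Z\<close> of \<open>2 * (Z - 1)\<^sup>2\<close> to the other side. The constant
    17/8 below is 1/8 plus the remaining 2.\<close>
  have "(\<integral>\<^sup>+h. N h \<partial>run'.law t) + 4 = (\<integral>\<^sup>+h. ennreal (Z h) * N h \<partial>run.law t) + 4 * (\<integral>\<^sup>+h. ennreal (Z h) \<partial>run.law t)"
    by (simp add: E' Z1)
  also have "\<dots> = (\<integral>\<^sup>+h. ennreal (Z h) * N h + 4 * ennreal (Z h) \<partial>run.law t)"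
    by (simp add: nn_integral_add nn_integral_cmult)
  also have "\<dots> \<le> (\<integral>\<^sup>+h. ennreal (N h) + (ennreal (17 / 8) + 2 * ennreal ((Z h)\<^sup>2)) \<partial>run.law t)"
  proof (rule nn_integral_mono)
    fix h assume h: "h \<in> space (run.law t)"
    then have n: "0 \<le> N h" "N h \<le> 1" "0 \<le> Z h" using N1[of h] Z by (auto simp: run.space_law)
    (* Cauchy-Schwarz in the additive form |z| <= 1/8 + 2 z^2, so that no signed integral is needed *)
    have "(Z h - 1) * N h \<le> \<bar>Z h - 1\<bar>"
      using n by (metis abs_ge_self abs_ge_zero abs_mult abs_of_nonneg mult_left_le order_trans)
    also have "\<dots> \<le> 1 / 8 + 2 * (Z h - 1)\<^sup>2"
      using sum_squares_bound[of "\<bar>Z h - 1\<bar>" "1 / 4"] zero_le_power2[of "4 * \<bar>Z h - 1\<bar> - 1"]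
      by (simp add: power2_eq_square algebra_simps abs_mult_self_eq)
    finally have "Z h * N h + 4 * Z h \<le> N h + (17 / 8 + 2 * (Z h)\<^sup>2)"
      by (simp add: power2_eq_square algebra_simps)
    then show "ennreal (Z h) * N h + 4 * ennreal (Z h) \<le> ennreal (N h) + (ennreal (17 / 8) + 2 * ennreal ((Z h)\<^sup>2))"
      using n by (simp flip: ennreal_mult ennreal_plus ennreal_numeral)
  qed
  also have "\<dots> = (\<integral>\<^sup>+h. N h \<partial>run.law t) + (ennreal (17 / 8) + 2 * (\<integral>\<^sup>+h. ennreal ((Z h)\<^sup>2) \<partial>run.law t))"
    by (simp add: nn_integral_add nn_integral_cmult emeasure_space_1)
  also have "\<dots> \<le> (\<integral>\<^sup>+h. N h \<partial>run.law t) + (ennreal (17 / 8) + 2 * ennreal (17 / 16))"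
    by (intro add_left_mono Z2)
  also have "ennreal (17 / 8) + 2 * ennreal (17 / 16) = ennreal (1 / 4) + 4"
    by (simp flip: ennreal_mult ennreal_plus ennreal_numeral)
  finally have "4 + (\<integral>\<^sup>+h. N h \<partial>run'.law t) \<le> 4 + ((\<integral>\<^sup>+h. N h \<partial>run.law t) + ennreal (1 / 4))"
    by (simp add: add_ac)
  then show ?thesis by (simp add: ennreal_add_left_cancel_le)
qed

text \<open>On histories that avoid \<open>A\<close> the likelihood ratio is 1, so avoiding
  \<open>A\<close> has the same probability in both runs, at least 3/4 by Markov's inequality.
  Otherwise \<open>A\<close> is visited at most \<open>t\<close> times. Thus a bump on
  \<open>A\<close> may have any height.\<close>

lemma visits_le_of_agree_off:
  assumes A [measurable]: "A \<in> sets (arm_algebra X d)" and eq: "\<And>x. x \<in> X - A \<Longrightarrow> \<nu>' x = \<nu> x"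
    and few: "(\<integral>\<^sup>+h. (\<Sum>s<t. indicator A (fst (h s))) \<partial>run.law t) \<le> ennreal (1 / 4)"
  shows "(\<integral>\<^sup>+h. (\<Sum>s<t. indicator A (fst (h s))) \<partial>run'.law t) \<le> ennreal (3 / 4 * t)"
proof -
  note run.hist_coord [measurable]
  note [measurable_cong] = run.sets_law run'.sets_law
  have XA [measurable]: "X - A \<in> sets (arm_algebra X d)"
    using sets.compl_sets[OF A] by simp
  let ?V = "\<lambda>h :: nat \<Rightarrow> 'a \<times> real. \<Sum>s<t. indicator A (fst (h s)) :: ennreal"
  define avoid where "avoid = (\<lambda>h :: nat \<Rightarrow> 'a \<times> real. \<Prod>s<t. indicator (X - A) (fst (h s)) :: ennreal)"
  have [measurable]: "avoid \<in> borel_measurable (run.hist t)"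
    unfolding avoid_def by measurable
  have avoid_cases: "avoid h = 1 \<and> ?V h = 0 \<or> avoid h = 0 \<and> 1 \<le> ?V h \<and> ?V h \<le> of_nat t"
    if "h \<in> space (run.hist t)" for h
  proof (cases "\<exists>s<t. fst (h s) \<in> A")
    case True
    then obtain s where s: "s < t" "fst (h s) \<in> A" by blast
    then have "indicator A (fst (h s)) \<le> ?V h"
      by (intro member_le_sum) auto
    moreover have "?V h \<le> (\<Sum>s<t. 1)"
      by (rule sum_mono) (simp split: split_indicator)
    moreover have "avoid h = 0"
      unfolding avoid_def using s by (intro prod_zero bexI[of _ s]) auto
    ultimately show ?thesis using s by simp
  next
    case False
    then show ?thesis
      using run.hist_arm[OF that] by (auto simp: avoid_def)
  qed
  have "(\<integral>\<^sup>+h. avoid h \<partial>run'.law t) = (\<integral>\<^sup>+h. (\<Prod>s<t. ennreal (\<rho> (h s))) * avoid h \<partial>run.law t)"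
    by (rule change_of_measure) measurable
  also have "\<dots> = (\<integral>\<^sup>+h. avoid h \<partial>run.law t)"
  proof (rule nn_integral_cong)
    fix h assume h: "h \<in> space (run.law t)"
    have "ennreal (\<rho> (h s)) * indicator (X - A) (fst (h s)) = indicator (X - A) (fst (h s))" if "s < t" for s
      using eq[of "fst (h s)"] payoff_bounds[of "fst (h s)"]
      by (auto simp: likelihood_ratio_def split_beta split: split_indicator)
    then show "(\<Prod>s<t. ennreal (\<rho> (h s))) * avoid h = avoid h"
      by (simp add: avoid_def flip: prod.distrib)
  qed
  finally have same: "(\<integral>\<^sup>+h. avoid h \<partial>run'.law t) = (\<integral>\<^sup>+h. avoid h \<partial>run.law t)" .
  have "1 = (\<integral>\<^sup>+h. 1 \<partial>run.law t)"
    using prob_space.emeasure_space_1[OF run.prob_law] by simp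
  also have "\<dots> \<le> (\<integral>\<^sup>+h. avoid h + ?V h \<partial>run.law t)"
    using avoid_cases by (intro nn_integral_mono) (force simp: run.space_law)
  also have "\<dots> = (\<integral>\<^sup>+h. avoid h \<partial>run.law t) + (\<integral>\<^sup>+h. ?V h \<partial>run.law t)"
    by (rule nn_integral_add) measurable
  also have "\<dots> \<le> (\<integral>\<^sup>+h. avoid h \<partial>run.law t) + ennreal (1 / 4)"
    by (rule add_left_mono[OF few])
  finally have lo: "1 \<le> (\<integral>\<^sup>+h. avoid h \<partial>run'.law t) + ennreal (1 / 4)"
    by (simp add: same)
  have "(\<integral>\<^sup>+h. ?V h \<partial>run'.law t) + of_nat t * (\<integral>\<^sup>+h. avoid h \<partial>run'.law t) = (\<integral>\<^sup>+h. ?V h + of_nat t * avoid h \<partial>run'.law t)"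
    by (subst nn_integral_cmult[symmetric], measurable, subst nn_integral_add) measurable
  also have "\<dots> \<le> (\<integral>\<^sup>+h. of_nat t \<partial>run'.law t)"
    using avoid_cases by (intro nn_integral_mono) (force simp: run'.space_law)
  also have "\<dots> = of_nat t"
    using prob_space.emeasure_space_1[OF run'.prob_law] by simp
  finally have hi: "(\<integral>\<^sup>+h. ?V h \<partial>run'.law t) + of_nat t * (\<integral>\<^sup>+h. avoid h \<partial>run'.law t) \<le> ennreal t"
    by (simp add: ennreal_of_nat_eq_real_of_nat)
  have "(\<integral>\<^sup>+h. avoid h \<partial>run'.law t) \<le> (\<integral>\<^sup>+h. 1 \<partial>run'.law t)"
    using avoid_cases by (intro nn_integral_mono) (force simp: run'.space_law)
  also have "\<dots> = 1"
    using prob_space.emeasure_space_1[OF run'.prob_law] by simp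
  finally obtain a where a: "(\<integral>\<^sup>+h. avoid h \<partial>run'.law t) = ennreal a" "0 \<le> a"
    by (cases "\<integral>\<^sup>+h. avoid h \<partial>run'.law t") (auto simp: top_unique)
  obtain v where v: "(\<integral>\<^sup>+h. ?V h \<partial>run'.law t) = ennreal v" "0 \<le> v"
    using hi by (cases "\<integral>\<^sup>+h. ?V h \<partial>run'.law t") (auto simp: top_unique)
  have "3 / 4 \<le> a"
    using lo a by (simp flip: ennreal_plus ennreal_1)
  have "v + t * a \<le> t"
    using hi a v by (simp add: ennreal_of_nat_eq_real_of_nat flip: ennreal_plus ennreal_mult)
  moreover have "t * (3 / 4) \<le> t * a" using \<open>3 / 4 \<le> a\<close> by (intro mult_left_mono) auto
  ultimately show ?thesis using v by (auto intro!: ennreal_leI)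
qed

end

section \<open>Hard payoff functions\<close>

text \<open>The constant \<open>C\<close> is fixed once the instance is, so regret of order
  \<open>sqrt t\<close> at arbitrarily late times contradicts the bound
  \<open>C * g t\<close>.\<close>

lemma not_tractable_if_hard_payoffs:
  assumes "Metric_space X d" "X \<noteq> {}"
    and hard: "\<And>\<pi>. bandit_algorithm X d \<pi> \<Longrightarrow> \<exists>\<mu> c. payoff X d \<mu> \<and> 0 < c \<and>
      (\<forall>n. \<exists>t\<ge>n. c * sqrt (real t) \<le> regret X d \<mu> (\<lambda>x. bern (\<mu> x)) \<pi> t)"
    and g: "little_o_sqrt g"
  shows "\<not> tractable X d g"
proof
  assume "tractable X d g"
  then obtain \<pi> where \<pi>: "bandit_algorithm X d \<pi>"
    and tr: "\<And>\<mu> P. lipschitz_instance X d \<mu> P \<Longrightarrow> \<exists>C. \<forall>t\<ge>1. regret X d \<mu> P \<pi> t \<le> C * g t"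
    unfolding tractable_def by blast
  from hard[OF \<pi>] obtain \<mu> c where \<mu>: "payoff X d \<mu>" and c: "c > 0"
    and often: "\<And>n. \<exists>t\<ge>n. c * sqrt (real t) \<le> regret X d \<mu> (\<lambda>x. bern (\<mu> x)) \<pi> t" by blast
  have "lipschitz_instance X d \<mu> (\<lambda>x. bern (\<mu> x))"
    using payoff_run[OF assms(1,2) \<pi> \<mu>] by (rule bandit_run.inst)
  from tr[OF this] obtain C where C: "\<And>t. t \<ge> 1 \<Longrightarrow> regret X d \<mu> (\<lambda>x. bern (\<mu> x)) \<pi> t \<le> C * g t" by blast
  \<comment> \<open>Chosen so that \<open>\<bar>C\<bar> * e < c\<close>; the summand 1 covers
    \<open>C = 0\<close>.\<close>
  define e where "e = c / (\<bar>C\<bar> + 1)"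
  have "e > 0" using c by (simp add: e_def)
  then obtain N where N: "\<And>t. t \<ge> N \<Longrightarrow> \<bar>g t / sqrt (real t)\<bar> < e"
    using g LIMSEQ_D[of "\<lambda>t. g t / sqrt (real t)" 0 e] unfolding little_o_sqrt_def by auto
  obtain t where t: "t \<ge> max N 1" "c * sqrt (real t) \<le> regret X d \<mu> (\<lambda>x. bern (\<mu> x)) \<pi> t"
    using often by blast
  have s: "sqrt (real t) > 0" using t by simp
  have "\<bar>g t\<bar> \<le> e * sqrt (real t)"
    using N[of t] t s by (simp add: abs_divide divide_less_eq)
  have "c * sqrt (real t) \<le> C * g t"
    using C[of t] t by linarith
  also have "\<dots> \<le> \<bar>C\<bar> * \<bar>g t\<bar>" by (metis abs_ge_self abs_mult)
  also have "\<dots> \<le> \<bar>C\<bar> * (e * sqrt (real t))"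
    using \<open>\<bar>g t\<bar> \<le> e * sqrt (real t)\<close> by (rule mult_left_mono) simp
  finally have "c \<le> \<bar>C\<bar> * e" using s by simp
  also have "\<dots> < (\<bar>C\<bar> + 1) * e" using \<open>e > 0\<close> by simp
  also have "\<dots> = c" by (simp add: e_def)
  finally show False by simp
qed

lemma payoff_limit:
  assumes p: "\<And>n :: nat. payoff X d (\<nu> n)" and mono: "\<And>n x. x \<in> X \<Longrightarrow> \<nu> n x \<le> \<nu> (Suc n) x"
  shows "\<exists>\<mu>. payoff X d \<mu> \<and> (\<forall>x\<in>X. (\<lambda>n. \<nu> n x) \<longlonglongrightarrow> \<mu> x \<and> (\<forall>n. \<nu> n x \<le> \<mu> x))"
proof (intro exI conjI ballI allI)
  define \<mu> where "\<mu> = (\<lambda>x. SUP n. \<nu> n x)"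
  have inc: "incseq (\<lambda>n. \<nu> n x)" if "x \<in> X" for x
    using mono[OF that] by (rule incseq_SucI)
  have bdd: "bdd_above (range (\<lambda>n. \<nu> n x))" if "x \<in> X" for x
    using p that by (auto simp: payoff_def intro!: bdd_aboveI[of _ "3 / 4"])
  show lim: "(\<lambda>n. \<nu> n x) \<longlonglongrightarrow> \<mu> x" if "x \<in> X" for x
    unfolding \<mu>_def by (rule LIMSEQ_incseq_SUP[OF bdd[OF that] inc[OF that]])
  show "\<nu> n x \<le> \<mu> x" if "x \<in> X" for n x
    unfolding \<mu>_def by (rule cSUP_upper[OF _ bdd[OF that]]) simp
  show "payoff X d \<mu>"
    unfolding payoff_def
  proof (intro conjI ballI)
    fix x assume x: "x \<in> X"
    show "1 / 2 \<le> \<mu> x"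
      using lim[OF x] by (rule LIMSEQ_le_const) (use p x in \<open>auto simp: payoff_def\<close>)
    show "\<mu> x \<le> 3 / 4"
      using lim[OF x] by (rule LIMSEQ_le_const2) (use p x in \<open>auto simp: payoff_def\<close>)
    fix y assume y: "y \<in> X"
    have "(\<lambda>n. \<bar>\<nu> n x - \<nu> n y\<bar>) \<longlonglongrightarrow> \<bar>\<mu> x - \<mu> y\<bar>"
      by (intro tendsto_intros lim x y)
    then show "\<bar>\<mu> x - \<mu> y\<bar> \<le> d x y"
      by (rule LIMSEQ_le_const2) (use p x y in \<open>auto simp: payoff_def\<close>)
  qed
qed

section \<open>Spaces that are not totally bounded\<close>

lemma (in Metric_space) payoff_maxI:
  assumes "payoff M d \<nu>" "payoff M d \<nu>'"
  shows "payoff M d (\<lambda>u. max (\<nu> u) (\<nu>' u))"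
  unfolding payoff_def
proof (intro conjI ballI)
  fix u v assume "u \<in> M" "v \<in> M"
  then have "\<bar>\<nu> u - \<nu> v\<bar> \<le> d u v" "\<bar>\<nu>' u - \<nu>' v\<bar> \<le> d u v"
    using assms by (auto simp: payoff_def)
  then show "\<bar>max (\<nu> u) (\<nu>' u) - max (\<nu> v) (\<nu>' v)\<bar> \<le> d u v" by linarith
qed (use assms in \<open>force simp: payoff_def max_def\<close>)+

text \<open>Within a given horizon, the expected number of visits to the tail of an infinite family
  of disjoint balls tends to 0. A bump placed far out in the family goes unnoticed whatever its
  height.\<close>

lemma (in Metric_space) hard_payoff_if_separated_sequence:
  assumes x: "\<And>k :: nat. x k \<in> M" and e: "0 < e" "e \<le> 1" and sep: "\<And>j k. j \<noteq> k \<Longrightarrow> e \<le> d (x j) (x k)"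
    and alg: "bandit_algorithm M d \<pi>"
  shows "\<exists>\<mu> c. payoff M d \<mu> \<and> 0 < c \<and>
      (\<forall>n. \<exists>t\<ge>n. c * sqrt (real t) \<le> regret M d \<mu> (\<lambda>x. bern (\<mu> x)) \<pi> t)"
proof -
  have ne: "M \<noteq> {}" using x by auto
  note run = payoff_run[OF Metric_space_axioms ne alg]
  \<comment> \<open>The whole tail and not one ball, because all later bumps must also be unnoticed
    up to the current horizon. Radius \<open>e / 4\<close> keeps the balls disjoint, so every point
    eventually leaves the tails.\<close>
  define A where "A = (\<lambda>K. \<Union>k\<in>{K..}. mball (x k) (e / 4))"
  have A_sets: "A K \<in> sets (arm_algebra M d)" for K
    unfolding A_def by (intro openin_arm_algebra openin_Union) auto
  have A_vanish: "(\<lambda>K. indicator (A K) y :: ennreal) \<longlonglongrightarrow> 0" for y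
  proof (cases "\<exists>k. y \<in> mball (x k) (e / 4)")
    case True
    then obtain k where k: "y \<in> mball (x k) (e / 4)" by blast
    have "y \<notin> A K" if "K > k" for K
    proof
      assume "y \<in> A K"
      then obtain j where j: "j \<ge> K" "y \<in> mball (x j) (e / 4)" by (auto simp: A_def)
      then have "d (x j) (x k) \<le> d (x j) y + d y (x k)" using k by (intro triangle) auto
      also have "\<dots> < e" using j k e by (auto simp: commute)
      finally show False using sep[of j k] j that by auto
    qed
    then have "eventually (\<lambda>K. indicator (A K) y = (0 :: ennreal)) sequentially"
      unfolding eventually_sequentially by (intro exI[of _ "Suc k"]) (auto simp: Suc_le_eq)
    then show ?thesis by (rule tendsto_eventually)
  next
    case False
    then have "y \<notin> A K" for K by (auto simp: A_def)
    then show ?thesis by simp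
  qed
  \<comment> \<open>Level \<open>n\<close> gains \<open>e / 8 * (1 / 2) ^ n\<close>, and all levels
    stay below \<open>1 / 2 + e / 4\<close>, so that a bump of slope 1 has sunk to 1/2 at distance
    \<open>e / 4\<close> from its centre.\<close>
  define lev where "lev = (\<lambda>n :: nat. 1 / 2 + e / 4 * (1 - (1 / 2) ^ n))"
  have lev: "1 / 2 \<le> lev n" "lev n \<le> 1 / 2 + e / 4" "lev n \<le> lev (Suc n)" for n
    using e by (auto simp: lev_def power_le_one mult_le_cancel_left)
  \<comment> \<open>The horizon grows so fast that \<open>t n\<close> times the gain of level
    \<open>n\<close> is of order \<open>8 ^ n\<close>, above
    \<open>sqrt (t n) = 4 ^ n\<close>.\<close>
  define t where "t = (\<lambda>n :: nat. 16 ^ n :: nat)"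
  define bump where "bump = (\<lambda>n k u. max (1 / 2) (lev n - d (x k) u))"
  have bump: "payoff M d (bump n k)" for n k
    unfolding payoff_def
  proof (intro conjI ballI)
    fix u assume u: "u \<in> M"
    show "1 / 2 \<le> bump n k u" by (simp add: bump_def)
    show "bump n k u \<le> 3 / 4" unfolding bump_def using lev[of n] e nonneg[of "x k" u] by linarith
    fix v assume v: "v \<in> M"
    have "\<bar>bump n k u - bump n k v\<bar> \<le> \<bar>d (x k) u - d (x k) v\<bar>" unfolding bump_def by linarith
    also have "\<dots> \<le> d u v"
      using dist_diff_le[of "x k" u "x k" v] x u v by simp
    finally show "\<bar>bump n k u - bump n k v\<bar> \<le> d u v" .
  qed
  define St where "St = (\<lambda>n (S :: ('a \<Rightarrow> real) \<times> nat). payoff M d (fst S) \<and> (\<forall>u\<in>M. fst S u \<le> lev n))"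
  define Next where "Next = (\<lambda>n (S :: ('a \<Rightarrow> real) \<times> nat) (S' :: ('a \<Rightarrow> real) \<times> nat). snd S \<le> snd S' \<and>
     fst S' = (\<lambda>u. max (fst S u) (bump (Suc n) (snd S') u)) \<and>
     (\<integral>\<^sup>+h. (\<Sum>s<t n. indicator (A (snd S')) (fst (h s))) \<partial>history_law M d (\<lambda>x. bern (fst S x)) \<pi> (t n)) \<le> ennreal (1 / 4))"
  have "\<exists>S. \<forall>n. St n (S n) \<and> Next n (S n) (S (Suc n))"
  proof (rule dependent_nat_choice)
    show "\<exists>S. St 0 S"
      by (rule exI[of _ "(\<lambda>_. 1 / 2, 0)"]) (auto simp: St_def payoff_def lev_def)
    fix S n assume S: "St n S"
    obtain \<nu> K where S_eq: "S = (\<nu>, K)" by (cases S)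
    have \<nu>: "payoff M d \<nu>" "\<And>u. u \<in> M \<Longrightarrow> \<nu> u \<le> lev n" using S by (auto simp: S_eq St_def)
    interpret run: bandit_run M d \<nu> "\<lambda>x. bern (\<nu> x)" \<pi> by (rule run[OF \<nu>(1)])
    interpret prob_space "run.law (t n)" by (rule run.prob_law)
    note run.law_arm [measurable] A_sets [measurable]
    \<comment> \<open>For a fixed run the counts are bounded by \<open>t n\<close> and vanish
      pointwise as \<open>K\<close> grows, so some tail has expected count below 1/4.\<close>
    have "(\<lambda>K. \<integral>\<^sup>+h. (\<Sum>s<t n. indicator (A K) (fst (h s))) \<partial>run.law (t n)) \<longlonglongrightarrow> (\<integral>\<^sup>+h. 0 \<partial>run.law (t n))"
    proof (rule nn_integral_dominated_convergence[where w="\<lambda>_. of_nat (t n)"])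
      show "AE h in run.law (t n). (\<Sum>s<t n. indicator (A K) (fst (h s))) \<le> (of_nat (t n) :: ennreal)" for K
      proof (rule AE_I2)
        fix h :: "nat \<Rightarrow> 'a \<times> real"
        have "(\<Sum>s<t n. indicator (A K) (fst (h s)) :: ennreal) \<le> (\<Sum>s<t n. 1)"
          by (rule sum_mono) (simp split: split_indicator)
        then show "(\<Sum>s<t n. indicator (A K) (fst (h s))) \<le> (of_nat (t n) :: ennreal)" by simp
      qed
      show "AE h in run.law (t n). (\<lambda>K. \<Sum>s<t n. indicator (A K) (fst (h s)) :: ennreal) \<longlonglongrightarrow> 0"
      proof (rule AE_I2)
        fix h :: "nat \<Rightarrow> 'a \<times> real"
        have "(\<lambda>K. \<Sum>s<t n. indicator (A K) (fst (h s)) :: ennreal) \<longlonglongrightarrow> (\<Sum>s<t n. 0)"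
          by (intro tendsto_sum A_vanish)
        then show "(\<lambda>K. \<Sum>s<t n. indicator (A K) (fst (h s)) :: ennreal) \<longlonglongrightarrow> 0" by simp
      qed
      show "(\<integral>\<^sup>+h. of_nat (t n) \<partial>run.law (t n)) < \<infinity>"
        by (simp add: emeasure_space_1 ennreal_of_nat_eq_real_of_nat)
    qed measurable
    then have "eventually (\<lambda>K. (\<integral>\<^sup>+h. (\<Sum>s<t n. indicator (A K) (fst (h s))) \<partial>run.law (t n)) < ennreal (1 / 4)) sequentially"
      by (intro order_tendstoD) auto
    then obtain K' where K': "K \<le> K'" "(\<integral>\<^sup>+h. (\<Sum>s<t n. indicator (A K') (fst (h s))) \<partial>run.law (t n)) < ennreal (1 / 4)"
      unfolding eventually_sequentially by (meson max.cobounded1 max.cobounded2)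
    show "\<exists>S'. St (Suc n) S' \<and> Next n S S'"
    proof (intro exI conjI)
      let ?S' = "(\<lambda>u. max (\<nu> u) (bump (Suc n) K' u), K')"
      have "\<nu> u \<le> lev (Suc n)" "bump (Suc n) K' u \<le> lev (Suc n)" if "u \<in> M" for u
        unfolding bump_def using \<nu>(2)[OF that] lev(3)[of n] lev(1)[of "Suc n"] nonneg[of "x K'" u] by linarith+
      then show "St (Suc n) ?S'"
        unfolding St_def using payoff_maxI[OF \<nu>(1) bump] by auto
      show "Next n S ?S'"
        using K' by (auto simp: Next_def S_eq)
    qed
  qed
  then obtain S where S: "\<And>n. St n (S n)" "\<And>n. Next n (S n) (S (Suc n))" by blast
  define \<nu> K where "\<nu> = (\<lambda>n. fst (S n))" and "K = (\<lambda>n. snd (S n))"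
  have \<nu>: "payoff M d (\<nu> n)" "u \<in> M \<Longrightarrow> \<nu> n u \<le> lev n"
    and K: "K n \<le> K (Suc n)"
    and \<nu>_Suc: "\<nu> (Suc n) u = max (\<nu> n u) (bump (Suc n) (K (Suc n)) u)"
    and few: "(\<integral>\<^sup>+h. (\<Sum>s<t n. indicator (A (K (Suc n))) (fst (h s))) \<partial>history_law M d (\<lambda>x. bern (\<nu> n x)) \<pi> (t n)) \<le> ennreal (1 / 4)"
    for n u
    using S[of n] by (auto simp: St_def Next_def \<nu>_def K_def)
  have mono: "\<nu> n u \<le> \<nu> (Suc n) u" for n u by (simp add: \<nu>_Suc)
  have "\<exists>\<mu>. payoff M d \<mu> \<and> (\<forall>x\<in>M. (\<lambda>n. \<nu> n x) \<longlonglongrightarrow> \<mu> x \<and> (\<forall>n. \<nu> n x \<le> \<mu> x))"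
    by (rule payoff_limit) (rule \<nu>(1), rule mono)
  then obtain \<mu> where \<mu>: "payoff M d \<mu>" "\<And>u. u \<in> M \<Longrightarrow> (\<lambda>n. \<nu> n u) \<longlonglongrightarrow> \<mu> u" "\<And>n u. u \<in> M \<Longrightarrow> \<nu> n u \<le> \<mu> u"
    by blast
  \<comment> \<open>Bumps added after stage \<open>n\<close> have centres of index at least
    \<open>K (Suc n)\<close>, hence do not rise above 1/2 off that tail.\<close>
  have agree: "\<mu> u = \<nu> n u" if u: "u \<in> M - A (K (Suc n))" for n u
  proof -
    have "\<nu> m u = \<nu> n u" if "m \<ge> n" for m
      using that
    proof (induction m rule: dec_induct)
      case (step m)
      have "K (Suc n) \<le> K (Suc m)"
        by (rule lift_Suc_mono_le[of K, OF K]) (use step in simp)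
      then have "u \<notin> mball (x (K (Suc m))) (e / 4)"
        using u by (auto simp: A_def)
      then have "e / 4 \<le> d (x (K (Suc m))) u" using u x by auto
      then have "bump (Suc m) (K (Suc m)) u \<le> 1 / 2"
        using lev(2)[of "Suc m"] by (auto simp: bump_def)
      also have "\<dots> \<le> \<nu> m u" using \<nu>(1)[of m] u by (auto simp: payoff_def)
      finally show ?case using step by (simp add: \<nu>_Suc)
    qed simp
    then have "eventually (\<lambda>m. \<nu> m u = \<nu> n u) sequentially"
      unfolding eventually_sequentially by blast
    then have "(\<lambda>m. \<nu> m u) \<longlonglongrightarrow> \<nu> n u" by (rule tendsto_eventually)
    then show ?thesis using \<mu>(2)[of u] u LIMSEQ_unique by blast
  qed
  have "e / 32 * sqrt (real (t n)) \<le> regret M d \<mu> (\<lambda>x. bern (\<mu> x)) \<pi> (t n)" for n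
  proof -
    interpret two_payoffs M d "\<nu> n" \<mu> \<pi>
      by (rule two_payoffs.intro[OF Metric_space_axioms ne alg \<nu>(1) \<mu>(1)])
    have "lev (Suc n) \<le> bump (Suc n) (K (Suc n)) (x (K (Suc n)))"
      using x by (simp add: bump_def)
    also have "\<dots> \<le> \<mu> (x (K (Suc n)))"
      using \<mu>(3)[OF x, of "Suc n" "K (Suc n)"] \<nu>_Suc[of n "x (K (Suc n))"] by simp
    also have "\<dots> \<le> run'.best" by (rule run'.\<mu>_le_best[OF x])
    finally have best: "lev (Suc n) \<le> run'.best" .
    have "real (t n) * (lev (Suc n) - lev n) / 4 \<le> regret M d \<mu> (\<lambda>x. bern (\<mu> x)) \<pi> (t n)"
      by (rule run'.regret_ge_of_few_visits[OF A_sets[of "K (Suc n)"] _ lev(3) best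
          visits_le_of_agree_off[OF A_sets agree few]])
         (use agree[of _ n] \<nu>(2)[of _ n] in simp_all)
    moreover have "sqrt (real (t n)) = 4 ^ n"
      using real_sqrt_power[of 16 n] by (simp add: t_def)
    moreover have "real (t n) * (lev (Suc n) - lev n) / 4 = e / 32 * 8 ^ n"
    proof -
      have "(16 :: real) ^ n = 8 ^ n * 2 ^ n" by (simp flip: power_mult_distrib)
      then show ?thesis by (simp add: lev_def t_def field_simps)
    qed
    moreover have "e / 32 * 4 ^ n \<le> e / 32 * 8 ^ n"
      using e by (intro mult_left_mono power_mono) auto
    ultimately show ?thesis by simp
  qed
  moreover have "n \<le> t n" for n
    using less_exp[of n] power_mono[of 2 "16 :: nat" n] by (simp add: t_def)
  ultimately show ?thesis
    using \<mu>(1) e by (intro exI[of _ \<mu>] exI[of _ "e / 32"]) auto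
qed

section \<open>Uncountable completions\<close>

lemma (in two_payoffs) visits_le_of_close:
  assumes A [measurable]: "A \<in> sets (arm_algebra X d)"
    and \<delta>: "\<And>x. x \<in> X \<Longrightarrow> \<bar>\<nu>' x - \<nu> x\<bar> \<le> \<delta>" and small: "t * \<delta>\<^sup>2 \<le> 1 / 192"
    and half: "(\<integral>\<^sup>+h. (\<Sum>s<t. indicator A (fst (h s))) \<partial>run.law t) \<le> ennreal (1 / 2 * t)"
  shows "(\<integral>\<^sup>+h. (\<Sum>s<t. indicator A (fst (h s))) \<partial>run'.law t) \<le> ennreal (3 / 4 * t)"
proof (cases "t = 0")
  case False
  note run.hist_coord [measurable]
  note [measurable_cong] = run.sets_law run'.sets_law
  \<comment> \<open>The fraction of time spent in \<open>A\<close> has values in the unit interval,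
    as \<open>expectation_close\<close> demands; its change by 1/4 turns 1/2 into 3/4.\<close>
  define N where "N = (\<lambda>h :: nat \<Rightarrow> 'a \<times> real. (\<Sum>s<t. indicator A (fst (h s))) / real t)"
  have [measurable]: "N \<in> borel_measurable (run.hist t)" unfolding N_def by measurable
  have V: "(\<Sum>s<t. indicator A (fst (h s)) :: ennreal) = ennreal t * ennreal (N h)" for h :: "nat \<Rightarrow> 'a \<times> real"
  proof -
    have "ennreal t * ennreal (N h) = ennreal (\<Sum>s<t. indicator A (fst (h s)))"
      using False by (simp add: N_def sum_nonneg flip: ennreal_mult)
    also have "\<dots> = (\<Sum>s<t. ennreal (indicator A (fst (h s))))"
      by (rule sum_ennreal[symmetric]) simp
    finally show ?thesis by (simp add: ennreal_indicator)
  qed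
  have N: "0 \<le> N h" "N h \<le> 1" for h
    using False sum_mono[of "{..<t}" "\<lambda>s. indicator A (fst (h s)) :: real" "\<lambda>_. 1"]
    by (auto simp: N_def sum_nonneg indicator_le_1)
  have half': "ennreal t * (\<integral>\<^sup>+h. N h \<partial>run.law t) \<le> ennreal t * ennreal (1 / 2)"
  proof -
    have "ennreal t * (\<integral>\<^sup>+h. N h \<partial>run.law t) = (\<integral>\<^sup>+h. ennreal t * N h \<partial>run.law t)"
      by (rule nn_integral_cmult[symmetric]) measurable
    also have "\<dots> \<le> ennreal (t * (1 / 2))" using half unfolding V by (simp only: mult.commute)
    also have "\<dots> = ennreal t * ennreal (1 / 2)" by (rule ennreal_mult) auto
    finally show ?thesis .
  qed
  have "(\<integral>\<^sup>+h. (\<Sum>s<t. indicator A (fst (h s))) \<partial>run'.law t) = ennreal t * (\<integral>\<^sup>+h. N h \<partial>run'.law t)"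
    unfolding V by (rule nn_integral_cmult) measurable
  also have "\<dots> \<le> ennreal t * ((\<integral>\<^sup>+h. N h \<partial>run.law t) + ennreal (1 / 4))"
    by (intro mult_left_mono expectation_close[OF \<delta> small]) (auto simp: N)
  also have "\<dots> \<le> ennreal t * ennreal (1 / 2) + ennreal t * ennreal (1 / 4)"
    using half' by (simp add: distrib_left)
  also have "\<dots> = ennreal (t * (1 / 2) + t * (1 / 4))"
    using ennreal_mult[of t "1 / 2"] ennreal_mult[of t "1 / 4"] ennreal_plus[of "t * (1 / 2)" "t * (1 / 4)"]
    by (simp only: of_nat_0_le_iff zero_le_divide_1_iff zero_le_numeral mult_nonneg_nonneg simp_thms)
  also have "t * (1 / 2) + t * (1 / 4) = 3 / 4 * real t" by simp
  finally show ?thesis .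
qed simp

lemma (in bandit_run) less_visited:
  assumes [measurable]: "A \<in> sets arms" "B \<in> sets arms" and "A \<inter> B = {}"
  shows "(\<integral>\<^sup>+h. (\<Sum>s<t. indicator A (fst (h s))) \<partial>law t) \<le> ennreal (1 / 2 * t) \<or>
    (\<integral>\<^sup>+h. (\<Sum>s<t. indicator B (fst (h s))) \<partial>law t) \<le> ennreal (1 / 2 * t)"
proof (rule ccontr)
  assume neg: "\<not> ?thesis"
  note law_arm [measurable]
  have "ennreal t = ennreal (1 / 2 * t) + ennreal (1 / 2 * t)"
    by (simp flip: ennreal_plus)
  also have "\<dots> < (\<integral>\<^sup>+h. (\<Sum>s<t. indicator A (fst (h s))) \<partial>law t) + (\<integral>\<^sup>+h. (\<Sum>s<t. indicator B (fst (h s))) \<partial>law t)"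
    using neg by (intro add_strict_mono) auto
  also have "\<dots> = (\<integral>\<^sup>+h. (\<Sum>s<t. indicator A (fst (h s))) + (\<Sum>s<t. indicator B (fst (h s))) \<partial>law t)"
    by (rule nn_integral_add[symmetric]) measurable
  also have "\<dots> \<le> (\<integral>\<^sup>+h. of_nat t \<partial>law t)"
  proof (rule nn_integral_mono)
    fix h :: "nat \<Rightarrow> 'a \<times> real"
    have "(\<Sum>s<t. indicator A (fst (h s)) + indicator B (fst (h s)) :: ennreal) \<le> (\<Sum>s<t. 1)"
      using assms(3) by (intro sum_mono) (auto split: split_indicator)
    then show "(\<Sum>s<t. indicator A (fst (h s))) + (\<Sum>s<t. indicator B (fst (h s))) \<le> (of_nat t :: ennreal)"
      by (simp add: sum.distrib)
  qed
  also have "\<dots> = ennreal t"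
    using prob_space.emeasure_space_1[OF prob_law] by (simp add: ennreal_of_nat_eq_real_of_nat)
  finally show False by simp
qed

context Metric_space
begin

text \<open>Centred in \<open>M\<close> but made of points of the completion: \<open>M\<close>
  itself may be countable, so largeness is measured in the completion, while the algorithm visits
  balls of \<open>M\<close>.\<close>

definition completion_ball :: "'a \<Rightarrow> real \<Rightarrow> (nat \<Rightarrow> 'a) set set" where
  "completion_ball x s = {c \<in> completion_space M d. completion_dist M d (completion_embed M d x) c < s}"

lemma completion_ball_mono: "s \<le> s' \<Longrightarrow> completion_ball x s \<subseteq> completion_ball x s'"
  by (auto simp: completion_ball_def)

lemma completion_approx:
  assumes "c \<in> completion_space M d" "0 < e"
  shows "\<exists>y\<in>M. completion_dist M d (completion_embed M d y) c < e"
proof -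
  interpret C: Metric_space "completion_space M d" "completion_dist M d"
    by (rule Metric_space_completion)
  obtain \<sigma> where "MCauchy \<sigma>" "c = cauchy_rel M d `` {\<sigma>}"
    using assms(1) by (rule completion_spaceE)
  then show ?thesis
    using completion_embed_approx[of \<sigma> e] assms(2) MCauchy_in C.commute by (metis order_refl)
qed

text \<open>A Cantor-Bendixson argument: all but countably many points of the ball have only
  uncountable neighbourhoods. Two of them are separated, and nearby points of \<open>M\<close> serve
  as centres. Radius \<open>r / 2\<close> is asked for because a bump on the ball of radius
  \<open>r\<close> will have its plateau on the ball of half the size.\<close>

lemma uncountable_ball_split:
  assumes B: "countable B" "B \<subseteq> M" "\<And>u e. u \<in> M \<Longrightarrow> 0 < e \<Longrightarrow> \<exists>y\<in>B. d y u < e"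
    and x: "x \<in> M" and unc: "uncountable (completion_ball x s)"
  shows "\<exists>y z r. y \<in> M \<and> z \<in> M \<and> 0 < r \<and> mball y r \<inter> mball z r = {} \<and> mball y r \<subseteq> mball x s \<and> mball z r \<subseteq> mball x s \<and>
    uncountable (completion_ball y (r / 2)) \<and> uncountable (completion_ball z (r / 2))"
proof -
  interpret C: Metric_space "completion_space M d" "completion_dist M d"
    by (rule Metric_space_completion)
  let ?D = "completion_dist M d" and ?e = "completion_embed M d"
  \<comment> \<open>Countable, because only centres in \<open>B\<close> and radii
    \<open>1 / Suc n\<close> occur; yet it contains every point that has a countable
    neighbourhood.\<close>
  define N where "N = (\<Union>y\<in>B. \<Union>n. if countable (completion_ball y (1 / Suc n)) then completion_ball y (1 / Suc n) else {})"
  have "countable N"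
    unfolding N_def by (intro countable_UN B) auto
  then have inf: "infinite (completion_ball x s - N)"
    using unc by (meson countable_finite uncountable_minus_countable)
  then obtain p where p: "p \<in> completion_ball x s - N"
    by (metis finite.emptyI ex_in_conv)
  have "infinite (completion_ball x s - N - {p})" using inf by simp
  then obtain q where q: "q \<in> completion_ball x s - N - {p}"
    by (metis finite.emptyI ex_in_conv)
  \<comment> \<open>With radius \<open>m / 4\<close>, moving \<open>p\<close> and \<open>q\<close>
    by less than \<open>r / 2\<close> to centres \<open>y\<close> and \<open>z\<close> still leaves
    \<open>d y z > 2 * r\<close> and keeps both balls inside the given one.\<close>
  define m where "m = min (?D p q) (min (s - ?D (?e x) p) (s - ?D (?e x) q))"
  have pq: "p \<in> completion_space M d" "q \<in> completion_space M d"
    using p q by (auto simp: completion_ball_def)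
  then have "m > 0"
    using p q C.mdist_pos_less[of p q] by (auto simp: m_def completion_ball_def)
  define r where "r = m / 4"
  have "r > 0" using \<open>m > 0\<close> by (simp add: r_def)
  have near: "\<exists>y\<in>M. ?D (?e y) c < r / 2 \<and> uncountable (completion_ball y (r / 2))"
    if c: "c \<in> completion_space M d" "c \<notin> N" for c
  proof -
    obtain n where n: "1 / real (Suc n) < r / 2"
      using nat_approx_posE[of "r / 2"] \<open>r > 0\<close> by auto
    let ?\<rho> = "1 / real (Suc n)"
    obtain u where u: "u \<in> M" "?D (?e u) c < ?\<rho> / 2"
      using completion_approx[OF c(1), of "?\<rho> / 2"] by auto
    obtain y where y: "y \<in> B" "d y u < ?\<rho> / 2"
      using B(3)[OF u(1), of "?\<rho> / 2"] by auto
    then have yM: "y \<in> M" using B by auto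
    have "?D (?e y) c \<le> d y u + ?D (?e u) c"
      using C.triangle[of "?e y" "?e u" c] yM u c by (simp add: completion_embed_in completion_embed_isometry)
    then have yc: "?D (?e y) c < ?\<rho>" using u y by linarith
    then have "c \<in> completion_ball y ?\<rho>" using c by (simp add: completion_ball_def)
    then have "uncountable (completion_ball y ?\<rho>)"
      using c(2) y(1) unfolding N_def by force
    then have "uncountable (completion_ball y (r / 2))"
      using completion_ball_mono[of ?\<rho> "r / 2" y] n countable_subset by auto
    then show ?thesis using yM yc n by force
  qed
  obtain y where y: "y \<in> M" "?D (?e y) p < r / 2" "uncountable (completion_ball y (r / 2))"
    using near[of p] p pq by auto
  obtain z where z: "z \<in> M" "?D (?e z) q < r / 2" "uncountable (completion_ball z (r / 2))"
    using near[of q] q pq by auto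
  have inside: "mball w r \<subseteq> mball x s"
    if w: "w \<in> M" "?D (?e w) c < r / 2" and c: "c \<in> completion_space M d" "?D (?e x) c + m \<le> s" for w c
  proof
    fix u assume u: "u \<in> mball w r"
    have "d x w \<le> ?D (?e x) c + ?D (?e w) c"
      using C.triangle[of "?e x" c "?e w"] x w c by (simp add: completion_embed_in completion_embed_isometry C.commute[of c])
    then have "d x u < s"
      using triangle[of x w u] u x w c \<open>r > 0\<close> by (auto simp: r_def)
    then show "u \<in> mball x s" using u x by auto
  qed
  have "?D p q \<le> ?D p (?e y) + (d y z + ?D (?e z) q)"
    using C.triangle[of p "?e y" q] C.triangle[of "?e y" "?e z" q] pq y z
    by (simp add: completion_embed_in completion_embed_isometry)
  moreover have "4 * r \<le> ?D p q" by (simp add: r_def m_def)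
  ultimately have dyz: "2 * r < d y z" using y z C.commute[of p "?e y"] \<open>r > 0\<close> by linarith
  have "mball y r \<inter> mball z r = {}"
  proof (rule ccontr)
    assume "mball y r \<inter> mball z r \<noteq> {}"
    then obtain u where "u \<in> mball y r" "u \<in> mball z r" by blast
    then show False using triangle[of y u z] dyz by (auto simp: commute)
  qed
  moreover have "mball y r \<subseteq> mball x s" by (rule inside[OF y(1,2) pq(1)]) (simp add: m_def)
  moreover have "mball z r \<subseteq> mball x s" by (rule inside[OF z(1,2) pq(2)]) (simp add: m_def)
  ultimately show ?thesis using y z \<open>r > 0\<close> by blast
qed

text \<open>Here no region need be almost unvisited; one of two is merely visited at most half the
  time. Hence the bump must be low to stay undetected. The heights of nested bumps at least halve,
  so all later bumps together change the payoff by at most twice the next height and stay undetected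
  as well.\<close>

lemma hard_payoff_if_uncountable_ball:
  assumes B: "countable B" "B \<subseteq> M" "\<And>u e. u \<in> M \<Longrightarrow> 0 < e \<Longrightarrow> \<exists>y\<in>B. d y u < e"
    and x\<^sub>0: "x\<^sub>0 \<in> M" "0 < s\<^sub>0" "uncountable (completion_ball x\<^sub>0 s\<^sub>0)"
    and alg: "bandit_algorithm M d \<pi>"
  shows "\<exists>\<mu> c. payoff M d \<mu> \<and> 0 < c \<and>
      (\<forall>n. \<exists>t\<ge>n. c * sqrt (real t) \<le> regret M d \<mu> (\<lambda>x. bern (\<mu> x)) \<pi> t)"
proof -
  have ne: "M \<noteq> {}" using x\<^sub>0 by auto
  define visits :: "('a \<Rightarrow> real) \<Rightarrow> nat \<Rightarrow> 'a set \<Rightarrow> ennreal" where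
    "visits = (\<lambda>\<nu> t A. \<integral>\<^sup>+h. (\<Sum>s<t. indicator A (fst (h s))) \<partial>history_law M d (\<lambda>x. bern (\<nu> x)) \<pi> t)"
  \<comment> \<open>The payoff is maximal and constant on \<open>mball x s\<close>, so a bump inside
    raises the optimum. The budget \<open>b\<close> bounds the total height of all later bumps, and
    the Lipschitz constant \<open>1 - (1 / 2) ^ n\<close> leaves slope for them.\<close>
  define St where "St = (\<lambda>(n :: nat) (\<nu> :: 'a \<Rightarrow> real, x, s, b :: real).
     x \<in> M \<and> 0 < s \<and> 0 < b \<and> uncountable (completion_ball x s) \<and> (\<forall>u\<in>mball x s. \<nu> x \<le> \<nu> u) \<and>
     (\<forall>u\<in>M. 1 / 2 \<le> \<nu> u \<and> \<nu> u \<le> \<nu> x) \<and> \<nu> x + b \<le> 3 / 4 \<and>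
     (\<forall>u\<in>M. \<forall>v\<in>M. \<bar>\<nu> u - \<nu> v\<bar> \<le> (1 - (1 / 2) ^ n) * d u v))"
  define Next where "Next = (\<lambda>(n :: nat) (\<nu> :: 'a \<Rightarrow> real, x, s, b :: real) (\<nu>' :: 'a \<Rightarrow> real, x', s', b' :: real).
     2 * b' \<le> b \<and> \<nu>' x' = \<nu> x + b' \<and> mball x' (2 * s') \<subseteq> mball x s \<and>
     (\<forall>u\<in>M. \<nu> u \<le> \<nu>' u) \<and> (\<forall>u\<in>M - mball x' (2 * s'). \<nu>' u = \<nu> u) \<and>
     (\<exists>t::nat. n < t \<and> b' = 1 / (32 * sqrt t) \<and> visits \<nu> t (mball x' (2 * s')) \<le> ennreal (1 / 2 * t)))"
  have St_payoff: "payoff M d \<nu>" if "St n (\<nu>, x, s, b)" for n \<nu> x s b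
    unfolding payoff_def
  proof (intro conjI ballI)
    fix u v assume uv: "u \<in> M" "v \<in> M"
    have "\<bar>\<nu> u - \<nu> v\<bar> \<le> (1 - (1 / 2) ^ n) * d u v" using that uv by (auto simp: St_def)
    also have "\<dots> \<le> 1 * d u v" by (rule mult_right_mono) auto
    finally show "\<bar>\<nu> u - \<nu> v\<bar> \<le> d u v" by simp
  next
    fix u assume "u \<in> M"
    then have "1 / 2 \<le> \<nu> u" "\<nu> u \<le> \<nu> x" "0 < b" "\<nu> x + b \<le> 3 / 4" using that by (auto simp: St_def)
    then show "1 / 2 \<le> \<nu> u" "\<nu> u \<le> 3 / 4" by linarith+
  qed
  have "\<exists>S. \<forall>n. St n (S n) \<and> Next n (S n) (S (Suc n))"
  proof (rule dependent_nat_choice)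
    show "\<exists>S. St 0 S"
      by (rule exI[of _ "(\<lambda>_. 1 / 2, x\<^sub>0, s\<^sub>0, 1 / 4)"]) (use x\<^sub>0 in \<open>auto simp: St_def\<close>)
    fix S n assume S: "St n S"
    obtain \<nu> x s b where S_eq: "S = (\<nu>, x, s, b)" by (cases S)
    have St: "x \<in> M" "0 < s" "0 < b" "uncountable (completion_ball x s)" "\<And>u. u \<in> mball x s \<Longrightarrow> \<nu> x \<le> \<nu> u"
     "\<And>u. u \<in> M \<Longrightarrow> 1 / 2 \<le> \<nu> u" "\<And>u. u \<in> M \<Longrightarrow> \<nu> u \<le> \<nu> x" "\<nu> x + b \<le> 3 / 4"
     "\<And>u v. u \<in> M \<Longrightarrow> v \<in> M \<Longrightarrow> \<bar>\<nu> u - \<nu> v\<bar> \<le> (1 - (1 / 2) ^ n) * d u v"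
      using S by (auto simp: S_eq St_def)
    interpret run: bandit_run M d \<nu> "\<lambda>x. bern (\<nu> x)" \<pi>
      using payoff_run[OF Metric_space_axioms ne alg] St_payoff S S_eq by blast
    obtain y z r where yz: "y \<in> M" "z \<in> M" "0 < r" "mball y r \<inter> mball z r = {}" "mball y r \<subseteq> mball x s" "mball z r \<subseteq> mball x s"
      "uncountable (completion_ball y (r / 2))" "uncountable (completion_ball z (r / 2))"
      using uncountable_ball_split[OF B St(1,4)] by blast
    define c where "c = ((1 / 2) ^ Suc n :: real)"
    have "c > 0" by (simp add: c_def)
    \<comment> \<open>The bump may use at most half of the budget and, at slope \<open>c\<close>,
      must reach its height over a distance of \<open>r / 2\<close>.\<close>
    define \<eta> where "\<eta> = min (b / 2) (c * (r / 2))"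
    have "\<eta> > 0" using St yz \<open>c > 0\<close> by (simp add: \<eta>_def)
    obtain m :: nat where m: "1 / \<eta> < m" using reals_Archimedean2 by blast
    \<comment> \<open>A square, so that \<open>sqrt t\<close> is explicit; \<open>m\<close> makes
      \<open>1 / (32 * sqrt t)\<close> at most \<open>\<eta>\<close>, and \<open>n\<close> makes the
      times unbounded.\<close>
    define t where "t = (m + n + 1)\<^sup>2"
    define \<epsilon> where "\<epsilon> = 1 / (32 * sqrt t)"
    have sqrt_t: "sqrt t = m + n + 1" by (simp add: t_def)
    have "1 \<le> \<eta> * m" using m \<open>\<eta> > 0\<close> by (simp add: field_simps)
    also have "\<dots> \<le> \<eta> * (32 * sqrt t)" using \<open>\<eta> > 0\<close> unfolding sqrt_t by (intro mult_left_mono) auto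
    finally have "\<epsilon> \<le> \<eta>" unfolding \<epsilon>_def sqrt_t by (subst pos_divide_le_eq) auto
    then have \<epsilon>: "0 < \<epsilon>" "2 * \<epsilon> \<le> b" "\<epsilon> \<le> c * (r / 2)" by (auto simp: \<epsilon>_def sqrt_t \<eta>_def)
    have "n < t" unfolding t_def by (simp add: power2_eq_square)
    have "\<exists>w. w \<in> M \<and> mball w r \<subseteq> mball x s \<and> uncountable (completion_ball w (r / 2)) \<and>
        visits \<nu> t (mball w r) \<le> ennreal (1 / 2 * t)"
      using run.less_visited[OF mball_arm_algebra mball_arm_algebra yz(4), of t] yz unfolding visits_def by blast
    then obtain w where w: "w \<in> M" "mball w r \<subseteq> mball x s" "uncountable (completion_ball w (r / 2))"
        "visits \<nu> t (mball w r) \<le> ennreal (1 / 2 * t)" by blast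
    have flat: "\<nu> u = \<nu> x" if "u \<in> mball w r" for u
    proof (rule antisym)
      show "\<nu> u \<le> \<nu> x" using that by (intro St(7)) (simp add: in_mball)
      show "\<nu> x \<le> \<nu> u" using that w(2) by (intro St(5)) blast
    qed
    have \<nu>w: "\<nu> w = \<nu> x" by (rule flat) (simp add: w yz)
    \<comment> \<open>A truncated cone of slope \<open>c\<close> with its plateau on the ball of
      radius \<open>r / 2\<close>, placed where \<open>\<nu>\<close> is constant.\<close>
    define \<beta> where "\<beta> = (\<lambda>u. max 0 (min \<epsilon> (c * (r - d w u))))"
    have \<beta>_lip: "\<bar>\<beta> u - \<beta> v\<bar> \<le> c * d u v" if "u \<in> M" "v \<in> M" for u v
    proof -
      have "\<bar>\<beta> u - \<beta> v\<bar> \<le> \<bar>c * (r - d w u) - c * (r - d w v)\<bar>" unfolding \<beta>_def by linarith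
      also have "\<dots> = c * \<bar>d w u - d w v\<bar>"
        using \<open>c > 0\<close> by (simp add: abs_minus_commute flip: right_diff_distrib add: abs_mult)
      also have "\<dots> \<le> c * d u v"
        using dist_diff_le[of w u w v] w that \<open>c > 0\<close> by simp
      finally show ?thesis .
    qed
    have \<beta>_range: "0 \<le> \<beta> u" "\<beta> u \<le> \<epsilon>" for u using \<epsilon> by (auto simp: \<beta>_def)
    have \<beta>_top: "\<beta> u = \<epsilon>" if "u \<in> mball w (r / 2)" for u
    proof -
      have "c * (r / 2) \<le> c * (r - d w u)" using that \<open>c > 0\<close> by (intro mult_left_mono) auto
      then show ?thesis using \<epsilon> by (simp add: \<beta>_def)
    qed
    have \<beta>_off: "\<beta> u = 0" if "u \<in> M - mball w r" for u
    proof -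
      have "c * (r - d w u) \<le> 0" using that w \<open>c > 0\<close> by (intro mult_nonneg_nonpos) auto
      then show ?thesis using \<epsilon> by (simp add: \<beta>_def)
    qed
    have \<beta>w: "\<beta> w = \<epsilon>" using w yz by (intro \<beta>_top) auto
    show "\<exists>S'. St (Suc n) S' \<and> Next n S S'"
    proof (intro exI conjI)
      let ?S' = "(\<lambda>u. \<nu> u + \<beta> u, w, r / 2, \<epsilon>)"
      have "\<bar>\<nu> u + \<beta> u - (\<nu> v + \<beta> v)\<bar> \<le> (1 - (1 / 2) ^ Suc n) * d u v" if "u \<in> M" "v \<in> M" for u v
      proof -
        have "\<bar>\<nu> u + \<beta> u - (\<nu> v + \<beta> v)\<bar> \<le> (1 - (1 / 2) ^ n) * d u v + c * d u v"
          using St(9)[OF that] \<beta>_lip[OF that] by linarith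
        then show ?thesis by (simp add: c_def algebra_simps)
      qed
      moreover have "\<nu> w + \<beta> w \<le> \<nu> u + \<beta> u" if "u \<in> mball w (r / 2)" for u
      proof -
        have "u \<in> mball w r" using that yz by auto
        then have "\<nu> u = \<nu> x" by (rule flat)
        then show ?thesis using \<beta>_top[OF that] by (simp add: \<beta>w \<nu>w)
      qed
      moreover have "1 / 2 \<le> \<nu> u + \<beta> u" "\<nu> u + \<beta> u \<le> \<nu> w + \<beta> w" if "u \<in> M" for u
        using St(6,7)[OF that] \<beta>_range[of u] by (auto simp: \<beta>w \<nu>w)
      ultimately show "St (Suc n) ?S'"
        unfolding St_def using w yz \<epsilon> St(8) by (auto simp: \<nu>w \<beta>w)
      show "Next n S ?S'"
        unfolding Next_def S_eq using \<epsilon> w \<beta>_range \<beta>_off \<open>n < t\<close>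
        by (auto simp: \<nu>w \<beta>w \<epsilon>_def)
    qed
  qed
  then obtain S where S: "\<And>n. St n (S n)" "\<And>n. Next n (S n) (S (Suc n))" by blast
  define \<nu> x s b where "\<nu> = (\<lambda>n. fst (S n))" and "x = (\<lambda>n. fst (snd (S n)))"
    and "s = (\<lambda>n. fst (snd (snd (S n))))" and "b = (\<lambda>n. snd (snd (snd (S n))))"
  have S_eq: "S n = (\<nu> n, x n, s n, b n)" for n
    by (simp add: \<nu>_def x_def s_def b_def)
  define A where "A = (\<lambda>n. mball (x (Suc n)) (2 * s (Suc n)))"
  have payoff: "payoff M d (\<nu> n)" for n
    using S(1)[of n] St_payoff by (simp add: S_eq)
  have x: "x n \<in> M" and s: "0 < s n" and flat: "u \<in> mball (x n) (s n) \<Longrightarrow> \<nu> n (x n) \<le> \<nu> n u"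
    and top: "u \<in> M \<Longrightarrow> \<nu> n u \<le> \<nu> n (x n)" and b_pos: "0 < b n" for n u
    using S(1)[of n] by (auto simp: S_eq St_def)
  have "\<forall>n. \<exists>t::nat. n < t \<and> b (Suc n) = 1 / (32 * sqrt t) \<and> visits (\<nu> n) t (A n) \<le> ennreal (1 / 2 * t)"
    using S(2) by (simp add: S_eq Next_def A_def)
  then obtain t :: "nat \<Rightarrow> nat" where t: "\<And>n. n < t n" "\<And>n. b (Suc n) = 1 / (32 * sqrt (t n))"
      "\<And>n. visits (\<nu> n) (t n) (A n) \<le> ennreal (1 / 2 * t n)"
    by metis
  have b_le: "2 * b (Suc n) \<le> b n" and step: "\<nu> (Suc n) (x (Suc n)) = \<nu> n (x n) + b (Suc n)"
    and nest: "A n \<subseteq> mball (x n) (s n)" and mono: "u \<in> M \<Longrightarrow> \<nu> n u \<le> \<nu> (Suc n) u"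
    and off: "u \<in> M - A n \<Longrightarrow> \<nu> (Suc n) u = \<nu> n u" for n u
    using S(2)[of n] by (auto simp: S_eq Next_def A_def)
  have "A (Suc n) \<subseteq> A n" for n
    using nest[of "Suc n"] s[of "Suc n"] by (force simp: A_def)
  then have A_mono: "A m \<subseteq> A n" if "n \<le> m" for m n
    by (rule lift_Suc_antimono_le[of A, OF _ that])
  \<comment> \<open>The height rises by \<open>b (Suc n)\<close> and the budget drops from
    \<open>b n\<close> to \<open>b (Suc n)\<close>, while twice \<open>b (Suc n)\<close> is at most
    \<open>b n\<close>.\<close>
  have level: "\<nu> m (x m) + b m \<le> \<nu> n (x n) + b n" if "n \<le> m" for m n
    by (rule lift_Suc_antimono_le[of "\<lambda>n. \<nu> n (x n) + b n", OF _ that]) (use b_le step in \<open>simp add: add.assoc\<close>)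
  have "\<exists>\<mu>. payoff M d \<mu> \<and> (\<forall>x\<in>M. (\<lambda>n. \<nu> n x) \<longlonglongrightarrow> \<mu> x \<and> (\<forall>n. \<nu> n x \<le> \<mu> x))"
    by (rule payoff_limit) (rule payoff, rule mono)
  then obtain \<mu> where \<mu>: "payoff M d \<mu>" "\<And>u. u \<in> M \<Longrightarrow> (\<lambda>n. \<nu> n u) \<longlonglongrightarrow> \<mu> u" "\<And>n u. u \<in> M \<Longrightarrow> \<nu> n u \<le> \<mu> u"
    by blast
  have agree: "\<mu> u = \<nu> n u" if u: "u \<in> M - A n" for n u
  proof -
    have "\<nu> m u = \<nu> n u" if "m \<ge> n" for m
      using that
    proof (induction m rule: dec_induct)
      case (step m)
      then show ?case using off[of u m] A_mono[of n m] u by auto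
    qed simp
    then have "eventually (\<lambda>m. \<nu> m u = \<nu> n u) sequentially"
      unfolding eventually_sequentially by blast
    then have "(\<lambda>m. \<nu> m u) \<longlonglongrightarrow> \<nu> n u" by (rule tendsto_eventually)
    then show ?thesis using \<mu>(2)[of u] u LIMSEQ_unique by blast
  qed
  \<comment> \<open>Off \<open>A n\<close> nothing changes any more. On \<open>A n\<close> the
    payoff \<open>\<nu> n\<close> is at its maximum, above which the next bump and the budget left
    after it allow a rise of \<open>b (Suc n)\<close> each.\<close>
  have close: "\<bar>\<mu> u - \<nu> n u\<bar> \<le> 2 * b (Suc n)" if u: "u \<in> M" for n u
  proof (cases "u \<in> A n")
    case True
    then have eq: "\<nu> n u = \<nu> n (x n)" using flat nest top[OF u, of n] by (meson antisym subsetD)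
    have "\<nu> m u \<le> \<nu> n (x n) + 2 * b (Suc n)" if "m \<ge> Suc n" for m
      using top[OF u, of m] level[OF that] step[of n] b_pos[of m] by linarith
    then have "\<mu> u \<le> \<nu> n (x n) + 2 * b (Suc n)"
      by (intro LIMSEQ_le_const2[OF \<mu>(2)[OF u]]) blast
    then show ?thesis using eq \<mu>(3)[OF u, of n] by auto
  next
    case False
    then show ?thesis using agree[of u n] u b_pos[of "Suc n"] by simp
  qed
  have "1 / 128 * sqrt (real (t n)) \<le> regret M d \<mu> (\<lambda>x. bern (\<mu> x)) \<pi> (t n)" for n
  proof -
    interpret two_payoffs M d "\<nu> n" \<mu> \<pi>
      by (rule two_payoffs.intro[OF Metric_space_axioms ne alg payoff \<mu>(1)])
    have A_sets: "A n \<in> sets (arm_algebra M d)" unfolding A_def by (rule mball_arm_algebra)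
    have tpos: "t n > 0" using t(1)[of n] by simp
    have best: "\<nu> n (x n) + b (Suc n) \<le> run'.best"
      using run'.\<mu>_le_best[OF x[of "Suc n"]] \<mu>(3)[OF x, of "Suc n" "Suc n"] step[of n] by linarith
    \<comment> \<open>The reason for the constant 32: the left-hand side equals 4/1024 =
      1/256.\<close>
    have "real (t n) * (2 * b (Suc n))\<^sup>2 \<le> 1 / 192"
      using tpos by (simp add: t(2) power_mult_distrib power_divide)
    then have visits': "(\<integral>\<^sup>+h. (\<Sum>s<t n. indicator (A n) (fst (h s))) \<partial>run'.law (t n)) \<le> ennreal (3 / 4 * t n)"
      using t(3)[of n] by (intro visits_le_of_close[OF A_sets close]) (auto simp: visits_def)
    have "real (t n) * (\<nu> n (x n) + b (Suc n) - \<nu> n (x n)) / 4 \<le> regret M d \<mu> (\<lambda>x. bern (\<mu> x)) \<pi> (t n)"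
      by (rule run'.regret_ge_of_few_visits[OF A_sets _ _ best visits'])
         (use agree[of _ n] top[of _ n] b_pos[of "Suc n"] in simp_all)
    moreover have "real (t n) = sqrt (t n) * sqrt (t n)" by simp
    then have "real (t n) * (\<nu> n (x n) + b (Suc n) - \<nu> n (x n)) / 4 = 1 / 128 * sqrt (real (t n))"
      using tpos by (simp add: t(2) field_simps)
    ultimately show ?thesis by simp
  qed
  moreover have "n \<le> t n" for n using t(1)[of n] by simp
  ultimately show ?thesis
    using \<mu>(1) by (intro exI[of _ \<mu>] exI[of _ "1 / 128"]) auto
qed

end

section \<open>Compactness and size of the completion; the combined lower bound\<close>

context Metric_space
begin

text \<open>The completion is complete, so compactness means total boundedness, and finite nets
  transfer both ways by the density of \<open>M\<close> at the price of doubling the radius.\<close>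

lemma compact_completion_iff:
  "compact_space (Metric_space.mtopology (completion_space M d) (completion_dist M d)) \<longleftrightarrow> mtotally_bounded M"
proof -
  interpret C: Metric_space "completion_space M d" "completion_dist M d"
    by (rule Metric_space_completion)
  let ?D = "completion_dist M d" and ?e = "completion_embed M d"
  have "C.mtotally_bounded (completion_space M d) \<longleftrightarrow> mtotally_bounded M"
  proof
    assume tb: "mtotally_bounded M"
    show "C.mtotally_bounded (completion_space M d)"
      unfolding C.mtotally_bounded_def
    proof (intro allI impI)
      fix e :: real assume "e > 0"
      then obtain F where F: "finite F" "F \<subseteq> M" "M \<subseteq> (\<Union>x\<in>F. mball x (e / 2))"
        using tb unfolding mtotally_bounded_def by (meson half_gt_zero)
      have "completion_space M d \<subseteq> (\<Union>c\<in>?e ` F. C.mball c e)"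
      proof
        fix c assume c: "c \<in> completion_space M d"
        obtain y where y: "y \<in> M" "?D (?e y) c < e / 2"
          using completion_approx[OF c, of "e / 2"] \<open>e > 0\<close> by auto
        obtain x where x: "x \<in> F" "y \<in> mball x (e / 2)" using F y by blast
        then have "?D (?e x) c < e"
          using C.triangle[of "?e x" "?e y" c] y c F by (auto simp: completion_embed_in completion_embed_isometry)
        then show "c \<in> (\<Union>c\<in>?e ` F. C.mball c e)"
          using x c F completion_embed_in[of x] by (intro UN_I[of "?e x"]) auto
      qed
      then show "\<exists>K. finite K \<and> K \<subseteq> completion_space M d \<and> completion_space M d \<subseteq> (\<Union>x\<in>K. C.mball x e)"
        using F by (intro exI[of _ "?e ` F"]) (auto simp: completion_embed_in)
    qed
  next
    assume tb: "C.mtotally_bounded (completion_space M d)"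
    show "mtotally_bounded M"
      unfolding mtotally_bounded_def
    proof (intro allI impI)
      fix e :: real assume "e > 0"
      then obtain G where G: "finite G" "G \<subseteq> completion_space M d" "completion_space M d \<subseteq> (\<Union>x\<in>G. C.mball x (e / 2))"
        using tb unfolding C.mtotally_bounded_def by (meson half_gt_zero)
      have "\<forall>c\<in>G. \<exists>y\<in>M. ?D (?e y) c < e / 2"
        using completion_approx G \<open>e > 0\<close> half_gt_zero by blast
      then obtain y where y: "\<And>c. c \<in> G \<Longrightarrow> y c \<in> M \<and> ?D (?e (y c)) c < e / 2" by metis
      have "M \<subseteq> (\<Union>x\<in>y ` G. mball x e)"
      proof
        fix u assume u: "u \<in> M"
        then obtain c where c: "c \<in> G" "?e u \<in> C.mball c (e / 2)"
          using G(3) completion_embed_in[OF u] by blast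
        then have "d (y c) u < e"
          using C.triangle[of "?e (y c)" c "?e u"] y[of c] u G
          by (auto simp: completion_embed_in completion_embed_isometry)
        then show "u \<in> (\<Union>x\<in>y ` G. mball x e)" using c y[of c] u by (intro UN_I[of "y c"]) auto
      qed
      then show "\<exists>K. finite K \<and> K \<subseteq> M \<and> M \<subseteq> (\<Union>x\<in>K. mball x e)"
        using G(1) y by (intro exI[of _ "y ` G"] conjI finite_imageI image_subsetI) blast+
    qed
  qed
  then show ?thesis
    using C.compact_space_eq_mcomplete_mtotally_bounded mcomplete_completion by blast
qed

text \<open>Greedy choice: finitely many balls of radius \<open>e\<close> never cover
  \<open>M\<close>. The cap at 1 keeps the bumps built on the sequence below 3/4.\<close>

lemma separated_sequence_if_not_mtotally_bounded:
  assumes "\<not> mtotally_bounded M"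
  shows "\<exists>(x :: nat \<Rightarrow> 'a) e. (\<forall>k. x k \<in> M) \<and> 0 < e \<and> e \<le> 1 \<and> (\<forall>j k. j \<noteq> k \<longrightarrow> e \<le> d (x j) (x k))"
proof -
  obtain e where "e > 0" "\<not> (\<exists>F. finite F \<and> F \<subseteq> M \<and> M \<subseteq> (\<Union>x\<in>F. mball x e))"
    using assms unfolding mtotally_bounded_def by meson
  then have e: "e > 0" "\<And>F. finite F \<Longrightarrow> F \<subseteq> M \<Longrightarrow> \<not> M \<subseteq> (\<Union>x\<in>F. mball x e)" by simp_all
  have "\<exists>x :: nat \<Rightarrow> 'a. \<forall>n. x n \<in> M \<and> (\<forall>j<n. e \<le> d (x j) (x n))"
  proof (rule dependent_wellorder_choice)
    fix n and x :: "nat \<Rightarrow> 'a" assume "\<And>y. y < n \<Longrightarrow> x y \<in> M \<and> (\<forall>j<y. e \<le> d (x j) (x y))"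
    then have "x ` {..<n} \<subseteq> M" by auto
    then have "\<not> M \<subseteq> (\<Union>u\<in>x ` {..<n}. mball u e)" by (intro e) auto
    then show "\<exists>r. r \<in> M \<and> (\<forall>j<n. e \<le> d (x j) r)"
      using \<open>x ` {..<n} \<subseteq> M\<close> by (force simp: not_less)
  qed auto
  then obtain x :: "nat \<Rightarrow> 'a" where x: "\<And>n. x n \<in> M" "\<And>j n. j < n \<Longrightarrow> e \<le> d (x j) (x n)" by blast
  have "min e 1 \<le> d (x j) (x k)" if "j \<noteq> k" for j k
    using x(2)[of j k] x(2)[of k j] that commute[of "x j" "x k"] by (cases "j < k") auto
  then show ?thesis
    using x(1) e(1) by (intro exI[of _ x] exI[of _ "min e 1"]) auto
qed

lemma countable_dense_if_mtotally_bounded: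
  assumes "mtotally_bounded M"
  shows "\<exists>B. countable B \<and> B \<subseteq> M \<and> (\<forall>u\<in>M. \<forall>e>0. \<exists>y\<in>B. d y u < e)"
proof -
  have "\<forall>n. \<exists>F. finite F \<and> F \<subseteq> M \<and> M \<subseteq> (\<Union>x\<in>F. mball x (1 / Suc n))"
    using assms unfolding mtotally_bounded_def by simp
  then obtain F where F: "\<And>n :: nat. finite (F n) \<and> F n \<subseteq> M \<and> M \<subseteq> (\<Union>x\<in>F n. mball x (1 / Suc n))"
    by metis
  have "\<exists>y\<in>\<Union>n. F n. d y u < e" if u: "u \<in> M" and "e > 0" for u e
  proof -
    obtain n where n: "1 / real (Suc n) < e" using \<open>e > 0\<close> by (rule nat_approx_posE)
    obtain y where "y \<in> F n" "d y u < 1 / Suc n" using F[of n] u by auto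
    then show ?thesis using n by (intro bexI[of _ y]) auto
  qed
  then show ?thesis
    using F by (intro exI[of _ "\<Union>n. F n"] conjI countable_UN) (auto intro: countable_finite)
qed

lemma uncountable_completion_ball:
  assumes "uncountable (completion_space M d)"
  shows "\<exists>x s. x \<in> M \<and> 0 < s \<and> uncountable (completion_ball x s)"
proof -
  have "completion_space M d \<noteq> {}" using assms by auto
  then obtain x where x: "x \<in> M"
    using completion_approx[of _ 1] by (metis ex_in_conv zero_less_one)
  have "completion_space M d \<subseteq> (\<Union>n. completion_ball x (real n))"
    using reals_Archimedean2 by (auto simp: completion_ball_def)
  then have "uncountable (\<Union>n. completion_ball x (real n))"
    using assms countable_subset by blast
  then obtain n where "uncountable (completion_ball x (real n))" by blast
  then have "uncountable (completion_ball x (real (Suc n)))"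
    using completion_ball_mono[of n "Suc n" x] countable_subset by auto
  then show ?thesis using x by (intro exI[of _ x] exI[of _ "real (Suc n)"]) auto
qed

end

lemma not_tractable_little_o_sqrt:
  assumes "Metric_space X d" "X \<noteq> {}"
    and "\<not> (compact_space (Metric_space.mtopology (completion_space X d) (completion_dist X d)) \<and>
           countable (completion_space X d))"
    and "little_o_sqrt g"
  shows "\<not> tractable X d g"
proof (rule not_tractable_if_hard_payoffs[OF assms(1,2) _ assms(4)])
  fix \<pi> assume \<pi>: "bandit_algorithm X d \<pi>"
  interpret Metric_space X d by (rule assms)
  show "\<exists>\<mu> c. payoff X d \<mu> \<and> 0 < c \<and>
      (\<forall>n. \<exists>t\<ge>n. c * sqrt (real t) \<le> regret X d \<mu> (\<lambda>x. bern (\<mu> x)) \<pi> t)"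
  proof (cases "mtotally_bounded X")
    case True
    then have "uncountable (completion_space X d)"
      using assms(3) compact_completion_iff by blast
    then obtain x s where "x \<in> X" "0 < s" "uncountable (completion_ball x s)"
      using uncountable_completion_ball by blast
    moreover obtain B where "countable B" "B \<subseteq> X" "\<forall>u\<in>X. \<forall>e>0. \<exists>y\<in>B. d y u < e"
      using countable_dense_if_mtotally_bounded[OF True] by blast
    ultimately show ?thesis
      by (intro hard_payoff_if_uncountable_ball[of B x s] \<pi>) auto
  next
    case False
    then obtain x :: "nat \<Rightarrow> 'a" and e where "\<And>k. x k \<in> X" "0 < e" "e \<le> 1" "\<And>j k. j \<noteq> k \<Longrightarrow> e \<le> d (x j) (x k)"
      using separated_sequence_if_not_mtotally_bounded by blast
    then show ?thesis
      by (intro hard_payoff_if_separated_sequence[of x e] \<pi>)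
  qed
qed

section \<open>Selecting an optimal point\<close>

text \<open>Without isolated points all singletons would be closed with empty interior in the
  completely metrizable subspace \<open>C\<close>, and by Baire so would their countable union
  \<open>C\<close> have empty interior in itself.\<close>

lemma isolated_point_if_countable:
  assumes T: "completely_metrizable_space T" and C: "closedin T C" "C \<noteq> {}" "countable C"
  shows "\<exists>x\<in>C. \<exists>U. openin T U \<and> U \<inter> C = {x}"
proof (rule ccontr)
  assume neg: "\<not> ?thesis"
  let ?S = "subtopology T C"
  have top: "topspace ?S = C"
    using closedin_subset[OF C(1)] by (auto simp: topspace_subtopology)
  have S: "completely_metrizable_space ?S"
    by (rule completely_metrizable_space_closedin[OF T C(1)])
  have "?S interior_of (\<Union>x\<in>C. {x}) = {}"
  proof (rule Baire_category_alt)
    fix A assume "A \<in> (\<lambda>x. {x}) ` C"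
    then obtain x where x: "x \<in> C" "A = {x}" by auto
    have "t1_space ?S"
      using S completely_metrizable_imp_metrizable_space metrizable_imp_t1_space by blast
    then have "closedin ?S A"
      using x top closedin_t1_singleton by metis
    moreover have "?S interior_of A = {}"
    proof (rule ccontr)
      assume "?S interior_of A \<noteq> {}"
      then have "?S interior_of A = {x}" using interior_of_subset[of ?S A] x by blast
      then have "openin ?S {x}" by (metis openin_interior_of)
      then obtain U where "openin T U" "U \<inter> C = {x}" by (auto simp: openin_subtopology)
      then show False using neg x by blast
    qed
    ultimately show "closedin ?S A \<and> ?S interior_of A = {}" ..
  qed (use S C in auto)
  then show False
    using interior_of_topspace[of ?S] top C(2) by simp
qed

text \<open>Transfinitely removing isolated points gives a chain of open sets in which each member
  but the last has an immediate successor with one more point. The selected point of a closed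
  set \<open>F\<close> is the one whose addition first covers \<open>F\<close>; it does not change if \<open>F\<close> is
  enlarged within the open set reached at that stage.\<close>

lemma stable_selector_exists:
  fixes T :: "'a topology"
  assumes compact: "compact_space T"
    and scattered: "\<And>C. closedin T C \<Longrightarrow> C \<noteq> {} \<Longrightarrow> \<exists>x\<in>C. \<exists>U. openin T U \<and> U \<inter> C = {x}"
  shows "\<exists>\<sigma>. \<forall>S. closedin T S \<longrightarrow> S \<noteq> {} \<longrightarrow> \<sigma> S \<in> S \<and>
    (\<exists>V. openin T V \<and> S \<subseteq> V \<and> (\<forall>F. closedin T F \<longrightarrow> S \<subseteq> F \<longrightarrow> F \<subseteq> V \<longrightarrow> \<sigma> F = \<sigma> S))"
proof -
  define nxt where "nxt = (\<lambda>U. SOME x. x \<in> topspace T - U \<and> openin T (insert x U))"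
  have nxt: "nxt U \<in> topspace T - U" "openin T (insert (nxt U) U)"
    if U: "openin T U" "U \<noteq> topspace T" for U
  proof -
    have "topspace T - U \<noteq> {}" using U openin_subset by blast
    then obtain x W where x: "x \<in> topspace T - U" "openin T W" "W \<inter> (topspace T - U) = {x}"
      using scattered[of "topspace T - U"] U(1) by blast
    have "insert x U = U \<union> W" using x openin_subset[OF x(2)] by blast
    then have "openin T (insert x U)" using x(2) U(1) by auto
    then have "\<exists>x. x \<in> topspace T - U \<and> openin T (insert x U)" using x(1) by blast
    from someI_ex[OF this] show "nxt U \<in> topspace T - U" "openin T (insert (nxt U) U)"
      unfolding nxt_def by auto
  qed
  define suc where "suc = (\<lambda>U. if openin T U \<and> U \<noteq> topspace T then insert (nxt U) U else U)"
  have suc_open: "openin T (suc U)" if "openin T U" for U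
    using that nxt(2)[of U] by (auto simp: suc_def)
  \<comment> \<open>Transfinite iteration of \<open>suc\<close> without ordinals: the iterates above
    the empty set form a chain of open sets closed under \<open>suc\<close> and unions.\<close>
  interpret bw: bourbaki_witt_fixpoint Union "{(A, B :: 'a set). A \<subseteq> B}" suc
  proof
    show "Partial_order {(A, B :: 'a set). A \<subseteq> B}"
      by (auto simp: partial_order_on_def preorder_on_def refl_on_def trans_def antisym_def Field_def)
  qed (auto simp: suc_def Field_def)
  define \<T> where "\<T> = bw.iterates_above {}"
  have base: "{} \<in> \<T>" and suc_in: "U \<in> \<T> \<Longrightarrow> suc U \<in> \<T>" for U
    unfolding \<T>_def by (auto intro: bw.iterates_above.intros)
  have chain: "\<T> \<in> Chains {(A, B :: 'a set). A \<subseteq> B}"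
    unfolding \<T>_def by (rule bw.chain_iterates_above) (auto simp: Field_def)
  then have total: "A \<subseteq> B \<or> B \<subseteq> A" if "A \<in> \<T>" "B \<in> \<T>" for A B
    using that by (auto simp: Chains_def)
  have Union_in: "\<Union>\<C> \<in> \<T>" if "\<C> \<subseteq> \<T>" for \<C>
  proof (cases "\<C> = {}")
    case False
    then show ?thesis
      using that in_Chains_subset[OF chain that] unfolding \<T>_def by (intro bw.iterates_above.Sup) auto
  qed (use base in simp)
  have \<T>_open: "openin T U" if "U \<in> \<T>" for U
    using that unfolding \<T>_def
    by (induction rule: bw.iterates_above.induct) (auto intro: suc_open)
  \<comment> \<open>The largest member of the chain that does not cover \<open>F\<close>. It exists
    by compactness: if this union covered \<open>F\<close>, so would finitely many members, hence
    the largest of these.\<close>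
  define L where "L = (\<lambda>F. \<Union>{U \<in> \<T>. \<not> F \<subseteq> U})"
  have L_in: "L F \<in> \<T>" for F unfolding L_def by (rule Union_in) auto
  have L: "\<not> F \<subseteq> L F" if F: "closedin T F" "F \<noteq> {}" for F
  proof
    assume "F \<subseteq> L F"
    moreover have "compactin T F" using compact F(1) by (rule closedin_compact_space)
    ultimately obtain \<F> where \<F>: "finite \<F>" "\<F> \<subseteq> {U \<in> \<T>. \<not> F \<subseteq> U}" "F \<subseteq> \<Union>\<F>"
      using compactinD[of T F "{U \<in> \<T>. \<not> F \<subseteq> U}"] \<T>_open unfolding L_def by blast
    have "\<F> \<noteq> {}" using \<F>(3) F(2) by auto
    moreover have "subset.chain UNIV \<F>"
      using \<F>(2) total by (auto simp: subset_chain_def)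
    ultimately have "\<Union>\<F> \<in> \<F>" using Union_in_chain[OF \<F>(1)] by blast
    then show False using \<F> by auto
  qed
  have suc_L: "suc (L F) = insert (nxt (L F)) (L F)" "nxt (L F) \<notin> L F" "F \<subseteq> suc (L F)" "nxt (L F) \<in> F"
    if F: "closedin T F" "F \<noteq> {}" for F
  proof -
    have "L F \<noteq> topspace T" using L[OF F] closedin_subset[OF F(1)] by auto
    then show eq: "suc (L F) = insert (nxt (L F)) (L F)" and nin: "nxt (L F) \<notin> L F"
      using \<T>_open[OF L_in] nxt(1)[of "L F"] by (auto simp: suc_def)
    show cover: "F \<subseteq> suc (L F)"
    proof (rule ccontr)
      assume "\<not> F \<subseteq> suc (L F)"
      then have "suc (L F) \<subseteq> L F" using suc_in[OF L_in] by (auto simp: L_def)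
      then show False using eq nin by auto
    qed
    show "nxt (L F) \<in> F" using cover L[OF F] eq by auto
  qed
  show ?thesis
  proof (intro exI[of _ "\<lambda>F. nxt (L F)"] allI impI conjI)
    fix S assume S: "closedin T S" "S \<noteq> {}"
    show "nxt (L S) \<in> S" by (rule suc_L(4)[OF S])
    show "\<exists>V. openin T V \<and> S \<subseteq> V \<and> (\<forall>F. closedin T F \<longrightarrow> S \<subseteq> F \<longrightarrow> F \<subseteq> V \<longrightarrow> nxt (L F) = nxt (L S))"
    proof (intro exI[of _ "suc (L S)"] conjI allI impI)
      show "openin T (suc (L S))" by (rule suc_open[OF \<T>_open[OF L_in]])
      show "S \<subseteq> suc (L S)" by (rule suc_L(3)[OF S])
      fix F assume F: "S \<subseteq> F" "F \<subseteq> suc (L S)"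
      \<comment> \<open>Thus the same members of the chain cover \<open>F\<close> and
        \<open>S\<close>, and \<open>L\<close> cannot tell the two sets apart.\<close>
      have "F \<subseteq> U" if U: "U \<in> \<T>" "S \<subseteq> U" for U
      proof -
        have "\<not> U \<subseteq> L S" using U L[OF S] by auto
        then have "L S \<subseteq> U" using total[OF U(1) L_in] by auto
        moreover have "nxt (L S) \<in> U" using U suc_L(4)[OF S] by auto
        ultimately show ?thesis using F(2) suc_L(1)[OF S] by auto
      qed
      then have "{U \<in> \<T>. \<not> F \<subseteq> U} = {U \<in> \<T>. \<not> S \<subseteq> U}" using F(1) by blast
      then show "nxt (L F) = nxt (L S)" by (simp add: L_def)
    qed
  qed
qed

context Metric_space
begin

text \<open>The selector \<open>\<sigma>\<close> is chosen before \<open>\<mu>\<close>, which the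
  algorithm does not know; only \<open>c\<close> and \<open>\<delta>\<close> depend on
  \<open>\<mu>\<close>. The Lipschitz extension of \<open>\<mu>\<close> to the completion is the
  infimum over \<open>y\<close> of \<open>\<mu> y\<close> plus the distance from \<open>y\<close> to
  \<open>b\<close>, so the inequalities express that \<open>b\<close> is optimal, or optimal up to
  \<open>\<delta>\<close>, without forming an extension.\<close>

lemma optimum_selector_exists:
  assumes compact: "compact_space (Metric_space.mtopology (completion_space M d) (completion_dist M d))"
    and countable: "countable (completion_space M d)" and ne: "M \<noteq> {}"
  shows "\<exists>\<sigma>. \<forall>\<mu>. (\<forall>x\<in>M. \<forall>y\<in>M. \<bar>\<mu> x - \<mu> y\<bar> \<le> d x y) \<longrightarrow> bdd_above (\<mu> ` M) \<longrightarrow>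
    (\<exists>c\<in>completion_space M d. \<exists>\<delta>>0.
      (\<forall>y\<in>M. (SUP x\<in>M. \<mu> x) \<le> \<mu> y + completion_dist M d (completion_embed M d y) c) \<and>
      (\<forall>F. closedin (Metric_space.mtopology (completion_space M d) (completion_dist M d)) F \<longrightarrow>
        (\<forall>b\<in>completion_space M d.
          (\<forall>y\<in>M. (SUP x\<in>M. \<mu> x) \<le> \<mu> y + completion_dist M d (completion_embed M d y) b) \<longrightarrow> b \<in> F) \<longrightarrow>
        (\<forall>b\<in>F. \<forall>y\<in>M. (SUP x\<in>M. \<mu> x) - \<delta> \<le> \<mu> y + completion_dist M d (completion_embed M d y) b) \<longrightarrow>
        \<sigma> F = c))"
proof -
  interpret C: Metric_space "completion_space M d" "completion_dist M d"
    by (rule Metric_space_completion)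
  let ?K = "completion_space M d" and ?D = "completion_dist M d" and ?e = "completion_embed M d"
  have "\<exists>x\<in>S. \<exists>U. openin C.mtopology U \<and> U \<inter> S = {x}"
    if "closedin C.mtopology S" "S \<noteq> {}" for S
  proof (rule isolated_point_if_countable[OF _ that])
    show "completely_metrizable_space C.mtopology"
      by (rule C.completely_metrizable_space_mtopology[OF mcomplete_completion])
    show "countable S"
      using closedin_subset[OF that(1)] countable countable_subset by auto
  qed
  from stable_selector_exists[OF compact this]
  obtain \<sigma> where \<sigma>: "\<And>S. closedin C.mtopology S \<Longrightarrow> S \<noteq> {} \<Longrightarrow> \<sigma> S \<in> S \<and>
    (\<exists>V. openin C.mtopology V \<and> S \<subseteq> V \<and> (\<forall>F. closedin C.mtopology F \<longrightarrow> S \<subseteq> F \<longrightarrow> F \<subseteq> V \<longrightarrow> \<sigma> F = \<sigma> S))"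
    by blast
  show ?thesis
  proof (intro exI[of _ \<sigma>] allI impI)
    fix \<mu> :: "'a \<Rightarrow> real"
    assume lip: "\<forall>x\<in>M. \<forall>y\<in>M. \<bar>\<mu> x - \<mu> y\<bar> \<le> d x y" and bdd: "bdd_above (\<mu> ` M)"
    define m where "m = (SUP x\<in>M. \<mu> x)"
    \<comment> \<open>The points that are not optimal up to \<open>\<delta>\<close>. A single arm
      \<open>y\<close> suffices to rule out a point, which makes this a union of open balls.\<close>
    define W where "W = (\<lambda>\<delta>. \<Union>y\<in>M. C.mball (?e y) (m - \<delta> - \<mu> y))"
    have W_open: "openin C.mtopology (W \<delta>)" for \<delta>
      unfolding W_def by (intro openin_Union) auto
    have W_iff: "b \<notin> W \<delta> \<longleftrightarrow> (\<forall>y\<in>M. m - \<delta> \<le> \<mu> y + ?D (?e y) b)" if "b \<in> ?K" for b \<delta>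
      using that completion_embed_in by (force simp: W_def not_less)
    have W_mono: "W \<delta> \<subseteq> W \<delta>'" if "\<delta>' \<le> \<delta>" for \<delta> \<delta>'
      unfolding W_def using that by (intro UN_mono C.mball_subset_concentric) auto
    define Opt where "Opt = ?K - W 0"
    have Opt_closed: "closedin C.mtopology Opt"
      unfolding Opt_def using closedin_diff[OF closedin_topspace W_open[of 0]] by simp
    \<comment> \<open>A non-optimal point is so by some margin \<open>1 / Suc n\<close>, so
      \<open>V\<close> and the sets \<open>W (1 / Suc n)\<close> cover the completion. By
      monotonicity a finite subcover reduces to \<open>V\<close> and a single
      \<open>W \<delta>\<close>.\<close>
    have gap: "\<exists>\<delta>>0. ?K - W \<delta> \<subseteq> V" if V: "openin C.mtopology V" "Opt \<subseteq> V" for V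
    proof -
      have "?K \<subseteq> \<Union>(insert V (range (\<lambda>n :: nat. W (1 / Suc n))))"
      proof
        fix b assume b: "b \<in> ?K"
        show "b \<in> \<Union>(insert V (range (\<lambda>n :: nat. W (1 / Suc n))))"
        proof (cases "b \<in> W 0")
          case True
          then obtain y where y: "y \<in> M" "?D (?e y) b < m - \<mu> y" by (auto simp: W_def)
          then obtain n where n: "1 / real (Suc n) < m - \<mu> y - ?D (?e y) b"
            using nat_approx_posE[of "m - \<mu> y - ?D (?e y) b"] by auto
          then have "b \<in> W (1 / Suc n)"
            using y b by (auto simp: W_def completion_embed_in intro!: bexI[of _ y])
          then show ?thesis by blast
        next
          case False
          then show ?thesis using b V by (auto simp: Opt_def)
        qed
      qed
      moreover have "compactin C.mtopology ?K"
        using compact by (simp add: compact_space_def)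
      moreover have "openin C.mtopology U" if "U \<in> insert V (range (\<lambda>n :: nat. W (1 / Suc n)))" for U
        using that V(1) W_open by auto
      ultimately have "\<exists>\<F>. finite \<F> \<and> \<F> \<subseteq> insert V (range (\<lambda>n :: nat. W (1 / Suc n))) \<and> ?K \<subseteq> \<Union>\<F>"
        by (intro compactinD)
      then obtain \<F> where \<F>: "finite \<F>" "\<F> \<subseteq> insert V (range (\<lambda>n :: nat. W (1 / Suc n)))" "?K \<subseteq> \<Union>\<F>"
        by (elim exE conjE)
      have "finite (\<F> - {V})" "\<F> - {V} \<subseteq> range (\<lambda>n :: nat. W (1 / Suc n))" using \<F> by auto
      then obtain I :: "nat set" where I: "finite I" "\<F> - {V} = (\<lambda>n. W (1 / Suc n)) ` I"
        by (metis finite_subset_image)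
      define N where "N = Max (insert 0 I)"
      have sub: "W (1 / Suc n) \<subseteq> W (1 / Suc N)" if "n \<in> I" for n
        using that I(1) by (intro W_mono divide_left_mono) (auto simp: N_def)
      have "U \<subseteq> V \<union> W (1 / Suc N)" if "U \<in> \<F>" for U
      proof (cases "U = V")
        case False
        with that have "U \<in> \<F> - {V}" by simp
        then have "U \<in> (\<lambda>n. W (1 / Suc n)) ` I" by (simp only: I(2))
        then obtain n where "n \<in> I" "U = W (1 / Suc n)" by (elim imageE)
        then show ?thesis using sub[of n] by auto
      qed auto
      then have "\<Union>\<F> \<subseteq> V \<union> W (1 / Suc N)" by (rule Union_least)
      with \<F>(3) have "?K \<subseteq> V \<union> W (1 / Suc N)" by (rule order_trans)
      then show ?thesis by (intro exI[of _ "1 / Suc N"]) auto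
    qed
    \<comment> \<open>The supremum need not be attained on \<open>M\<close>. If \<open>Opt\<close>
      were empty, \<open>gap\<close> with the empty set as \<open>V\<close> would exclude points
      optimal up to \<open>\<delta>\<close>, but arms approaching the supremum are such
      points.\<close>
    have "Opt \<noteq> {}"
    proof
      assume "Opt = {}"
      then obtain \<delta> where \<delta>: "\<delta> > 0" "?K - W \<delta> \<subseteq> {}" using gap[of "{}"] by auto
      obtain x where x: "x \<in> M" "m - \<delta> < \<mu> x"
        using less_cSUP_iff[of M \<mu> "m - \<delta>"] ne bdd \<delta>(1) by (auto simp: m_def)
      have "m - \<delta> \<le> \<mu> y + d y x" if "y \<in> M" for y
        using lip[rule_format, OF that x(1)] x(2) by linarith
      then have "?e x \<notin> W \<delta>"
        using x by (subst W_iff) (auto simp: completion_embed_in completion_embed_isometry)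
      then show False using \<delta> completion_embed_in[OF x(1)] by auto
    qed
    with \<sigma>[OF Opt_closed] obtain V where c: "\<sigma> Opt \<in> Opt" and V: "openin C.mtopology V" "Opt \<subseteq> V"
      and stable: "\<And>F. closedin C.mtopology F \<Longrightarrow> Opt \<subseteq> F \<Longrightarrow> F \<subseteq> V \<Longrightarrow> \<sigma> F = \<sigma> Opt" by blast
    obtain \<delta> where \<delta>: "\<delta> > 0" "?K - W \<delta> \<subseteq> V" using gap[OF V] by blast
    show "\<exists>c\<in>?K. \<exists>\<delta>>0. (\<forall>y\<in>M. (SUP x\<in>M. \<mu> x) \<le> \<mu> y + ?D (?e y) c) \<and>
      (\<forall>F. closedin C.mtopology F \<longrightarrow>
        (\<forall>b\<in>?K. (\<forall>y\<in>M. (SUP x\<in>M. \<mu> x) \<le> \<mu> y + ?D (?e y) b) \<longrightarrow> b \<in> F) \<longrightarrow>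
        (\<forall>b\<in>F. \<forall>y\<in>M. (SUP x\<in>M. \<mu> x) - \<delta> \<le> \<mu> y + ?D (?e y) b) \<longrightarrow> \<sigma> F = c)"
      unfolding m_def[symmetric]
    proof (intro bexI[of _ "\<sigma> Opt"] exI[of _ \<delta>] conjI \<delta>(1) allI impI)
      show "\<sigma> Opt \<in> ?K" using c by (simp add: Opt_def)
      then show "\<forall>y\<in>M. m \<le> \<mu> y + ?D (?e y) (\<sigma> Opt)"
        using c W_iff[of "\<sigma> Opt" 0] by (simp add: Opt_def)
      fix F assume F: "closedin C.mtopology F" and opt: "\<forall>b\<in>?K. (\<forall>y\<in>M. m \<le> \<mu> y + ?D (?e y) b) \<longrightarrow> b \<in> F"
        and near: "\<forall>b\<in>F. \<forall>y\<in>M. m - \<delta> \<le> \<mu> y + ?D (?e y) b"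
      have "Opt \<subseteq> F" using opt W_iff[of _ 0] by (auto simp: Opt_def)
      moreover have "F \<subseteq> ?K - W \<delta>"
      proof
        fix b assume b: "b \<in> F"
        then have "b \<in> ?K" using closedin_subset[OF F] by auto
        then show "b \<in> ?K - W \<delta>" using near b W_iff[of b \<delta>] by blast
      qed
      ultimately show "\<sigma> F = \<sigma> Opt" using stable[OF F] \<delta>(2) by blast
    qed
  qed
qed

end

section \<open>Concentration of sampled rewards\<close>

text \<open>Hoeffding's lemma on an interval of length 1; the sign \<open>a\<close> serves both
  tails.\<close>

lemma (in bandit_run) reward_mgf:
  assumes x: "x \<in> X" and "l > 0" and a: "a = 1 \<or> a = - 1"
  shows "(\<integral>\<^sup>+r. ennreal (exp (l * (a * (r - \<mu> x)))) \<partial>P x) \<le> ennreal (exp (l\<^sup>2 / 8))"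
proof -
  interpret P: prob_space "P x" by (rule P_prob[OF x])
  define lo where "lo = (if a = 1 then 0 else - 1 :: real)"
  interpret B: interval_bounded_random_variable "P x" "\<lambda>r. a * r" lo "lo + 1"
  proof
    show "AE r in P x. a * r \<in> {lo..lo + 1}"
      using reward_range[OF x] by (rule eventually_mono) (use a in \<open>auto simp: lo_def\<close>)
    show "(\<lambda>r. a * r) \<in> borel_measurable (P x)"
      by (simp add: measurable_cong_sets[OF sets_P[OF x] refl])
  qed
  show ?thesis
    using B.Hoeffdings_lemma_nn_integral[OF \<open>l > 0\<close>] reward_mean[OF x] by (simp add: right_diff_distrib)
qed

text \<open>Chernoff's bound with \<open>l = 4 * e\<close>, the minimiser of
  \<open>l\<^sup>2 / 8 - l * e\<close>. The rounds in \<open>S\<close> are fixed in advance and play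
  \<open>x\<close> whatever the history, so each obeys the same moment bound although other rounds
  are adaptive.\<close>

lemma (in bandit_run) sampling_deviation_one_sided:
  fixes e a :: real
  assumes S: "S \<subseteq> {..<t}" "S \<noteq> {}" and x: "x \<in> X" and e: "e > 0" and a: "a = 1 \<or> a = - 1"
    and play: "\<And>s h. s \<in> S \<Longrightarrow> h \<in> space (hist s) \<Longrightarrow> \<pi> s h = return arms x"
  shows "emeasure (law t) {h \<in> space (law t). card S * e \<le> a * (\<Sum>s\<in>S. snd (h s) - \<mu> x)}
    \<le> ennreal (exp (- 2 * real (card S) * e\<^sup>2))"
proof -
  note hist_coord [measurable]
  have fin: "finite S" using S finite_subset by blast
  define l where "l = 4 * e"
  have "l > 0" using e by (simp add: l_def)
  define G where "G = (\<lambda>s (z :: 'a \<times> real). if s \<in> S then ennreal (exp (l * (a * (snd z - \<mu> x)))) else 1)"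
  have [measurable]: "G s \<in> borel_measurable (round_algebra X d)" for s
    unfolding G_def by (cases "s \<in> S") simp_all
  have "(\<integral>\<^sup>+h. (\<Prod>s<t. G s (h s)) \<partial>law t) \<le> (\<Prod>s<t. if s \<in> S then ennreal (exp (l\<^sup>2 / 8)) else 1)"
  proof (rule nn_integral_law_prod_le)
    fix s h assume h: "h \<in> space (hist s)"
    show "(\<integral>\<^sup>+y. (\<integral>\<^sup>+r. G s (y, r) \<partial>P y) \<partial>\<pi> s h) \<le> (if s \<in> S then ennreal (exp (l\<^sup>2 / 8)) else 1)"
    proof (cases "s \<in> S")
      case True
      have "(\<integral>\<^sup>+y. (\<integral>\<^sup>+r. G s (y, r) \<partial>P y) \<partial>\<pi> s h) = (\<integral>\<^sup>+r. G s (x, r) \<partial>P x)"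
        unfolding play[OF True h] by (rule nn_integral_return) (auto simp: x intro: measurable_reward_integral)
      then show ?thesis using reward_mgf[OF x \<open>l > 0\<close> a] True by (simp add: G_def)
    next
      case False
      have "(\<integral>\<^sup>+y. (\<integral>\<^sup>+r. G s (y, r) \<partial>P y) \<partial>\<pi> s h) = (\<integral>\<^sup>+y. 1 \<partial>\<pi> s h)"
        using False prob_space.emeasure_space_1[OF P_prob] by (intro nn_integral_cong) (simp add: G_def space_\<pi>[OF h])
      then show ?thesis using prob_space.emeasure_space_1[OF \<pi>_prob[OF h]] False by simp
    qed
  qed measurable
  also have "\<dots> = ennreal (exp (l\<^sup>2 / 8)) ^ card S"
    using S(1) by (simp add: prod.If_cases Int_absorb1)
  also have "\<dots> = ennreal (exp (card S * (l\<^sup>2 / 8)))"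
    using exp_of_nat_mult[of "card S" "l\<^sup>2 / 8"] by (simp add: ennreal_power)
  finally have mgf: "(\<integral>\<^sup>+h. (\<Prod>s<t. G s (h s)) \<partial>law t) \<le> ennreal (exp (card S * (l\<^sup>2 / 8)))" .
  have prod_eq: "(\<Prod>s<t. G s (h s)) = ennreal (exp (l * (a * (\<Sum>s\<in>S. snd (h s) - \<mu> x))))" for h
  proof -
    have "(\<Prod>s<t. G s (h s)) = (\<Prod>s\<in>S. ennreal (exp (l * (a * (snd (h s) - \<mu> x)))))"
      using S(1) by (simp add: G_def prod.If_cases Int_absorb1)
    also have "\<dots> = ennreal (\<Prod>s\<in>S. exp (l * (a * (snd (h s) - \<mu> x))))"
      by (rule prod_ennreal) simp
    finally show ?thesis using fin by (simp add: exp_sum sum_distrib_left)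
  qed
  have [measurable]: "(\<lambda>h. \<Sum>s\<in>S. snd (h s) - \<mu> x) \<in> borel_measurable (hist t)"
    using S(1) by (intro borel_measurable_sum borel_measurable_diff measurable_compose[OF hist_coord measurable_snd]) auto
  have "emeasure (law t) {h \<in> space (law t). card S * e \<le> a * (\<Sum>s\<in>S. snd (h s) - \<mu> x)} =
      (\<integral>\<^sup>+h. indicator {h \<in> space (law t). card S * e \<le> a * (\<Sum>s\<in>S. snd (h s) - \<mu> x)} h \<partial>law t)"
    by (rule nn_integral_indicator[symmetric]) measurable
  also have "\<dots> \<le> (\<integral>\<^sup>+h. ennreal (exp (- l * (card S * e))) * (\<Prod>s<t. G s (h s)) \<partial>law t)"
  proof (rule nn_integral_mono)
    fix h assume h: "h \<in> space (law t)"
    show "indicator {h \<in> space (law t). card S * e \<le> a * (\<Sum>s\<in>S. snd (h s) - \<mu> x)} h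
        \<le> ennreal (exp (- l * (card S * e))) * (\<Prod>s<t. G s (h s))"
    proof (cases "card S * e \<le> a * (\<Sum>s\<in>S. snd (h s) - \<mu> x)")
      case True
      then have "l * (card S * e) \<le> l * (a * (\<Sum>s\<in>S. snd (h s) - \<mu> x))"
        using \<open>l > 0\<close> by (intro mult_left_mono) auto
      then have "1 \<le> exp (- l * (card S * e)) * exp (l * (a * (\<Sum>s\<in>S. snd (h s) - \<mu> x)))"
        by (simp flip: exp_add)
      then have "ennreal 1 \<le> ennreal (exp (- l * (card S * e)) * exp (l * (a * (\<Sum>s\<in>S. snd (h s) - \<mu> x))))"
        by (rule ennreal_leI)
      then show ?thesis
        using True h by (simp add: prod_eq ennreal_mult)
    qed simp
  qed
  also have "\<dots> = ennreal (exp (- l * (card S * e))) * (\<integral>\<^sup>+h. (\<Prod>s<t. G s (h s)) \<partial>law t)"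
    by (rule nn_integral_cmult) measurable
  also have "\<dots> \<le> ennreal (exp (- l * (card S * e))) * ennreal (exp (card S * (l\<^sup>2 / 8)))"
    by (rule mult_left_mono[OF mgf]) simp
  also have "\<dots> = ennreal (exp (- l * (card S * e) + card S * (l\<^sup>2 / 8)))"
    by (simp only: exp_add ennreal_mult exp_ge_zero)
  also have "- l * (card S * e) + card S * (l\<^sup>2 / 8) = - 2 * real (card S) * e\<^sup>2"
    by (simp add: l_def power2_eq_square)
  finally show ?thesis .
qed

lemma (in bandit_run) sampling_deviation:
  fixes e :: real
  assumes S: "S \<subseteq> {..<t}" "S \<noteq> {}" and x: "x \<in> X" and e: "e > 0"
    and play: "\<And>s h. s \<in> S \<Longrightarrow> h \<in> space (hist s) \<Longrightarrow> \<pi> s h = return arms x"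
  shows "emeasure (law t) {h \<in> space (law t). e < \<bar>(\<Sum>s\<in>S. snd (h s)) / card S - \<mu> x\<bar>}
    \<le> ennreal (2 * exp (- 2 * real (card S) * e\<^sup>2))"
proof -
  note hist_coord [measurable]
  have fin: "finite S" using S finite_subset by blast
  then have card: "card S > 0" using S by (simp add: card_gt_0_iff)
  have [measurable]: "(\<lambda>h. \<Sum>s\<in>S. snd (h s) - \<mu> x) \<in> borel_measurable (hist t)"
    using S(1) by (intro borel_measurable_sum borel_measurable_diff measurable_compose[OF hist_coord measurable_snd]) auto
  let ?E = "\<lambda>a. {h \<in> space (law t). card S * e \<le> a * (\<Sum>s\<in>S. snd (h s) - \<mu> x)}"
  have "{h \<in> space (law t). e < \<bar>(\<Sum>s\<in>S. snd (h s)) / card S - \<mu> x\<bar>} \<subseteq> ?E 1 \<union> ?E (- 1)"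
  proof
    fix h assume h: "h \<in> {h \<in> space (law t). e < \<bar>(\<Sum>s\<in>S. snd (h s)) / card S - \<mu> x\<bar>}"
    have "card S * ((\<Sum>s\<in>S. snd (h s)) / card S - \<mu> x) = (\<Sum>s\<in>S. snd (h s) - \<mu> x)"
      using card by (simp add: sum_subtractf right_diff_distrib)
    moreover have "card S * e \<le> card S * \<bar>(\<Sum>s\<in>S. snd (h s)) / card S - \<mu> x\<bar>"
      using h by (intro mult_left_mono) auto
    ultimately have "card S * e \<le> \<bar>\<Sum>s\<in>S. snd (h s) - \<mu> x\<bar>"
      by (metis abs_mult abs_of_nat)
    then show "h \<in> ?E 1 \<union> ?E (- 1)" using h by (auto simp: abs_if split: if_splits)
  qed
  then have "emeasure (law t) {h \<in> space (law t). e < \<bar>(\<Sum>s\<in>S. snd (h s)) / card S - \<mu> x\<bar>} \<le> emeasure (law t) (?E 1 \<union> ?E (- 1))"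
    by (rule emeasure_mono) measurable
  also have "\<dots> \<le> emeasure (law t) (?E 1) + emeasure (law t) (?E (- 1))"
    by (rule emeasure_subadditive) measurable
  also have "\<dots> \<le> ennreal (exp (- 2 * real (card S) * e\<^sup>2)) + ennreal (exp (- 2 * real (card S) * e\<^sup>2))"
    by (intro add_mono sampling_deviation_one_sided S x e play) auto
  also have "\<dots> = ennreal (2 * exp (- 2 * real (card S) * e\<^sup>2))"
    by (subst ennreal_plus[symmetric]) auto
  finally show ?thesis .
qed

section \<open>Exploration in phases\<close>

definition phase :: "nat \<Rightarrow> nat" where
  "phase t = floor_log (floor_log t)"

text \<open>Each phase starts at the square of the previous start, so logarithms vary by a factor of
  at most 2 within a phase. Rounds 0 and 1 precede phase 0 but get the phase number 0 too.\<close>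

definition phase_start :: "nat \<Rightarrow> nat" where
  "phase_start j = 2 ^ 2 ^ j"

lemma phase_mono: "s \<le> t \<Longrightarrow> phase s \<le> phase t"
  unfolding phase_def by (intro floor_log_le_iff)

lemma phase_phase_start: "phase (phase_start j) = j"
  by (simp add: phase_def phase_start_def)

lemma phase_ge: "phase_start j \<le> t \<Longrightarrow> j \<le> phase t"
  using phase_mono[of "phase_start j" t] by (simp add: phase_phase_start)

lemma phase_start_phase_le:
  assumes "2 \<le> t"
  shows "phase_start (phase t) \<le> t"
proof -
  have "floor_log t > 0"
    using floor_log_le_iff[OF assms] floor_log_power[of 1] by simp
  then have "(2::nat) ^ 2 ^ phase t \<le> 2 ^ floor_log t"
    unfolding phase_def by (intro power_increasing floor_log_exp2_le) auto
  also have "\<dots> \<le> t" using assms by (intro floor_log_exp2_le) auto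
  finally show ?thesis by (simp add: phase_start_def)
qed

lemma less_phase_start_Suc_phase: "t < phase_start (Suc (phase t))"
proof -
  have "t < 2 ^ Suc (floor_log t)" using floor_log_exp2_gt[of t] by simp
  also have "\<dots> \<le> 2 ^ (2 * 2 ^ phase t)"
    using floor_log_exp2_gt[of "floor_log t"] unfolding phase_def by (intro power_increasing) auto
  finally show ?thesis by (simp add: phase_start_def)
qed

lemma two_power_phase_le:
  assumes "2 \<le> t"
  shows "2 ^ phase t \<le> 2 * ln (real t)"
proof -
  have "real (2 ^ 2 ^ phase t) \<le> real t"
    using phase_start_phase_le[OF assms] unfolding phase_start_def of_nat_le_iff .
  then have "ln (2 ^ 2 ^ phase t) \<le> ln (real t)"
    using assms by (subst ln_le_cancel_iff) auto
  then have "2 ^ phase t * ln 2 \<le> ln (real t)" by (simp add: ln_realpow)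
  moreover have "2 ^ phase t * (1 / 2) \<le> 2 ^ phase t * ln (2 :: real)"
    using ln2_ge_two_thirds by (intro mult_left_mono) auto
  ultimately show ?thesis by linarith
qed

text \<open>In phase \<open>j\<close> the round number is below \<open>2 ^ (2 * 2 ^ j)\<close>, and
  \<open>2 \<le> exp 1\<close>. This turns failure probabilities into a harmonic series over the
  rounds.\<close>

lemma exp_phase_le: "exp (- 2 * 2 ^ phase s) \<le> 1 / real (Suc s)"
proof -
  have "real (Suc s) \<le> real (2 ^ (2 * 2 ^ phase s))"
    using less_phase_start_Suc_phase[of s] unfolding phase_start_def of_nat_le_iff by simp
  also have "\<dots> \<le> exp 1 ^ (2 * 2 ^ phase s)"
    using exp_ge_add_one_self[of 1] by (simp add: power_mono)
  also have "\<dots> = exp (2 * 2 ^ phase s)"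
    by (simp flip: exp_of_nat_mult)
  finally show ?thesis by (simp add: exp_minus field_simps)
qed

text \<open>The arms \<open>net k i\<close> with \<open>i < n k\<close> are meant as a net of
  accuracy \<open>(1 / 2) ^ k\<close>; phase \<open>j\<close> uses net \<open>\<kappa> j\<close>,
  and \<open>rule\<close> turns the set of apparently good indices into an arm.\<close>

locale explore_exploit =
  fixes X :: "'a set" and d :: "'a \<Rightarrow> 'a \<Rightarrow> real"
    and net :: "nat \<Rightarrow> nat \<Rightarrow> 'a" and n :: "nat \<Rightarrow> nat" and \<kappa> :: "nat \<Rightarrow> nat"
    and rule :: "nat \<Rightarrow> nat set \<Rightarrow> 'a"
  assumes metric: "Metric_space X d"
    and net_in: "\<And>k i. i < n k \<Longrightarrow> net k i \<in> X" and n_pos: "\<And>k. 0 < n k"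
    and rule_in: "\<And>t S. rule t S \<in> X"
begin

text \<open>Chosen so that \<open>rounds j * (width j)\<^sup>2 = 2 ^ j\<close>, which is half the
  exponent in Hoeffding's bound.\<close>

definition rounds :: "nat \<Rightarrow> nat" where
  "rounds j = 4 ^ \<kappa> j * 2 ^ j"

definition width :: "nat \<Rightarrow> real" where
  "width j = (1 / 2) ^ \<kappa> j"

definition block :: "nat \<Rightarrow> nat \<Rightarrow> nat set" where
  "block j i = {phase_start j + i * rounds j ..< phase_start j + Suc i * rounds j}"

definition est :: "nat \<Rightarrow> nat \<Rightarrow> (nat \<Rightarrow> 'a \<times> real) \<Rightarrow> real" where
  "est j i h = (\<Sum>s\<in>block j i. snd (h s)) / rounds j"

text \<open>Slack 3: with accurate estimates no arm seems better than the optimum plus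
  \<open>width j\<close>, and an arm within \<open>width j\<close> of an optimal point seems at
  worst \<open>2 * width j\<close> below the optimum, so it stays active.\<close>

definition active :: "nat \<Rightarrow> (nat \<Rightarrow> 'a \<times> real) \<Rightarrow> nat set" where
  "active j h = {i \<in> {..<n (\<kappa> j)}. \<forall>i'\<in>{..<n (\<kappa> j)}. est j i' h - 3 * width j \<le> est j i h}"

text \<open>If the exploration does not fit into its phase, the whole phase explores and its
  estimates are never consulted.\<close>

definition exploring :: "nat \<Rightarrow> bool" where
  "exploring t \<longleftrightarrow> t < phase_start (phase t) + n (\<kappa> (phase t)) * rounds (phase t)"

definition arm :: "nat \<Rightarrow> (nat \<Rightarrow> 'a \<times> real) \<Rightarrow> 'a" where
  "arm t h = (if exploring t then net (\<kappa> (phase t)) ((t - phase_start (phase t)) div rounds (phase t))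
     else rule t (active (phase t) h))"

definition policy :: "nat \<Rightarrow> (nat \<Rightarrow> 'a \<times> real) \<Rightarrow> 'a measure" where
  "policy t h = return (arm_algebra X d) (arm t h)"

lemma rounds_pos: "0 < rounds j"
  by (simp add: rounds_def)

lemma card_block: "card (block j i) = rounds j"
  by (simp add: block_def)

lemma block_less:
  assumes "\<not> exploring t" "i < n (\<kappa> (phase t))"
  shows "block (phase t) i \<subseteq> {..<t}"
proof
  fix s assume "s \<in> block (phase t) i"
  then have "s < phase_start (phase t) + Suc i * rounds (phase t)" by (simp add: block_def)
  also have "\<dots> \<le> phase_start (phase t) + n (\<kappa> (phase t)) * rounds (phase t)"
    using assms(2) by (intro add_left_mono mult_right_mono) auto
  also have "\<dots> \<le> t" using assms(1) by (simp add: exploring_def)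
  finally show "s \<in> {..<t}" by simp
qed

text \<open>A block that starts in the phase of \<open>t\<close> and ends by time \<open>t\<close>
  lies in that phase entirely, so its rounds play one fixed arm whatever the history, as the
  deviation bound demands.\<close>

lemma arm_block:
  assumes "\<not> exploring t" "i < n (\<kappa> (phase t))" "s \<in> block (phase t) i"
  shows "arm s h = net (\<kappa> (phase t)) i"
proof -
  let ?j = "phase t"
  have s: "phase_start ?j + i * rounds ?j \<le> s" "s < phase_start ?j + Suc i * rounds ?j" "s < t"
    using assms(3) block_less[OF assms(1,2)] by (auto simp: block_def)
  have ph: "phase s = ?j"
    using phase_mono[of s t] phase_ge[of ?j s] s by simp
  have "Suc i * rounds ?j \<le> n (\<kappa> ?j) * rounds ?j"
    using assms(2) by (intro mult_right_mono) auto
  then have "exploring s" using s(2) by (simp add: exploring_def ph)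
  moreover have "(s - phase_start ?j) div rounds ?j = i"
    using s(1,2) by (intro div_nat_eqI) (auto simp: mult.commute)
  ultimately show ?thesis by (simp add: arm_def ph)
qed

lemma arm_in: "arm t h \<in> X"
proof (cases "exploring t")
  case True
  \<comment> \<open>In rounds 0 and 1 the subtraction truncates to 0, so positivity of
    \<open>n\<close> and \<open>rounds\<close> is what counts there.\<close>
  then have "t - phase_start (phase t) < n (\<kappa> (phase t)) * rounds (phase t)"
    using n_pos[of "\<kappa> (phase t)"] rounds_pos[of "phase t"] mult_pos_pos[of "n (\<kappa> (phase t))" "rounds (phase t)"]
    unfolding exploring_def by linarith
  then have "(t - phase_start (phase t)) div rounds (phase t) < n (\<kappa> (phase t))"
    by (simp add: div_less_iff_less_mult rounds_pos)
  then show ?thesis using True by (simp add: arm_def net_in)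
qed (simp add: arm_def rule_in)

lemma est_measurable:
  assumes "block j i \<subseteq> {..<t}"
  shows "est j i \<in> borel_measurable (\<Pi>\<^sub>M s\<in>{0..<t}. round_algebra X d)"
  unfolding est_def
proof (intro borel_measurable_divide borel_measurable_sum borel_measurable_const)
  fix s assume "s \<in> block j i"
  then have "s \<in> {0..<t}" using assms by auto
  then have "(\<lambda>h. h s) \<in> (\<Pi>\<^sub>M s\<in>{0..<t}. round_algebra X d) \<rightarrow>\<^sub>M round_algebra X d"
    by (rule measurable_component_singleton)
  then show "(\<lambda>h. snd (h s)) \<in> borel_measurable (\<Pi>\<^sub>M s\<in>{0..<t}. round_algebra X d)"
    by (rule measurable_compose[OF _ measurable_snd])
qed

text \<open>After exploration the arm depends on the history only through \<open>active\<close>,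
  which has finitely many values, so any function can serve as \<open>rule\<close>.\<close>

lemma arm_measurable: "arm t \<in> (\<Pi>\<^sub>M s\<in>{0..<t}. round_algebra X d) \<rightarrow>\<^sub>M arm_algebra X d" (is "_ \<in> ?H \<rightarrow>\<^sub>M _")
proof (cases "exploring t")
  case True
  then have "arm t = (\<lambda>h. arm t undefined)" by (simp add: arm_def fun_eq_iff)
  then show ?thesis
    using arm_in[of t undefined] by (metis measurable_const space_arm_algebra[OF metric])
next
  case False
  let ?j = "phase t"
  let ?N = "{..<n (\<kappa> ?j)}"
  have le: "Measurable.pred ?H (\<lambda>h. est ?j i' h - 3 * width ?j \<le> est ?j i h)" if "i \<in> ?N" "i' \<in> ?N" for i i'
  proof -
    have "est ?j i \<in> borel_measurable ?H" "est ?j i' \<in> borel_measurable ?H"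
      using that by (auto intro!: est_measurable block_less[OF False])
    then show ?thesis
      unfolding pred_def by (intro borel_measurable_le borel_measurable_diff borel_measurable_const)
  qed
  have "active ?j \<in> ?H \<rightarrow>\<^sub>M count_space (Pow ?N)"
  proof (subst measurable_count_space_eq2, simp, intro conjI ballI)
    show "active ?j \<in> space ?H \<rightarrow> Pow ?N" by (auto simp: active_def)
    fix S assume "S \<in> Pow ?N"
    then have "{i \<in> ?N. Q i} = S \<longleftrightarrow> (\<forall>i\<in>?N. i \<in> S \<longleftrightarrow> Q i)" for Q by blast
    then have "active ?j h = S \<longleftrightarrow> (\<forall>i\<in>?N. i \<in> S \<longleftrightarrow> (\<forall>i'\<in>?N. est ?j i' h - 3 * width ?j \<le> est ?j i h))" for h
      unfolding active_def .
    then have "active ?j -` {S} \<inter> space ?H =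
      {h \<in> space ?H. \<forall>i\<in>?N. i \<in> S \<longleftrightarrow> (\<forall>i'\<in>?N. est ?j i' h - 3 * width ?j \<le> est ?j i h)}"
      by (simp only: vimage_def Int_def singleton_iff mem_Collect_eq conj_commute)
    also have "\<dots> \<in> sets ?H"
      by (rule predE) (intro pred_intros_finite pred_intros_logic le finite_lessThan measurable_const; simp)
    finally show "active ?j -` {S} \<inter> space ?H \<in> sets ?H" .
  qed
  moreover have "rule t \<in> count_space (Pow ?N) \<rightarrow>\<^sub>M arm_algebra X d"
    by (simp add: rule_in space_arm_algebra[OF metric])
  ultimately have "(\<lambda>h. rule t (active ?j h)) \<in> ?H \<rightarrow>\<^sub>M arm_algebra X d"
    by (rule measurable_compose)
  then show ?thesis using False by (simp add: arm_def[abs_def])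
qed

lemma policy_algorithm: "bandit_algorithm X d policy"
  unfolding bandit_algorithm_def policy_def[abs_def]
  by (intro allI measurable_compose[OF arm_measurable measurable_return_prob_space])

end

locale explore_exploit_run = explore_exploit X d net n \<kappa> rule
  for X :: "'a set" and d net n \<kappa> rule +
  fixes \<mu> :: "'a \<Rightarrow> real" and P :: "'a \<Rightarrow> real measure"
  assumes nonempty: "X \<noteq> {}" and inst: "lipschitz_instance X d \<mu> P"
begin

sublocale run: bandit_run X d \<mu> P policy
  by (rule bandit_run.intro[OF metric nonempty inst policy_algorithm])

definition accurate :: "nat \<Rightarrow> (nat \<Rightarrow> 'a \<times> real) \<Rightarrow> bool" where
  "accurate j h \<longleftrightarrow> (\<forall>i<n (\<kappa> j). \<bar>est j i h - \<mu> (net (\<kappa> j) i)\<bar> \<le> width j)"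

lemma inaccurate_eq:
  "{h \<in> space (run.law t). \<not> accurate j h} =
    (\<Union>i<n (\<kappa> j). {h \<in> space (run.law t). width j < \<bar>est j i h - \<mu> (net (\<kappa> j) i)\<bar>})"
  by (auto simp: accurate_def not_le)

lemma inaccurate_sets:
  assumes "\<not> exploring t"
  shows "i < n (\<kappa> (phase t)) \<Longrightarrow>
      {h \<in> space (run.law t). width (phase t) < \<bar>est (phase t) i h - \<mu> (net (\<kappa> (phase t)) i)\<bar>} \<in> sets (run.law t)"
    and "{h \<in> space (run.law t). \<not> accurate (phase t) h} \<in> sets (run.law t)"
proof -
  show B: "{h \<in> space (run.law t). width (phase t) < \<bar>est (phase t) i h - \<mu> (net (\<kappa> (phase t)) i)\<bar>} \<in> sets (run.law t)"
    if "i < n (\<kappa> (phase t))" for i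
  proof -
    have "est (phase t) i \<in> borel_measurable (run.law t)"
      using est_measurable[OF block_less[OF assms that]] by (simp add: measurable_cong_sets[OF run.sets_law refl])
    then show ?thesis
      by (intro borel_measurable_less borel_measurable_abs borel_measurable_diff borel_measurable_const)
  qed
  show "{h \<in> space (run.law t). \<not> accurate (phase t) h} \<in> sets (run.law t)"
    unfolding inaccurate_eq by (intro sets.finite_UN) (use B in auto)
qed

text \<open>Union bound over the net, with Hoeffding's bound for each block.\<close>

lemma inaccurate_prob:
  assumes "\<not> exploring t"
  shows "emeasure (run.law t) {h \<in> space (run.law t). \<not> accurate (phase t) h}
    \<le> ennreal (2 * n (\<kappa> (phase t)) * exp (- 2 * 2 ^ phase t))"
proof -
  let ?j = "phase t"
  let ?B = "\<lambda>i. {h \<in> space (run.law t). width ?j < \<bar>est ?j i h - \<mu> (net (\<kappa> ?j) i)\<bar>}"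
  have B: "emeasure (run.law t) (?B i) \<le> ennreal (2 * exp (- 2 * 2 ^ ?j))" if "i \<in> {..<n (\<kappa> ?j)}" for i
  proof -
    have i: "i < n (\<kappa> ?j)" using that by simp
    have ne: "block ?j i \<noteq> {}"
      using card_block[of ?j i] rounds_pos[of ?j] by auto
    have "emeasure (run.law t) {h \<in> space (run.law t). width ?j < \<bar>(\<Sum>s\<in>block ?j i. snd (h s)) / card (block ?j i) - \<mu> (net (\<kappa> ?j) i)\<bar>}
      \<le> ennreal (2 * exp (- 2 * real (card (block ?j i)) * (width ?j)\<^sup>2))"
      by (rule run.sampling_deviation[OF block_less[OF assms i] ne net_in[OF i]])
         (auto simp: width_def policy_def arm_block[OF assms i])
    moreover have "- 2 * real (card (block ?j i)) * (width ?j)\<^sup>2 = - 2 * 2 ^ ?j"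
    proof -
      have "(4 :: real) ^ \<kappa> ?j * ((1 / 2) ^ \<kappa> ?j * (1 / 2) ^ \<kappa> ?j) = (4 * (1 / 2 * (1 / 2))) ^ \<kappa> ?j"
        by (simp only: power_mult_distrib)
      also have "\<dots> = 1" by simp
      finally have "real (rounds ?j) * (width ?j)\<^sup>2 = 2 ^ ?j"
        unfolding rounds_def width_def power2_eq_square of_nat_mult of_nat_power of_nat_numeral
        by (metis mult.commute mult.left_commute mult_1)
      then show ?thesis by (simp add: card_block)
    qed
    ultimately show ?thesis by (simp only: est_def card_block)
  qed
  have "emeasure (run.law t) {h \<in> space (run.law t). \<not> accurate ?j h} \<le> (\<Sum>i<n (\<kappa> ?j). emeasure (run.law t) (?B i))"
    unfolding inaccurate_eq by (rule emeasure_subadditive_finite) (use inaccurate_sets(1)[OF assms] in auto)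
  also have "\<dots> \<le> (\<Sum>i<n (\<kappa> ?j). ennreal (2 * exp (- 2 * 2 ^ ?j)))"
    by (rule sum_mono) (use B in simp)
  also have "\<dots> = ennreal (2 * n (\<kappa> ?j) * exp (- 2 * 2 ^ ?j))"
    unfolding sum_constant card_lessThan ennreal_of_nat_eq_real_of_nat
    by (subst ennreal_mult[symmetric]) (auto simp: mult_ac)
  finally show ?thesis .
qed

text \<open>Exploring and early rounds are charged 1. In the others, inaccurate estimates cost at
  most 1 and are improbable, and \<open>good\<close> covers accurate ones.\<close>

lemma regret_le:
  assumes good: "\<And>t h. j\<^sub>0 \<le> phase t \<Longrightarrow> \<not> exploring t \<Longrightarrow> accurate (phase t) h \<Longrightarrow> run.best - \<mu> (arm t h) \<le> (1 / 2) ^ t"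
  shows "regret X d \<mu> P policy t \<le> (\<Sum>s<t. if exploring s \<or> phase s < j\<^sub>0 then 1
      else 2 * n (\<kappa> (phase s)) * exp (- 2 * 2 ^ phase s) + (1 / 2) ^ s)"
proof -
  let ?c = "\<lambda>s. if exploring s \<or> phase s < j\<^sub>0 then 1 else 2 * n (\<kappa> (phase s)) * exp (- 2 * 2 ^ phase s) + (1 / 2) ^ s :: real"
  have c: "0 \<le> ?c s" for s by simp
  have one: "(\<integral>\<^sup>+h. (\<integral>\<^sup>+x. ennreal (run.best - \<mu> x) \<partial>policy s h) \<partial>run.law s) \<le> ennreal (?c s)" for s
  proof -
    interpret prob_space "run.law s" by (rule run.prob_law)
    have [measurable]: "arm s \<in> run.law s \<rightarrow>\<^sub>M arm_algebra X d"
      using arm_measurable[of s] by (simp add: measurable_cong_sets[OF run.sets_law refl])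
    have "(\<integral>\<^sup>+h. (\<integral>\<^sup>+x. ennreal (run.best - \<mu> x) \<partial>policy s h) \<partial>run.law s) = (\<integral>\<^sup>+h. ennreal (run.best - \<mu> (arm s h)) \<partial>run.law s)"
      unfolding policy_def by (intro nn_integral_cong nn_integral_return) (auto simp: arm_in)
    also have "\<dots> \<le> ennreal (?c s)"
    proof (cases "exploring s \<or> phase s < j\<^sub>0")
      case True
      have "ennreal (run.best - \<mu> (arm s h)) \<le> 1" for h
        using run.best_le_1 run.\<mu>_range(1)[OF arm_in[of s h]] by (simp add: ennreal_le_1)
      then have "(\<integral>\<^sup>+h. ennreal (run.best - \<mu> (arm s h)) \<partial>run.law s) \<le> (\<integral>\<^sup>+h. 1 \<partial>run.law s)"
        by (intro nn_integral_mono)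
      then show ?thesis using True by (simp add: emeasure_space_1)
    next
      case False
      define E where "E = {h \<in> space (run.law s). \<not> accurate (phase s) h}"
      have [measurable]: "E \<in> sets (run.law s)"
        unfolding E_def using False by (intro inaccurate_sets) auto
      have "(\<integral>\<^sup>+h. ennreal (run.best - \<mu> (arm s h)) \<partial>run.law s) \<le> (\<integral>\<^sup>+h. indicator E h + ennreal ((1 / 2) ^ s) \<partial>run.law s)"
      proof (rule nn_integral_mono)
        fix h assume h: "h \<in> space (run.law s)"
        show "ennreal (run.best - \<mu> (arm s h)) \<le> indicator E h + ennreal ((1 / 2) ^ s)"
        proof (cases "h \<in> E")
          case True
          have "ennreal (run.best - \<mu> (arm s h)) \<le> 1"
            using run.best_le_1 run.\<mu>_range(1)[OF arm_in[of s h]] by (simp add: ennreal_le_1)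
          then show ?thesis using True by (simp add: add_increasing2)
        next
          case f: False
          then have "run.best - \<mu> (arm s h) \<le> (1 / 2) ^ s"
            using h False by (intro good) (auto simp: E_def)
          then show ?thesis using f by (simp add: ennreal_leI del: power_one_over)
        qed
      qed
      also have "\<dots> = emeasure (run.law s) E + ennreal ((1 / 2) ^ s)"
        by (simp add: nn_integral_add emeasure_space_1)
      also have "\<dots> \<le> ennreal (2 * n (\<kappa> (phase s)) * exp (- 2 * 2 ^ phase s)) + ennreal ((1 / 2) ^ s)"
        using inaccurate_prob[of s] False unfolding E_def by (intro add_right_mono) auto
      also have "\<dots> = ennreal (?c s)"
        using False by (subst ennreal_plus[symmetric]) auto
      finally show ?thesis .
    qed
    finally show ?thesis .
  qed
  have "ennreal (regret X d \<mu> P policy t) \<le> (\<Sum>s<t. ennreal (?c s))"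
    unfolding run.regret_eq_sum by (rule sum_mono) (rule one)
  also have "\<dots> = ennreal (\<Sum>s<t. ?c s)" by (rule sum_ennreal) (rule c)
  finally show ?thesis by (subst (asm) ennreal_le_iff) (auto intro!: sum_nonneg)
qed

end

section \<open>The schedule of accuracies and the resulting regret rate\<close>

lemma phase_start_mono: "i \<le> j \<Longrightarrow> phase_start i \<le> phase_start j"
  by (simp add: phase_start_def)

text \<open>The ratio \<open>f t / ln t\<close> diverges at an unknown speed, so the index is raised
  only once the ratio has permanently passed the cost \<open>w\<close> of the new index. Later
  \<open>w k\<close> is the net size times \<open>4 ^ k\<close>.\<close>

lemma slow_schedule_exists:
  fixes w :: "nat \<Rightarrow> real"
  assumes f: "omega_log f"
  shows "\<exists>\<kappa>. filterlim \<kappa> at_top sequentially \<and>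
    (\<exists>J\<^sub>0. \<forall>J\<ge>J\<^sub>0. \<forall>j\<le>J. \<forall>t\<ge>phase_start J. w (\<kappa> j) \<le> f t / ln (real t))"
proof -
  define good where "good = (\<lambda>k j. \<forall>k'\<le>k. \<forall>t\<ge>phase_start j. w k' \<le> f t / ln (real t))"
  have good_mono: "good k j'" if "good k j" "j \<le> j'" for k j j'
    using that(1) order_trans[OF phase_start_mono[OF that(2)]] unfolding good_def by blast
  have ev: "\<exists>j. good k j" for k
  proof -
    have "eventually (\<lambda>t. Max (w ` {..k}) \<le> f t / ln (real t)) sequentially"
      using f unfolding omega_log_def filterlim_at_top by blast
    then obtain T where T: "\<And>t. t \<ge> T \<Longrightarrow> Max (w ` {..k}) \<le> f t / ln (real t)"
      unfolding eventually_sequentially by blast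
    have "T < 2 ^ T" by (rule less_exp)
    also have "(2::nat) ^ T \<le> 2 ^ 2 ^ T" by (intro power_increasing less_imp_le less_exp) simp
    finally have start: "T \<le> phase_start T" by (simp add: phase_start_def)
    have "w k' \<le> f t / ln (real t)" if "k' \<le> k" "t \<ge> phase_start T" for k' t
    proof -
      have "w k' \<le> Max (w ` {..k})" using that by (intro Max_ge) auto
      also have "\<dots> \<le> f t / ln (real t)" using T start that by simp
      finally show ?thesis .
    qed
    then show ?thesis unfolding good_def by blast
  qed
  \<comment> \<open>Index 0 is the default while no index is affordable; \<open>J\<^sub>0\<close>
    below marks a phase from which index 0 is affordable as well.\<close>
  define \<kappa> where "\<kappa> = (\<lambda>j. Max {k. k \<le> j \<and> (k = 0 \<or> good k j)})"
  have fin: "finite {k. k \<le> j \<and> (k = 0 \<or> good k j)}" for j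
    by (rule finite_subset[of _ "{..j}"]) auto
  have \<kappa>: "\<kappa> j = 0 \<or> good (\<kappa> j) j" for j
  proof -
    have "0 \<in> {k. k \<le> j \<and> (k = 0 \<or> good k j)}" by simp
    then have "\<kappa> j \<in> {k. k \<le> j \<and> (k = 0 \<or> good k j)}"
      unfolding \<kappa>_def by (intro Max_in fin) blast
    then show ?thesis by simp
  qed
  have "filterlim \<kappa> at_top sequentially"
    unfolding filterlim_at_top
  proof
    fix k
    obtain j where j: "good k j" using ev by blast
    have "k \<le> \<kappa> i" if "i \<ge> max k j" for i
      unfolding \<kappa>_def using that good_mono[OF j, of i] by (intro Max_ge fin) simp
    then show "eventually (\<lambda>i. k \<le> \<kappa> i) sequentially"
      unfolding eventually_sequentially by blast
  qed
  moreover obtain J\<^sub>0 where J\<^sub>0: "good 0 J\<^sub>0" using ev by blast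
  have "w (\<kappa> j) \<le> f t / ln (real t)" if "J \<ge> J\<^sub>0" "j \<le> J" "t \<ge> phase_start J" for J j t
  proof (cases "\<kappa> j = 0")
    case True
    then show ?thesis using good_mono[OF J\<^sub>0 that(1)] that(3) unfolding good_def by simp
  next
    case False
    then have "good (\<kappa> j) J" using \<kappa>[of j] good_mono[OF _ that(2)] by simp
    then show ?thesis using that(3) unfolding good_def by simp
  qed
  ultimately show ?thesis by blast
qed

lemma harmonic_sum_le: "1 \<le> t \<Longrightarrow> (\<Sum>s<t. 1 / real (Suc s)) \<le> 1 + ln (real t)"
proof -
  assume t: "1 \<le> t"
  have "harm (Suc (t - 1)) - ln (real (Suc (t - 1))) \<le> harm (Suc 0) - ln (real (Suc 0))"
    using decseq_harm_diff_ln by (rule decseqD) simp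
  then show ?thesis using t by (simp add: harm_altdef inverse_eq_divide)
qed

text \<open>The summand 2 accounts for rounds 0 and 1, which precede
  \<open>phase_start 0\<close>.\<close>

lemma (in explore_exploit) exploring_count:
  "(\<Sum>s<t. of_bool (exploring s)) \<le> 2 + (\<Sum>j\<le>phase t. real (n (\<kappa> j) * rounds j))"
proof -
  have "{s \<in> {..<t}. exploring s} \<subseteq> {..<2} \<union> (\<Union>j\<le>phase t. {phase_start j ..< phase_start j + n (\<kappa> j) * rounds j})"
  proof
    fix s assume s: "s \<in> {s \<in> {..<t}. exploring s}"
    show "s \<in> {..<2} \<union> (\<Union>j\<le>phase t. {phase_start j ..< phase_start j + n (\<kappa> j) * rounds j})"
    proof (cases "s < 2")
      case False
      then have "s \<in> {phase_start (phase s) ..< phase_start (phase s) + n (\<kappa> (phase s)) * rounds (phase s)}"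
        using phase_start_phase_le[of s] s by (simp add: exploring_def)
      moreover have "phase s \<le> phase t" using s by (intro phase_mono) simp
      ultimately show ?thesis by blast
    qed simp
  qed
  then have "card {s \<in> {..<t}. exploring s} \<le> card ({..<2::nat} \<union> (\<Union>j\<le>phase t. {phase_start j ..< phase_start j + n (\<kappa> j) * rounds j}))"
    by (rule card_mono[rotated]) simp
  also have "\<dots> \<le> card {..<2::nat} + card (\<Union>j\<le>phase t. {phase_start j ..< phase_start j + n (\<kappa> j) * rounds j})"
    by (rule card_Un_le)
  also have "\<dots> \<le> 2 + (\<Sum>j\<le>phase t. n (\<kappa> j) * rounds j)"
    using card_UN_le[of "{..phase t}" "\<lambda>j. {phase_start j ..< phase_start j + n (\<kappa> j) * rounds j}"] by simp
  finally have "real (card {s \<in> {..<t}. exploring s}) \<le> real (2 + (\<Sum>j\<le>phase t. n (\<kappa> j) * rounds j))"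
    by (rule of_nat_mono)
  moreover have "(\<Sum>s<t. of_bool (exploring s)) = real (card {s \<in> {..<t}. exploring s})"
    by (simp add: of_bool_def sum.If_cases Int_def)
  ultimately show ?thesis by simp
qed

text \<open>Exploration costs at most \<open>2 + 4 * f t\<close>, as
  \<open>2 ^ phase t \<le> 2 * ln t\<close>; inaccurate estimates cost \<open>2 * q\<close> times a
  harmonic sum, at most \<open>4 * f t\<close>; the geometric losses add 2. Since
  \<open>f t \<ge> 1\<close>, this makes 12, besides the early phases.\<close>

lemma (in explore_exploit_run) regret_le_rate:
  fixes f :: "nat \<Rightarrow> real"
  assumes good: "\<And>t h. j\<^sub>0 \<le> phase t \<Longrightarrow> \<not> exploring t \<Longrightarrow> accurate (phase t) h \<Longrightarrow> run.best - \<mu> (arm t h) \<le> (1 / 2) ^ t"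
    and sched: "\<And>j. j \<le> phase t \<Longrightarrow> real (n (\<kappa> j) * 4 ^ \<kappa> j) \<le> f t / ln (real t)"
    and t: "4 \<le> t"
  shows "regret X d \<mu> P policy t \<le> (12 + phase_start j\<^sub>0) * f t"
proof -
  define q where "q = f t / ln (real t)"
  have "exp 1 \<le> (4 :: real)" using exp_le by simp
  then have ln: "1 \<le> ln (real t)" using t by (subst ln_ge_iff) auto
  have f_eq: "f t = q * ln (real t)" using ln by (simp add: q_def)
  have nq: "real (n (\<kappa> j)) \<le> q" "real (n (\<kappa> j) * rounds j) \<le> q * 2 ^ j" if "j \<le> phase t" for j
  proof -
    have "real (n (\<kappa> j)) * 1 \<le> real (n (\<kappa> j)) * 4 ^ \<kappa> j" by (intro mult_left_mono) auto
    then show "real (n (\<kappa> j)) \<le> q" using sched[OF that] by (simp add: q_def)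
    have "real (n (\<kappa> j) * rounds j) = real (n (\<kappa> j) * 4 ^ \<kappa> j) * 2 ^ j" by (simp add: rounds_def)
    also have "\<dots> \<le> q * 2 ^ j" using sched[OF that] unfolding q_def by (intro mult_right_mono) auto
    finally show "real (n (\<kappa> j) * rounds j) \<le> q * 2 ^ j" .
  qed
  have q1: "1 \<le> q" using nq(1)[of 0] n_pos[of "\<kappa> 0"] by simp
  have f1: "1 \<le> f t" unfolding f_eq using mult_mono[OF q1 ln] q1 by simp
  have "regret X d \<mu> P policy t \<le> (\<Sum>s<t. if exploring s \<or> phase s < j\<^sub>0 then 1
      else 2 * n (\<kappa> (phase s)) * exp (- 2 * 2 ^ phase s) + (1 / 2) ^ s)"
    by (rule regret_le[OF good])
  also have "\<dots> \<le> (\<Sum>s<t. of_bool (exploring s) + of_bool (phase s < j\<^sub>0) + (2 * q * (1 / real (Suc s)) + (1 / 2) ^ s))"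
  proof (rule sum_mono)
    fix s assume s: "s \<in> {..<t}"
    have "2 * n (\<kappa> (phase s)) * exp (- 2 * 2 ^ phase s) \<le> 2 * q * (1 / real (Suc s))"
      using nq(1)[OF phase_mono[of s t]] s q1 exp_phase_le[of s] by (intro mult_mono) auto
    moreover have "0 \<le> 2 * q * (1 / real (Suc s)) + (1 / 2) ^ s" using q1 by simp
    ultimately show "(if exploring s \<or> phase s < j\<^sub>0 then 1 else 2 * n (\<kappa> (phase s)) * exp (- 2 * 2 ^ phase s) + (1 / 2) ^ s)
      \<le> of_bool (exploring s) + of_bool (phase s < j\<^sub>0) + (2 * q * (1 / real (Suc s)) + (1 / 2) ^ s)"
      by (auto simp: of_bool_def)
  qed
  also have "\<dots> = (\<Sum>s<t. of_bool (exploring s)) + (\<Sum>s<t. of_bool (phase s < j\<^sub>0)) +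
      (2 * q * (\<Sum>s<t. 1 / real (Suc s)) + (\<Sum>s<t. (1 / 2) ^ s))"
    by (simp only: sum.distrib sum_distrib_left)
  also have "\<dots> \<le> (2 + 4 * f t) + phase_start j\<^sub>0 + (4 * f t + 2)"
  proof (intro add_mono)
    have "(\<Sum>s<t. of_bool (exploring s)) \<le> 2 + (\<Sum>j\<le>phase t. real (n (\<kappa> j) * rounds j))"
      by (rule exploring_count)
    also have "\<dots> \<le> 2 + (\<Sum>j\<le>phase t. q * 2 ^ j)"
      by (intro add_left_mono sum_mono nq) simp
    also have "(\<Sum>j\<le>phase t. q * 2 ^ j) = q * (2 ^ Suc (phase t) - 1)"
      using power_diff_1_eq[of "2 :: real" "Suc (phase t)"]
      by (simp only: sum_distrib_left[symmetric] lessThan_Suc_atMost[symmetric]) simp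
    also have "\<dots> \<le> q * (2 * (2 * ln (real t)))"
      using two_power_phase_le[of t] t q1 by (intro mult_left_mono) auto
    also have "\<dots> = 4 * f t" by (simp add: f_eq)
    finally show "(\<Sum>s<t. of_bool (exploring s)) \<le> 2 + 4 * f t" by simp
  next
    have "(\<Sum>s<t. of_bool (phase s < j\<^sub>0)) = real (card {s \<in> {..<t}. phase s < j\<^sub>0})"
      by (simp add: of_bool_def sum.If_cases Int_def)
    also have "card {s \<in> {..<t}. phase s < j\<^sub>0} \<le> card {..<phase_start j\<^sub>0}"
      using phase_ge[of j\<^sub>0] by (intro card_mono) (auto simp: not_less[symmetric])
    finally show "(\<Sum>s<t. of_bool (phase s < j\<^sub>0)) \<le> real (phase_start j\<^sub>0)" by simp
  next
    have "2 * q * (\<Sum>s<t. 1 / real (Suc s)) \<le> 2 * q * (2 * ln (real t))"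
      using harmonic_sum_le[of t] t ln q1 by (intro mult_left_mono) auto
    then show "2 * q * (\<Sum>s<t. 1 / real (Suc s)) \<le> 4 * f t" by (simp add: f_eq)
  next
    show "(\<Sum>s<t. (1 / 2) ^ s) \<le> (2 :: real)"
      by (simp add: sum_gp_strict)
  qed
  also have "\<dots> \<le> (12 + phase_start j\<^sub>0) * f t"
    using mult_left_mono[OF f1, of "4 + phase_start j\<^sub>0"] by (simp add: distrib_right)
  finally show ?thesis .
qed

section \<open>The dichotomy\<close>

lemma (in Metric_space) finite_net_exists:
  assumes tb: "mtotally_bounded M" and ne: "M \<noteq> {}" and e: "0 < e"
  shows "\<exists>(N :: nat) g. 0 < N \<and> (\<forall>i<N. g i \<in> M) \<and>
    (\<forall>c\<in>completion_space M d. \<exists>i<N. completion_dist M d (completion_embed M d (g i)) c \<le> e)"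
proof -
  interpret C: Metric_space "completion_space M d" "completion_dist M d"
    by (rule Metric_space_completion)
  let ?D = "completion_dist M d" and ?e = "completion_embed M d"
  obtain F where F: "finite F" "F \<subseteq> M" "M \<subseteq> (\<Union>x\<in>F. mball x (e / 2))"
    using tb e unfolding mtotally_bounded_def by (meson half_gt_zero)
  have "F \<noteq> {}" using F(3) ne by auto
  obtain g where g: "bij_betw g {0..<card F} F"
    using ex_bij_betw_nat_finite[OF F(1)] by blast
  show ?thesis
  proof (rule exI[of _ "card F"], rule exI[of _ g], intro conjI allI ballI impI)
    show "0 < card F" using F(1) \<open>F \<noteq> {}\<close> by (simp add: card_gt_0_iff)
    show "g i \<in> M" if "i < card F" for i
      using bij_betw_apply[OF g, of i] that F(2) by auto
    fix c assume c: "c \<in> completion_space M d"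
    obtain y where y: "y \<in> M" "?D (?e y) c < e / 2"
      using completion_approx[OF c, of "e / 2"] e by auto
    obtain x where x: "x \<in> F" "y \<in> mball x (e / 2)" using F(3) y(1) by blast
    obtain i where i: "i < card F" "g i = x"
      using g x(1) unfolding bij_betw_def by (metis atLeastLessThan_iff imageE)
    have "?D (?e x) c \<le> d x y + ?D (?e y) c"
      using C.triangle[of "?e x" "?e y" c] x y c by (simp add: completion_embed_in completion_embed_isometry)
    then show "\<exists>i<card F. ?D (?e (g i)) c \<le> e"
      using i x y by (intro exI[of _ i]) auto
  qed
qed

lemma tractable_omega_log:
  assumes metric: "Metric_space X d" and ne: "X \<noteq> {}"
    and compact: "compact_space (Metric_space.mtopology (completion_space X d) (completion_dist X d))"
    and countable: "countable (completion_space X d)"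
    and f: "omega_log f"
  shows "tractable X d f"
proof -
  interpret Metric_space X d by (rule metric)
  interpret C: Metric_space "completion_space X d" "completion_dist X d"
    by (rule Metric_space_completion)
  let ?K = "completion_space X d" and ?D = "completion_dist X d" and ?e = "completion_embed X d"
  have tb: "mtotally_bounded X" using compact compact_completion_iff by blast
  have "\<forall>k. \<exists>(N :: nat) g. 0 < N \<and> (\<forall>i<N. g i \<in> X) \<and> (\<forall>c\<in>?K. \<exists>i<N. ?D (?e (g i)) c \<le> (1 / 2) ^ k)"
    using finite_net_exists[OF tb ne] by simp
  then obtain n :: "nat \<Rightarrow> nat" and net where n_pos: "\<And>k. 0 < n k" and net_in: "\<And>k i. i < n k \<Longrightarrow> net k i \<in> X"
    and cover: "\<And>k c. c \<in> ?K \<Longrightarrow> \<exists>i<n k. ?D (?e (net k i)) c \<le> (1 / 2) ^ k"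
    by metis
  obtain \<kappa> J\<^sub>0 where \<kappa>: "filterlim \<kappa> at_top sequentially"
    and sched: "\<And>J j t. J \<ge> J\<^sub>0 \<Longrightarrow> j \<le> J \<Longrightarrow> t \<ge> phase_start J \<Longrightarrow> real (n (\<kappa> j) * 4 ^ \<kappa> j) \<le> f t / ln (real t)"
    using slow_schedule_exists[OF f, of "\<lambda>k. real (n k * 4 ^ k)"] by blast
  from optimum_selector_exists[OF compact countable ne]
  obtain \<sigma> where \<sigma>: "\<forall>\<mu>. (\<forall>x\<in>X. \<forall>y\<in>X. \<bar>\<mu> x - \<mu> y\<bar> \<le> d x y) \<longrightarrow> bdd_above (\<mu> ` X) \<longrightarrow>
    (\<exists>c\<in>?K. \<exists>\<delta>>0. (\<forall>y\<in>X. (SUP x\<in>X. \<mu> x) \<le> \<mu> y + ?D (?e y) c) \<and>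
      (\<forall>F. closedin C.mtopology F \<longrightarrow>
        (\<forall>b\<in>?K. (\<forall>y\<in>X. (SUP x\<in>X. \<mu> x) \<le> \<mu> y + ?D (?e y) b) \<longrightarrow> b \<in> F) \<longrightarrow>
        (\<forall>b\<in>F. \<forall>y\<in>X. (SUP x\<in>X. \<mu> x) - \<delta> \<le> \<mu> y + ?D (?e y) b) \<longrightarrow> \<sigma> F = c))"
    by (elim exE)
  \<comment> \<open>The estimate of the optimal set to which the selector is applied: closed balls
    in the completion about the active arms.\<close>
  define region where "region = (\<lambda>j S. \<Union>i\<in>S. C.mcball (?e (net (\<kappa> j) i)) ((1 / 2) ^ \<kappa> j))"
  \<comment> \<open>The selected point may lie outside \<open>X\<close>, so an arm within
    \<open>(1 / 2) ^ t\<close> replaces it. Should \<open>\<sigma>\<close> leave the completion, any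
    arm will do.\<close>
  define rule where "rule = (\<lambda>t S. SOME y. y \<in> X \<and>
    (\<sigma> (region (phase t) S) \<in> ?K \<longrightarrow> ?D (?e y) (\<sigma> (region (phase t) S)) < (1 / 2) ^ t))"
  have rule: "rule t S \<in> X \<and>
    (\<sigma> (region (phase t) S) \<in> ?K \<longrightarrow> ?D (?e (rule t S)) (\<sigma> (region (phase t) S)) < (1 / 2) ^ t)" for t S
    unfolding rule_def
  proof (rule someI_ex)
    show "\<exists>y. y \<in> X \<and> (\<sigma> (region (phase t) S) \<in> ?K \<longrightarrow> ?D (?e y) (\<sigma> (region (phase t) S)) < (1 / 2) ^ t)"
    proof (cases "\<sigma> (region (phase t) S) \<in> ?K")
      case True
      then show ?thesis using completion_approx[OF True, of "(1 / 2) ^ t"] by auto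
    next
      case False
      then show ?thesis using ne by auto
    qed
  qed
  interpret E: explore_exploit X d net n \<kappa> rule
    by (rule explore_exploit.intro[OF metric net_in n_pos conjunct1[OF rule]])
  have "\<exists>B. \<forall>t\<ge>1. regret X d \<mu> P E.policy t \<le> B * f t" if inst: "lipschitz_instance X d \<mu> P" for \<mu> P
  proof -
    interpret R: explore_exploit_run X d net n \<kappa> rule \<mu> P
      by (intro explore_exploit_run.intro explore_exploit_run_axioms.intro E.explore_exploit_axioms ne inst)
    have "\<exists>c\<in>?K. \<exists>\<delta>>0. (\<forall>y\<in>X. R.run.best \<le> \<mu> y + ?D (?e y) c) \<and>
      (\<forall>F. closedin C.mtopology F \<longrightarrow>
        (\<forall>b\<in>?K. (\<forall>y\<in>X. R.run.best \<le> \<mu> y + ?D (?e y) b) \<longrightarrow> b \<in> F) \<longrightarrow>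
        (\<forall>b\<in>F. \<forall>y\<in>X. R.run.best - \<delta> \<le> \<mu> y + ?D (?e y) b) \<longrightarrow> \<sigma> F = c)"
      by (rule \<sigma>[THEN spec, THEN mp, THEN mp]) (auto intro: R.run.\<mu>_lipschitz R.run.bdd_\<mu>)
    then obtain c \<delta> where c: "c \<in> ?K" and \<delta>: "\<delta> > 0" and opt: "\<forall>y\<in>X. R.run.best \<le> \<mu> y + ?D (?e y) c"
      and select: "\<forall>F. closedin C.mtopology F \<longrightarrow>
        (\<forall>b\<in>?K. (\<forall>y\<in>X. R.run.best \<le> \<mu> y + ?D (?e y) b) \<longrightarrow> b \<in> F) \<longrightarrow>
        (\<forall>b\<in>F. \<forall>y\<in>X. R.run.best - \<delta> \<le> \<mu> y + ?D (?e y) b) \<longrightarrow> \<sigma> F = c"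
      by (elim bexE exE conjE)
    \<comment> \<open>The 7 consists of 2 for the estimate of an arm near an optimum, 3 for the
      slack in \<open>active\<close>, 1 for the estimate of the active arm itself and 1 for the
      radius of its ball.\<close>
    obtain k\<^sub>0 where k\<^sub>0: "(1 / 2) ^ k\<^sub>0 < \<delta> / 7"
      using real_arch_pow_inv[of "\<delta> / 7" "1 / 2"] \<delta> by auto
    obtain j\<^sub>0 where j\<^sub>0: "\<And>j. j \<ge> j\<^sub>0 \<Longrightarrow> k\<^sub>0 \<le> \<kappa> j"
      using \<kappa> unfolding filterlim_at_top eventually_sequentially by blast
    have good: "R.run.best - \<mu> (E.arm t h) \<le> (1 / 2) ^ t"
      if t: "j\<^sub>0 \<le> phase t" "\<not> E.exploring t" and acc: "R.accurate (phase t) h" for t h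
    proof -
      define j where "j = phase t"
      define r where "r = E.width j"
      have r_eq: "r = (1 / 2) ^ \<kappa> j" by (simp add: r_def E.width_def)
      have "r \<le> (1 / 2) ^ k\<^sub>0" unfolding r_eq using j\<^sub>0[of j] t(1) by (intro power_decreasing) (auto simp: j_def)
      then have r7: "7 * r \<le> \<delta>" using k\<^sub>0 by linarith
      let ?p = "net (\<kappa> j)" and ?N = "n (\<kappa> j)"
      define S where "S = E.active j h"
      have est: "\<bar>E.est j i h - \<mu> (?p i)\<bar> \<le> r" if "i < ?N" for i
        using acc that by (simp add: R.accurate_def j_def r_def)
      have S_iff: "i \<in> S \<longleftrightarrow> i < ?N \<and> (\<forall>i'<?N. E.est j i' h - 3 * r \<le> E.est j i h)" for i
        by (auto simp: S_def E.active_def r_def)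
      have near_opt: "E.est j i h \<ge> R.run.best - 2 * r"
        if "i < ?N" "?D (?e (?p i)) b \<le> r" "\<forall>y\<in>X. R.run.best \<le> \<mu> y + ?D (?e y) b" for i b
        using est[OF that(1)] bspec[OF that(3) net_in[OF that(1)]] that(2) by linarith
      have "\<sigma> (region j S) = c"
      proof (rule select[THEN spec, THEN mp, THEN mp, THEN mp]; (intro ballI impI)?)
        show "closedin C.mtopology (region j S)"
          unfolding region_def S_def E.active_def by (intro closedin_Union) auto
      next
        fix b assume b: "b \<in> ?K" "\<forall>y\<in>X. R.run.best \<le> \<mu> y + ?D (?e y) b"
        obtain i where i: "i < ?N" "?D (?e (?p i)) b \<le> r" using cover[OF b(1)] r_eq by blast
        have "E.est j i' h - 3 * r \<le> E.est j i h" if "i' < ?N" for i'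
          using est[OF that] R.run.\<mu>_le_best[OF net_in[OF that]] near_opt[OF i b(2)] by linarith
        then have "i \<in> S" using i S_iff by blast
        then show "b \<in> region j S"
          using i b(1) completion_embed_in[OF net_in[OF i(1)]] by (auto simp: region_def r_eq)
      next
        fix b y assume b: "b \<in> region j S" and y: "y \<in> X"
        then obtain i where i: "i \<in> S" "b \<in> ?K" "?D (?e (?p i)) b \<le> r"
          by (auto simp: region_def r_eq)
        have iN: "i < ?N" using i S_iff by blast
        obtain i' where i': "i' < ?N" "?D (?e (?p i')) c \<le> r" using cover[OF c] r_eq by blast
        have "E.est j i' h - 3 * r \<le> E.est j i h" using i(1) i'(1) S_iff by blast
        then have "R.run.best - 6 * r \<le> \<mu> (?p i)"
          using near_opt[OF i' opt] est[OF iN] by linarith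
        moreover have "\<mu> (?p i) - \<mu> y \<le> d (?p i) y"
          using R.run.\<mu>_lipschitz[OF net_in[OF iN] y] by linarith
        moreover have "d (?p i) y \<le> ?D (?e (?p i)) b + ?D (?e y) b"
          using C.triangle[of "?e (?p i)" b "?e y"] C.commute[of b "?e y"] net_in[OF iN] y i(2)
          by (simp add: completion_embed_in completion_embed_isometry)
        ultimately show "R.run.best - \<delta> \<le> \<mu> y + ?D (?e y) b" using i(3) r7 by linarith
      qed
      then have "?D (?e (rule t S)) c < (1 / 2) ^ t"
        using rule[of t S] c by (simp add: j_def)
      moreover have "E.arm t h = rule t S" using t(2) by (simp add: E.arm_def S_def j_def)
      ultimately show ?thesis using bspec[OF opt, of "rule t S"] rule[of t S] by simp
    qed
    define T where "T = phase_start (max J\<^sub>0 1)"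
    have late: "regret X d \<mu> P E.policy t \<le> (12 + phase_start j\<^sub>0) * f t" if t: "t \<ge> T" for t
    proof (rule R.regret_le_rate[OF good])
      have "phase_start 1 \<le> T" unfolding T_def by (rule phase_start_mono) simp
      then show "4 \<le> t" using t by (simp add: phase_start_def)
      then have "t \<ge> phase_start (phase t)" by (intro phase_start_phase_le) simp
      moreover have "J\<^sub>0 \<le> phase t" using phase_ge[of "max J\<^sub>0 1" t] t by (simp add: T_def)
      ultimately show "real (n (\<kappa> j) * 4 ^ \<kappa> j) \<le> f t / ln (real t)" if "j \<le> phase t" for j
        using sched that by blast
    qed
    \<comment> \<open>Finitely many times precede \<open>T\<close>; as \<open>f\<close> is positive
      there, their ratios can be added to the constant.\<close>
    define B where "B = 12 + phase_start j\<^sub>0 + (\<Sum>t=1..<T. \<bar>regret X d \<mu> P E.policy t\<bar> / f t)"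
    have f_pos: "0 < f t" if "t \<ge> 1" for t using f that by (simp add: omega_log_def)
    have "regret X d \<mu> P E.policy t \<le> B * f t" if t: "t \<ge> 1" for t
    proof (cases "t \<ge> T")
      case True
      have "(12 + phase_start j\<^sub>0) * f t \<le> B * f t"
        unfolding B_def using f_pos by (intro mult_right_mono) (auto intro!: sum_nonneg divide_nonneg_pos less_imp_le[OF f_pos] t)
      then show ?thesis using late[OF True] by linarith
    next
      case False
      have "\<bar>regret X d \<mu> P E.policy t\<bar> / f t \<le> (\<Sum>t=1..<T. \<bar>regret X d \<mu> P E.policy t\<bar> / f t)"
        using False t f_pos by (intro member_le_sum) (auto intro!: divide_nonneg_pos)
      also have "\<dots> \<le> B" by (simp add: B_def)
      finally have "\<bar>regret X d \<mu> P E.policy t\<bar> \<le> B * f t" using f_pos[OF t] by (simp add: pos_divide_le_eq)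
      then show ?thesis by linarith
    qed
    then show ?thesis by blast
  qed
  then show ?thesis
    unfolding tractable_def using E.policy_algorithm by blast
qed

text \<open>A rate in both classes shows that the two alternatives exclude each other.\<close>

lemma omega_log_and_little_o_sqrt: "\<exists>f. omega_log f \<and> little_o_sqrt f"
proof (intro exI conjI)
  let ?f = "\<lambda>t :: nat. real t powr (1 / 4)"
  have "filterlim (\<lambda>t :: nat. real t powr (1 / 4) / ln (real t)) at_top sequentially"
    by real_asymp
  then show "omega_log ?f" by (simp add: omega_log_def)
  show "little_o_sqrt ?f" unfolding little_o_sqrt_def by real_asymp
qed

theorem theorem1p6:
  fixes X :: "'a set" and d :: "'a \<Rightarrow> 'a \<Rightarrow> real"
  assumes "Metric_space X d" and "X \<noteq> {}" and "\<forall>x\<in>X. \<forall>y\<in>X. d x y \<le> 1"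
  shows "((\<forall>f. omega_log f \<longrightarrow> tractable X d f) \<or>
          (\<forall>g. little_o_sqrt g \<longrightarrow> \<not> tractable X d g)) \<and>
         \<not> ((\<forall>f. omega_log f \<longrightarrow> tractable X d f) \<and>
            (\<forall>g. little_o_sqrt g \<longrightarrow> \<not> tractable X d g)) \<and>
         ((\<forall>f. omega_log f \<longrightarrow> tractable X d f) \<longleftrightarrow>
          compact_space (Metric_space.mtopology (completion_space X d) (completion_dist X d)) \<and>
          countable (completion_space X d))"
proof -
  let ?log = "\<forall>f. omega_log f \<longrightarrow> tractable X d f"
  let ?sqrt = "\<forall>g. little_o_sqrt g \<longrightarrow> \<not> tractable X d g"
  let ?cc = "compact_space (Metric_space.mtopology (completion_space X d) (completion_dist X d)) \<and>
    countable (completion_space X d)"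
  have "?cc \<Longrightarrow> ?log"
    using tractable_omega_log[OF assms(1,2)] by simp
  moreover have "\<not> ?cc \<Longrightarrow> ?sqrt"
    using not_tractable_little_o_sqrt[OF assms(1,2)] by simp
  moreover have "\<not> (?log \<and> ?sqrt)"
    using omega_log_and_little_o_sqrt by fast
  \<comment> \<open>Off the compact countable case \<open>?sqrt\<close> holds, so exclusion refutes
    \<open>?log\<close>; this is the converse half of the equivalence.\<close>
  ultimately show ?thesis by argo
qed

end
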